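(* Let $G$ be a compact connected Lie group, $\eta\in\mathfrak g^*$, $\mathcal O$ the coadjoint orbit of $\eta$, $H$ a maximal torus of $G$ contained in the stabilizer of $\eta$, and $W$ the Weyl group of the pair $(G,H)$. Let $X,X'$ be two elements of the integer lattice of $\mathfrak h$. If there exists $w\in W$ such that $w(X)=X'$, then the circle actions defined on $\mathcal O$ by $X$ and $X'$ are $\sim$-equivalent.
   Context: $\mathcal O$ carries its standard (Kirillov–Kostant–Souriau) symplectic structure. The integer lattice of $\mathfrak h=\mathrm{Lie}(H)$ is $\{X\in\mathfrak h: e^X=1\}$; such an $X$ defines the Hamiltonian circle action $t\in\mathbb R/\mathbb Z\mapsto(\nu\mapsto e^{tX}\cdot\nu)$ on $\mathcal O$, where $\cdot$ is the coadjoint action. $\mathrm{Ham}(\mathcal O)$ is the group of Hamiltonian diffeomorphisms with its usual ($C^\infty$) topology. Two Hamiltonian circle actions $\psi,\psi':U(1)\to\mathrm{Ham}(\mathcal O)$ are $\sim$-equivalent if there is a continuous family $\{\psi^s:U(1)\to\mathrm{Ham}(\mathcal O)\}_{s\in[0,1]}$ of Lie group homomorphisms with $\psi^0=\psi$ and $\psi^1=\psi'$. *)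

theory Defs
  imports "HOL-Analysis.Analysis" "HOL-Algebra.Group_Action"
begin

section \<open>Smooth maps between normed spaces\<close>

text \<open>All normed spaces below are finite-dimensional. There the operator-norm continuity of the
  \<open>k\<close>-th derivative on an open set is equivalent to continuity of all iterated directional derivatives.\<close>

primrec Ck_on :: "nat \<Rightarrow> 'a::real_normed_vector set \<Rightarrow> ('a \<Rightarrow> 'b::real_normed_vector) \<Rightarrow> bool" where
  "Ck_on 0 S f \<longleftrightarrow> continuous_on S f"
| "Ck_on (Suc k) S f \<longleftrightarrow> (\<forall>x\<in>S. f differentiable (at x)) \<and>
     (\<forall>v. Ck_on k S (\<lambda>x. frechet_derivative f (at x) v))"

definition Cinf_on :: "'a::real_normed_vector set \<Rightarrow> ('a \<Rightarrow> 'b::real_normed_vector) \<Rightarrow> bool" where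
  "Cinf_on S f \<longleftrightarrow> (\<forall>k. Ck_on k S f)"

text \<open>Smoothness on an arbitrary subset (used for embedded submanifolds, possibly times an interval):
  existence of local smooth extensions to the ambient space.\<close>

definition smooth_on :: "'a::real_normed_vector set \<Rightarrow> ('a \<Rightarrow> 'b::real_normed_vector) \<Rightarrow> bool" where
  "smooth_on S f \<longleftrightarrow>
     (\<forall>x\<in>S. \<exists>U g. open U \<and> x \<in> U \<and> Cinf_on U g \<and> (\<forall>y\<in>S \<inter> U. g y = f y))"


section \<open>Smooth manifolds\<close>

text \<open>The model space is a type of class \<^class>\<open>real_normed_vector\<close> required to be finite-dimensional,
  rather than one of class \<^class>\<open>euclidean_space\<close>, because the latter excludes dimension 0.\<close>

definition finite_dim :: "'e::real_normed_vector itself \<Rightarrow> bool" where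
  "finite_dim _ \<longleftrightarrow> (\<exists>B::'e set. finite B \<and> span B = UNIV)"

type_synonym ('g, 'e) chart = "'g set \<times> ('g \<Rightarrow> 'e)"
type_synonym ('g, 'e) manifold = "'g topology \<times> ('g, 'e) chart set"

definition chart_inv :: "('g, 'e) chart \<Rightarrow> 'e \<Rightarrow> 'g" where
  "chart_inv c = inv_into (fst c) (snd c)"

definition smooth_manifold :: "('g, 'e::real_normed_vector) manifold \<Rightarrow> bool" where
  "smooth_manifold M \<longleftrightarrow> (case M of (T, A) \<Rightarrow>
     finite_dim TYPE('e) \<and> Hausdorff_space T \<and> second_countable T \<and>
     (\<Union>c\<in>A. fst c) = topspace T \<and>
     (\<forall>(U, \<phi>)\<in>A. openin T U \<and> open (\<phi> ` U) \<and>
        homeomorphic_map (subtopology T U) (top_of_set (\<phi> ` U)) \<phi>) \<and>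
     (\<forall>(U, \<phi>)\<in>A. \<forall>(V, \<psi>)\<in>A. Cinf_on (\<phi> ` (U \<inter> V)) (\<psi> \<circ> chart_inv (U, \<phi>))))"

definition smooth_map ::
  "('g, 'e::real_normed_vector) manifold \<Rightarrow> ('h, 'f::real_normed_vector) manifold \<Rightarrow> ('g \<Rightarrow> 'h) \<Rightarrow> bool" where
  "smooth_map M N f \<longleftrightarrow> continuous_map (fst M) (fst N) f \<and>
     (\<forall>(U, \<phi>)\<in>snd M. \<forall>(V, \<psi>)\<in>snd N.
        Cinf_on (\<phi> ` {x\<in>U. f x \<in> V}) (\<psi> \<circ> f \<circ> chart_inv (U, \<phi>)))"

definition prod_manifold ::
  "('g, 'e) manifold \<Rightarrow> ('h, 'f) manifold \<Rightarrow> ('g \<times> 'h, 'e \<times> 'f) manifold" where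
  "prod_manifold M N = (prod_topology (fst M) (fst N),
     {(U \<times> V, map_prod \<phi> \<psi>) |U \<phi> V \<psi>. (U, \<phi>) \<in> snd M \<and> (V, \<psi>) \<in> snd N})"

definition real_line :: "(real, real) manifold" where
  "real_line = (euclidean, {(UNIV, id)})"


section \<open>Lie groups\<close>

text \<open>The field \<open>id_chart\<close> is a chart around the identity. Its differential identifies the Lie algebra,
  as the tangent space at the identity, with the model space \<open>'e\<close>.\<close>

record ('g, 'e) lie_data = "'g monoid" +
  gtop :: "'g topology"
  atlas :: "('g, 'e) chart set"
  id_chart :: "('g, 'e) chart"

definition lie_manifold :: "('g, 'e, 'm) lie_data_scheme \<Rightarrow> ('g, 'e) manifold" where
  "lie_manifold G = (gtop G, atlas G)"

definition lie_group :: "('g, 'e::real_normed_vector, 'm) lie_data_scheme \<Rightarrow> bool" where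
  "lie_group G \<longleftrightarrow> group G \<and> smooth_manifold (lie_manifold G) \<and> topspace (gtop G) = carrier G \<and>
     smooth_map (prod_manifold (lie_manifold G) (lie_manifold G)) (lie_manifold G)
       (\<lambda>(g, h). g \<otimes>\<^bsub>G\<^esub> h) \<and>
     smooth_map (lie_manifold G) (lie_manifold G) (\<lambda>g. inv\<^bsub>G\<^esub> g) \<and>
     id_chart G \<in> atlas G \<and> \<one>\<^bsub>G\<^esub> \<in> fst (id_chart G)"

definition id_coord :: "('g, 'e, 'm) lie_data_scheme \<Rightarrow> 'e" where
  "id_coord G = snd (id_chart G) \<one>\<^bsub>G\<^esub>"

definition one_param_subgroup ::
  "('g, 'e::real_normed_vector, 'm) lie_data_scheme \<Rightarrow> (real \<Rightarrow> 'g) \<Rightarrow> 'e \<Rightarrow> bool" where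
  "one_param_subgroup G \<gamma> X \<longleftrightarrow> smooth_map real_line (lie_manifold G) \<gamma> \<and>
     (\<forall>s t. \<gamma> (s + t) = \<gamma> s \<otimes>\<^bsub>G\<^esub> \<gamma> t) \<and>
     ((snd (id_chart G) \<circ> \<gamma>) has_vector_derivative X) (at 0)"

definition lie_exp :: "('g, 'e::real_normed_vector, 'm) lie_data_scheme \<Rightarrow> 'e \<Rightarrow> 'g" where
  "lie_exp G X = (THE \<gamma>. one_param_subgroup G \<gamma> X) 1"

text \<open>\<open>Ad g\<close> is the differential at the identity of conjugation by \<open>g\<close>, and \<open>[X, Y] = ad X Y\<close> is the
  differential of \<open>Ad\<close> at the identity.\<close>

definition Ad :: "('g, 'e::real_normed_vector, 'm) lie_data_scheme \<Rightarrow> 'g \<Rightarrow> 'e \<Rightarrow> 'e" where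
  "Ad G g = frechet_derivative
     (\<lambda>z. snd (id_chart G) (g \<otimes>\<^bsub>G\<^esub> chart_inv (id_chart G) z \<otimes>\<^bsub>G\<^esub> inv\<^bsub>G\<^esub> g)) (at (id_coord G))"

definition bracket :: "('g, 'e::real_normed_vector, 'm) lie_data_scheme \<Rightarrow> 'e \<Rightarrow> 'e \<Rightarrow> 'e" where
  "bracket G X Y =
     frechet_derivative (\<lambda>z. Ad G (chart_inv (id_chart G) z) Y) (at (id_coord G)) X"

definition coAd ::
  "('g, 'e::real_normed_vector, 'm) lie_data_scheme \<Rightarrow> 'g \<Rightarrow> ('e \<Rightarrow>\<^sub>L real) \<Rightarrow> ('e \<Rightarrow>\<^sub>L real)" where
  "coAd G g \<nu> = Blinfun (\<lambda>Y. \<nu> (Ad G (inv\<^bsub>G\<^esub> g) Y))"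

definition coad ::
  "('g, 'e::real_normed_vector, 'm) lie_data_scheme \<Rightarrow> 'e \<Rightarrow> ('e \<Rightarrow>\<^sub>L real) \<Rightarrow> ('e \<Rightarrow>\<^sub>L real)" where
  "coad G X \<nu> = Blinfun (\<lambda>Y. - \<nu> (bracket G X Y))"

definition coadjoint_orbit ::
  "('g, 'e::real_normed_vector, 'm) lie_data_scheme \<Rightarrow> ('e \<Rightarrow>\<^sub>L real) \<Rightarrow> ('e \<Rightarrow>\<^sub>L real) set" where
  "coadjoint_orbit G \<eta> = orbit G (coAd G) \<eta>"


section \<open>Maximal tori, integer lattice, Weyl group\<close>

text \<open>A compact subgroup is closed, hence a Lie subgroup; a compact connected abelian Lie group is a
  torus.\<close>

definition torus :: "('g, 'e, 'm) lie_data_scheme \<Rightarrow> 'g set \<Rightarrow> bool" where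
  "torus G H \<longleftrightarrow> subgroup H G \<and> compactin (gtop G) H \<and> connectedin (gtop G) H \<and>
     (\<forall>x\<in>H. \<forall>y\<in>H. x \<otimes>\<^bsub>G\<^esub> y = y \<otimes>\<^bsub>G\<^esub> x)"

definition maximal_torus :: "('g, 'e, 'm) lie_data_scheme \<Rightarrow> 'g set \<Rightarrow> bool" where
  "maximal_torus G H \<longleftrightarrow> torus G H \<and> (\<forall>K. torus G K \<and> H \<subseteq> K \<longrightarrow> K = H)"

text \<open>The Lie algebra of \<open>H\<close>: those \<open>X\<close> with \<open>exp (t X) \<in> H\<close> for all \<open>t\<close>.\<close>

definition lie_subalgebra_of :: "('g, 'e::real_normed_vector, 'm) lie_data_scheme \<Rightarrow> 'g set \<Rightarrow> 'e set" where
  "lie_subalgebra_of G H = {X. \<exists>\<gamma>. one_param_subgroup G \<gamma> X \<and> range \<gamma> \<subseteq> H}"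

definition integer_lattice :: "('g, 'e::real_normed_vector, 'm) lie_data_scheme \<Rightarrow> 'g set \<Rightarrow> 'e set" where
  "integer_lattice G H = {X \<in> lie_subalgebra_of G H. lie_exp G X = \<one>\<^bsub>G\<^esub>}"

definition weyl_group :: "('g, 'e, 'm) lie_data_scheme \<Rightarrow> 'g set \<Rightarrow> 'g set monoid" where
  "weyl_group G H = (G\<lparr>carrier := normalizer G H\<rparr>) Mod H"

text \<open>The coset \<open>w\<close> acts on the Lie algebra of \<open>H\<close> by \<open>Ad\<close> of any representative; the choice is
  immaterial because \<open>H\<close> is abelian.\<close>

definition weyl_act :: "('g, 'e::real_normed_vector, 'm) lie_data_scheme \<Rightarrow> 'g set \<Rightarrow> 'e \<Rightarrow> 'e" where
  "weyl_act G w X = Ad G (SOME n. n \<in> w) X"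


section \<open>Symplectic geometry of a coadjoint orbit\<close>

text \<open>A coadjoint orbit of a compact group is an embedded submanifold of the dual of the Lie algebra,
  with tangent space \<open>{coad X \<nu> | X}\<close> at \<open>\<nu>\<close>. For a smooth map \<open>f\<close> on the orbit \<open>M\<close>, the
  derivative \<open>frechet_derivative f (at \<nu> within M)\<close> is determined only on tangent vectors, which are
  the only vectors it is applied to below.\<close>

definition tangent ::
  "('g, 'e::real_normed_vector, 'm) lie_data_scheme \<Rightarrow> ('e \<Rightarrow>\<^sub>L real) \<Rightarrow> ('e \<Rightarrow>\<^sub>L real) set" where
  "tangent G \<nu> = range (\<lambda>X. coad G X \<nu>)"

definition kks_form ::
  "('g, 'e::real_normed_vector, 'm) lie_data_scheme \<Rightarrow>
   ('e \<Rightarrow>\<^sub>L real) \<Rightarrow> ('e \<Rightarrow>\<^sub>L real) \<Rightarrow> ('e \<Rightarrow>\<^sub>L real) \<Rightarrow> real" where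
  "kks_form G \<nu> \<xi> \<zeta> =
     (THE a. \<exists>X Y. \<xi> = coad G X \<nu> \<and> \<zeta> = coad G Y \<nu> \<and> a = \<nu> (bracket G X Y))"

definition hamiltonian_vector ::
  "('g, 'e::real_normed_vector, 'm) lie_data_scheme \<Rightarrow> ('e \<Rightarrow>\<^sub>L real) set \<Rightarrow>
   (('e \<Rightarrow>\<^sub>L real) \<Rightarrow> real) \<Rightarrow> ('e \<Rightarrow>\<^sub>L real) \<Rightarrow> ('e \<Rightarrow>\<^sub>L real) \<Rightarrow> bool" where
  "hamiltonian_vector G M F \<nu> \<xi> \<longleftrightarrow> \<xi> \<in> tangent G \<nu> \<and>
     (\<forall>\<zeta>\<in>tangent G \<nu>. kks_form G \<nu> \<xi> \<zeta> = frechet_derivative F (at \<nu> within M) \<zeta>)"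

text \<open>\<open>\<Phi>\<close> is the flow of the time-dependent Hamiltonian \<open>F\<close>. As \<open>M\<close> is compact, each \<open>\<Phi> t\<close> is
  automatically a diffeomorphism.\<close>

definition hamiltonian_flow ::
  "('g, 'e::real_normed_vector, 'm) lie_data_scheme \<Rightarrow> ('e \<Rightarrow>\<^sub>L real) set \<Rightarrow>
   (real \<Rightarrow> ('e \<Rightarrow>\<^sub>L real) \<Rightarrow> real) \<Rightarrow> (real \<Rightarrow> ('e \<Rightarrow>\<^sub>L real) \<Rightarrow> ('e \<Rightarrow>\<^sub>L real)) \<Rightarrow> bool" where
  "hamiltonian_flow G M F \<Phi> \<longleftrightarrow>
     smooth_on ({0..1} \<times> M) (\<lambda>(t, \<nu>). F t \<nu>) \<and>
     smooth_on ({0..1} \<times> M) (\<lambda>(t, \<nu>). \<Phi> t \<nu>) \<and>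
     (\<forall>\<nu>\<in>M. \<Phi> 0 \<nu> = \<nu>) \<and>
     (\<forall>t\<in>{0..1}. \<forall>\<nu>\<in>M. \<Phi> t \<nu> \<in> M \<and>
        (\<exists>\<xi>. ((\<lambda>s. \<Phi> s \<nu>) has_vector_derivative \<xi>) (at t within {0..1}) \<and>
             hamiltonian_vector G M (F t) (\<Phi> t \<nu>) \<xi>))"

text \<open>Elements of \<open>Ham\<close> are maps on \<open>M\<close>, represented as functions undefined outside \<open>M\<close>.\<close>

definition Ham ::
  "('g, 'e::real_normed_vector, 'm) lie_data_scheme \<Rightarrow> ('e \<Rightarrow>\<^sub>L real) set \<Rightarrow>
   (('e \<Rightarrow>\<^sub>L real) \<Rightarrow> ('e \<Rightarrow>\<^sub>L real)) set" where
  "Ham G M = {\<phi> \<in> extensional M. \<exists>F \<Phi>. hamiltonian_flow G M F \<Phi> \<and> (\<forall>\<nu>\<in>M. \<phi> \<nu> = \<Phi> 1 \<nu>)}"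

definition vector_fields ::
  "('g, 'e::real_normed_vector, 'm) lie_data_scheme \<Rightarrow> ('e \<Rightarrow>\<^sub>L real) set \<Rightarrow>
   (('e \<Rightarrow>\<^sub>L real) \<Rightarrow> ('e \<Rightarrow>\<^sub>L real)) set" where
  "vector_fields G M = {Y. smooth_on M Y \<and> (\<forall>\<nu>\<in>M. Y \<nu> \<in> tangent G \<nu>)}"

definition iter_deriv ::
  "'v::real_normed_vector set \<Rightarrow> ('v \<Rightarrow> 'v) list \<Rightarrow> ('v \<Rightarrow> 'w::real_normed_vector) \<Rightarrow> 'v \<Rightarrow> 'w" where
  "iter_deriv M Ys f = foldr (\<lambda>Y h \<nu>. frechet_derivative h (at \<nu> within M) (Y \<nu>)) Ys f"

text \<open>The \<open>C\<^sup>\<infinity>\<close> topology: uniform convergence on the compact manifold \<open>M\<close> of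
  \<open>Y\<^sub>1 (\<dots> (Y\<^sub>k \<phi>))\<close> for all finite lists of smooth vector fields, maps into \<open>M\<close> being regarded as
  maps into the ambient vector space.\<close>

definition Ham_topology ::
  "('g, 'e::real_normed_vector, 'm) lie_data_scheme \<Rightarrow> ('e \<Rightarrow>\<^sub>L real) set \<Rightarrow>
   (('e \<Rightarrow>\<^sub>L real) \<Rightarrow> ('e \<Rightarrow>\<^sub>L real)) topology" where
  "Ham_topology G M = topology_generated_by
     {{\<psi> \<in> Ham G M. (SUP \<nu>\<in>M. norm (iter_deriv M Ys \<psi> \<nu> - iter_deriv M Ys \<phi> \<nu>)) < \<epsilon>} |\<phi> Ys \<epsilon>.
        \<phi> \<in> Ham G M \<and> set Ys \<subseteq> vector_fields G M \<and> \<epsilon> > 0}"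


section \<open>Hamiltonian circle actions\<close>

text \<open>\<open>U(1) = \<real>/\<int>\<close>, so a homomorphism from \<open>U(1)\<close> is one from \<open>\<real>\<close> that is trivial at 1. Smoothness of
  a map into the group \<open>Ham\<close> means joint smoothness of the action map.\<close>

definition hamiltonian_circle_action ::
  "('g, 'e::real_normed_vector, 'm) lie_data_scheme \<Rightarrow> ('e \<Rightarrow>\<^sub>L real) set \<Rightarrow>
   (real \<Rightarrow> ('e \<Rightarrow>\<^sub>L real) \<Rightarrow> ('e \<Rightarrow>\<^sub>L real)) \<Rightarrow> bool" where
  "hamiltonian_circle_action G M \<psi> \<longleftrightarrow> (\<forall>t. \<psi> t \<in> Ham G M) \<and>
     (\<forall>s t. \<psi> (s + t) = compose M (\<psi> s) (\<psi> t)) \<and> \<psi> 1 = restrict id M \<and>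
     smooth_on (UNIV \<times> M) (\<lambda>(t, \<nu>). \<psi> t \<nu>)"

definition circle_equivalent ::
  "('g, 'e::real_normed_vector, 'm) lie_data_scheme \<Rightarrow> ('e \<Rightarrow>\<^sub>L real) set \<Rightarrow>
   (real \<Rightarrow> ('e \<Rightarrow>\<^sub>L real) \<Rightarrow> ('e \<Rightarrow>\<^sub>L real)) \<Rightarrow> (real \<Rightarrow> ('e \<Rightarrow>\<^sub>L real) \<Rightarrow> ('e \<Rightarrow>\<^sub>L real)) \<Rightarrow> bool" where
  "circle_equivalent G M \<psi> \<psi>' \<longleftrightarrow> (\<exists>\<Psi>.
     (\<forall>s\<in>{0..1}. hamiltonian_circle_action G M (\<Psi> s)) \<and>
     continuous_map (top_of_set ({0..1::real} \<times> UNIV)) (Ham_topology G M) (\<lambda>(s, t). \<Psi> s t) \<and>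
     \<Psi> 0 = \<psi> \<and> \<Psi> 1 = \<psi>')"

definition circle_action ::
  "('g, 'e::real_normed_vector, 'm) lie_data_scheme \<Rightarrow> ('e \<Rightarrow>\<^sub>L real) set \<Rightarrow> 'e \<Rightarrow>
   real \<Rightarrow> ('e \<Rightarrow>\<^sub>L real) \<Rightarrow> ('e \<Rightarrow>\<^sub>L real)" where
  "circle_action G M X t = restrict (coAd G (lie_exp G (t *\<^sub>R X))) M"

end

theory Submission
  imports Defs
begin

text \<open>A Weyl group element is represented by some \<open>n\<close> in \<open>G\<close>, and \<open>G\<close>, being a connected manifold, contains a path
\<open>n\<^sub>s\<close> from the identity to \<open>n\<close>. Put \<open>X\<^sub>s = Ad n\<^sub>s X\<close>. Since
\<open>exp (t X\<^sub>s) = n\<^sub>s exp (t X) n\<^sub>s\<^sup>-\<^sup>1\<close>, every \<open>X\<^sub>s\<close> exponentiates to the identity, even though it usually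
leaves the Lie algebra of the torus. So the \<open>X\<^sub>s\<close> all define circle actions on the orbit, and these
join the action of \<open>X\<close> to that of \<open>Ad n X = X'\<close>. It remains to see that each of them is Hamiltonian and
that they vary continuously in the smooth topology.

The action of \<open>X\<close> is the flow of the linear function \<open>\<nu> \<mapsto> \<nu> X\<close> (\<open>hamiltonian_flow_coAd\<close>). Its
derivative along \<open>coad Y \<nu>\<close> is \<open>- \<nu> [Y, X]\<close>, while the Kirillov-Kostant-Souriau form gives
\<open>\<nu> [X, Y]\<close>; the two agree because the bracket is antisymmetric, which also makes the form well defined.
With the bracket defined as the derivative of \<open>Ad\<close>, antisymmetry comes from writing the bracket as the
difference of two mixed second derivatives of the group multiplication in a chart
(\<open>bracket_eq_mixed_derivatives\<close>), since such derivatives commute.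

The exponential map enters only along the vectors \<open>t X\<^sub>s\<close>. There the one-parameter subgroups are
obtained by conjugating and rescaling the one given with \<open>X\<close>, and they determine the exponential by
uniqueness (\<open>one_param_subgroup_unique\<close>).

For the continuity, each map \<open>coAd g\<close> is the restriction of a linear map \<open>L\<close> of the dual of the Lie
algebra. Differentiating \<open>L\<close> on the orbit along vector fields gives \<open>L\<close> applied to the corresponding
derivatives of the identity map (\<open>iter_deriv_linear\<close>), and these are bounded because the orbit is compact.
Hence a family of linear maps that depends continuously on a parameter is continuous in the smooth
topology (\<open>Ham_topology_continuous_linear\<close>).

The model space of a manifold is a finite-dimensional normed space without a preferred inner product.
Bounded coordinate functionals (\<open>finite_dim_coordinates\<close>) take the place of an orthonormal basis;
they turn iterated directional derivatives into a calculus with chain and product rules.\<close>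

section \<open>Finite-dimensional normed spaces\<close>

text \<open>Induction over the basis. The span of the vectors already treated is closed, because its coordinates
converge along every convergent sequence by the induction hypothesis. The next basis vector \<open>v\<close> thus
has a positive distance \<open>d\<close> from that span, which bounds the coefficient of \<open>v\<close>.\<close>

lemma coordinates_bounded_by_norm:
  fixes B :: "'e::real_normed_vector set"
  assumes "finite B" "independent B"
  shows "\<exists>C. \<forall>a. (\<Sum>b\<in>B. \<bar>a b\<bar>) \<le> C * norm (\<Sum>b\<in>B. a b *\<^sub>R b)"
  using assms
proof (induction B)
  case empty
  show ?case by simp
next
  case (insert v B)
  have ind: "independent B" and v: "v \<notin> span B"
    using insert.prems insert.hyps by (auto simp: independent_insert)
  obtain C0 where C0: "(\<Sum>b\<in>B. \<bar>a b\<bar>) \<le> C0 * norm (\<Sum>b\<in>B. a b *\<^sub>R b)" for a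
    using insert.IH[OF ind] by blast
  define C where "C = \<bar>C0\<bar> + 1"
  have Cpos: "C > 0" by (simp add: C_def)
  have C: "(\<Sum>b\<in>B. \<bar>a b\<bar>) \<le> C * norm (\<Sum>b\<in>B. a b *\<^sub>R b)" for a
  proof -
    have "C0 * norm (\<Sum>b\<in>B. a b *\<^sub>R b) \<le> C * norm (\<Sum>b\<in>B. a b *\<^sub>R b)"
      by (rule mult_right_mono) (auto simp: C_def)
    then show ?thesis using C0[of a] by linarith
  qed
  have "closed (span B)"
    unfolding closed_sequential_limits
  proof (intro allI impI, elim conjE)
    fix w l assume wB: "\<forall>n. w n \<in> span B" and wl: "w \<longlonglongrightarrow> l"
    have "\<forall>n. \<exists>a. w n = (\<Sum>b\<in>B. a b *\<^sub>R b)"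
      using wB insert.hyps(1) by (auto simp: span_finite image_iff)
    then obtain a where a: "\<And>n. w n = (\<Sum>b\<in>B. a n b *\<^sub>R b)" by metis
    have diff: "\<bar>a n b - a m b\<bar> \<le> C * norm (w n - w m)" if "b \<in> B" for n m b
    proof -
      have "\<bar>a n b - a m b\<bar> \<le> (\<Sum>b\<in>B. \<bar>a n b - a m b\<bar>)"
        using insert.hyps(1) that by (intro member_le_sum) auto
      also have "\<dots> \<le> C * norm (\<Sum>b\<in>B. (a n b - a m b) *\<^sub>R b)" by (rule C)
      also have "\<dots> = C * norm (w n - w m)"
        by (simp add: a scaleR_left_diff_distrib sum_subtractf)
      finally show ?thesis .
    qed
    have "convergent (\<lambda>n. a n b)" if b: "b \<in> B" for b
    proof -
      have "Cauchy w" using wl LIMSEQ_imp_Cauchy by blast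
      have "Cauchy (\<lambda>n. a n b)"
      proof (rule metric_CauchyI)
        fix e :: real assume "e > 0"
        then obtain M where M: "\<forall>m\<ge>M. \<forall>n\<ge>M. dist (w m) (w n) < e / C"
          using \<open>Cauchy w\<close> Cpos unfolding Cauchy_def by (meson divide_pos_pos)
        show "\<exists>M. \<forall>m\<ge>M. \<forall>n\<ge>M. dist (a m b) (a n b) < e"
        proof (intro exI allI impI)
          fix m n assume "M \<le> m" "M \<le> n"
          then have "norm (w m - w n) < e / C" using M by (simp add: dist_norm)
          then have "C * norm (w m - w n) < e" using Cpos by (simp add: field_simps)
          then show "dist (a m b) (a n b) < e"
            using diff[OF b, of m n] by (simp add: dist_real_def)
        qed
      qed
      then show ?thesis by (simp add: Cauchy_convergent_iff)
    qed
    then obtain \<alpha> where \<alpha>: "\<And>b. b \<in> B \<Longrightarrow> (\<lambda>n. a n b) \<longlonglongrightarrow> \<alpha> b"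
      unfolding convergent_def by metis
    have "w \<longlonglongrightarrow> (\<Sum>b\<in>B. \<alpha> b *\<^sub>R b)"
      unfolding a using \<alpha> by (intro tendsto_sum tendsto_scaleR tendsto_const) auto
    then have "l = (\<Sum>b\<in>B. \<alpha> b *\<^sub>R b)" using wl LIMSEQ_unique by blast
    then show "l \<in> span B" by (simp add: span_sum span_scale span_base)
  qed
  moreover have "- v \<in> - span B" using v by (metis ComplI add.inverse_inverse span_neg)
  ultimately obtain d where d: "d > 0" "ball (- v) d \<subseteq> - span B"
    by (meson open_Compl open_contains_ball)
  have dist_v: "d \<le> norm (v + u)" if "u \<in> span B" for u
  proof (rule ccontr)
    assume "\<not> d \<le> norm (v + u)"
    then have "u \<in> ball (- v) d"
      by (simp add: dist_norm norm_minus_commute add.commute)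
    then show False using d(2) that by blast
  qed
  have "(\<Sum>b\<in>insert v B. \<bar>a b\<bar>) \<le> (1 / d + C * (1 + norm v / d)) * norm (\<Sum>b\<in>insert v B. a b *\<^sub>R b)" for a
  proof -
    define u where "u = (\<Sum>b\<in>B. a b *\<^sub>R b)"
    define N where "N = norm (a v *\<^sub>R v + u)"
    have u: "u \<in> span B" by (simp add: u_def span_sum span_scale span_base)
    have av: "\<bar>a v\<bar> * d \<le> N"
    proof (cases "a v = 0")
      case False
      have "\<bar>a v\<bar> * d \<le> \<bar>a v\<bar> * norm (v + (1 / a v) *\<^sub>R u)"
        using dist_v[OF span_scale[OF u]] by (intro mult_left_mono) auto
      also have "\<dots> = norm (a v *\<^sub>R (v + (1 / a v) *\<^sub>R u))" by simp
      also have "\<dots> = N" using False by (simp add: N_def scaleR_add_right)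
      finally show ?thesis .
    qed (simp add: N_def)
    then have av': "\<bar>a v\<bar> \<le> N / d" using d(1) by (simp add: pos_le_divide_eq)
    have "norm u \<le> N + \<bar>a v\<bar> * norm v"
    proof -
      have "norm u = norm ((a v *\<^sub>R v + u) - a v *\<^sub>R v)" by simp
      also have "\<dots> \<le> N + norm (a v *\<^sub>R v)" unfolding N_def by (rule norm_triangle_ineq4)
      finally show ?thesis by simp
    qed
    also have "\<dots> \<le> N + N / d * norm v" using mult_right_mono[OF av' norm_ge_zero[of v]] by simp
    finally have "C * norm u \<le> C * (N + N / d * norm v)" using Cpos by simp
    moreover have "(\<Sum>b\<in>B. \<bar>a b\<bar>) \<le> C * norm u" using C[of a] by (simp add: u_def)
    ultimately have "\<bar>a v\<bar> + (\<Sum>b\<in>B. \<bar>a b\<bar>) \<le> N / d + C * (N + N / d * norm v)"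
      using av' by linarith
    also have "\<dots> = (1 / d + C * (1 + norm v / d)) * N" by (simp add: algebra_simps)
    finally show ?thesis using insert.hyps by (simp add: N_def u_def)
  qed
  then show ?case by blast
qed

lemma finite_dim_coordinates:
  assumes "finite_dim TYPE('e::real_normed_vector)"
  obtains B and c :: "'e::real_normed_vector \<Rightarrow> 'e \<Rightarrow> real" where "finite B" "\<And>b. bounded_linear (c b)"
    "\<And>x. (\<Sum>b\<in>B. c b x *\<^sub>R b) = x"
proof -
  obtain S :: "'e set" where S: "finite S" "span S = UNIV"
    using assms unfolding finite_dim_def by blast
  obtain B where B: "B \<subseteq> S" "independent B" "S \<subseteq> span B"
    using maximal_independent_subset by blast
  have fin: "finite B" using B S finite_subset by blast
  have span: "span B = UNIV" using B S by (metis span_mono span_span top.extremum_uniqueI)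
  define c where "c = (\<lambda>b x. representation B x b)"
  have lin: "linear (c b)" for b
    unfolding c_def by (intro linearI) (auto simp: representation_add representation_scale B span)
  have sum: "(\<Sum>b\<in>B. c b x *\<^sub>R b) = x" for x
    unfolding c_def using sum_representation_eq[OF B(2), of x B] fin span by auto
  obtain C where C: "(\<Sum>b\<in>B. \<bar>a b\<bar>) \<le> C * norm (\<Sum>b\<in>B. a b *\<^sub>R b)" for a
    using coordinates_bounded_by_norm[OF fin B(2)] by blast
  have "bounded_linear (c b)" for b
  proof (cases "b \<in> B")
    case True
    show ?thesis
    proof (rule bounded_linear_intro[where K = C])
      fix x y :: 'e and r :: real
      show "c b (x + y) = c b x + c b y" using lin linear_add by blast
      show "c b (r *\<^sub>R x) = r *\<^sub>R c b x" using lin linear_scale by blast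
      have "\<bar>c b x\<bar> \<le> (\<Sum>b\<in>B. \<bar>c b x\<bar>)"
        using fin True by (intro member_le_sum) auto
      then show "norm (c b x) \<le> norm x * C"
        using C[of "\<lambda>b. c b x"] sum[of x] by (simp add: mult.commute)
    qed
  next
    case False
    then have "c b = (\<lambda>x. 0)" unfolding c_def using representation_ne_zero by blast
    then show ?thesis by simp
  qed
  then show thesis using that fin sum by blast
qed

lemma linear_coordinate_expansion:
  fixes f :: "'e::real_normed_vector \<Rightarrow> 'f::real_normed_vector"
  assumes "linear f" and coords: "\<And>x. (\<Sum>b\<in>B. c b x *\<^sub>R b) = x"
  shows "(\<Sum>b\<in>B. c b x *\<^sub>R f b) = f x"
proof -
  have "(\<Sum>b\<in>B. c b x *\<^sub>R f b) = f (\<Sum>b\<in>B. c b x *\<^sub>R b)"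
    using assms(1) by (simp add: linear_sum linear_scale)
  then show ?thesis by (simp only: coords)
qed

lemma linear_imp_bounded_linear:
  fixes f :: "'e::real_normed_vector \<Rightarrow> 'f::real_normed_vector"
  assumes "finite_dim TYPE('e)" "linear f"
  shows "bounded_linear f"
proof -
  obtain B and c :: "'e \<Rightarrow> 'e \<Rightarrow> real" where Bc: "finite B" "\<And>b. bounded_linear (c b)"
    "\<And>x. (\<Sum>b\<in>B. c b x *\<^sub>R b) = x"
    using finite_dim_coordinates[OF assms(1)] by blast
  have "bounded_linear (\<lambda>x. \<Sum>b\<in>B. c b x *\<^sub>R f b)"
    by (intro bounded_linear_sum bounded_linear_compose[OF bounded_linear_scaleR_left] Bc)
  then show ?thesis by (simp only: linear_coordinate_expansion[OF assms(2) Bc(3)])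
qed

lemma finite_dim_prod:
  assumes "finite_dim TYPE('a::real_normed_vector)" "finite_dim TYPE('b::real_normed_vector)"
  shows "finite_dim TYPE('a \<times> 'b)"
proof -
  obtain A :: "'a set" and B :: "'b set"
    where A: "finite A" "span A = UNIV" and B: "finite B" "span B = UNIV"
    using assms unfolding finite_dim_def by blast
  let ?S = "(\<lambda>x. (x, 0)) ` A \<union> (\<lambda>y. (0, y)) ` B :: ('a \<times> 'b) set"
  have "linear (\<lambda>x::'a. (x, 0::'b))" "linear (\<lambda>y::'b. (0::'a, y))"
    by (auto intro!: linearI)
  then have sp: "span ((\<lambda>x. (x, 0::'b)) ` A) = range (\<lambda>x. (x, 0))"
    "span ((\<lambda>y. (0::'a, y)) ` B) = range (\<lambda>y. (0, y))"
    using A B by (simp_all add: linear_span_image)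
  have "(x, y) \<in> span ?S" for x y
  proof -
    have "(x, 0) \<in> span ?S" "(0, y) \<in> span ?S"
      using sp by (metis (no_types, lifting) Un_upper1 rangeI span_mono subsetD,
          metis (no_types, lifting) Un_upper2 rangeI span_mono subsetD)
    then have "(x, 0) + (0, y) \<in> span ?S" by (rule span_add)
    then show ?thesis by simp
  qed
  then have "span ?S = UNIV" by auto
  moreover have "finite ?S" using A B by simp
  ultimately show ?thesis unfolding finite_dim_def by blast
qed

lemma dual_basis_expansion:
  assumes "finite_dim TYPE('e::real_normed_vector)"
  obtains B :: "'e::real_normed_vector set" and C :: "'e \<Rightarrow> 'e \<Rightarrow>\<^sub>L real"
  where "finite B" "\<And>\<nu> :: 'e \<Rightarrow>\<^sub>L real. (\<Sum>b\<in>B. blinfun_apply \<nu> b *\<^sub>R C b) = \<nu>"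
proof -
  obtain B and c :: "'e \<Rightarrow> 'e \<Rightarrow> real" where Bc: "finite B" "\<And>b. bounded_linear (c b)"
    "\<And>x. (\<Sum>b\<in>B. c b x *\<^sub>R b) = x"
    using finite_dim_coordinates[OF assms(1)] by blast
  have "(\<Sum>b\<in>B. \<nu> b *\<^sub>R Blinfun (c b)) = \<nu>" for \<nu> :: "'e \<Rightarrow>\<^sub>L real"
  proof (rule blinfun_eqI)
    fix x
    have "\<nu> x = \<nu> (\<Sum>b\<in>B. c b x *\<^sub>R b)" by (simp add: Bc)
    also have "\<dots> = (\<Sum>b\<in>B. \<nu> b * c b x)"
      by (simp add: blinfun.sum_right blinfun.scaleR_right mult.commute)
    finally show "(\<Sum>b\<in>B. \<nu> b *\<^sub>R Blinfun (c b)) x = \<nu> x"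
      by (simp add: blinfun.sum_left blinfun.scaleR_left bounded_linear_Blinfun_apply Bc)
  qed
  then show thesis using that[of B "\<lambda>b. Blinfun (c b)"] Bc(1) by blast
qed

lemma finite_dim_dual:
  assumes "finite_dim TYPE('e::real_normed_vector)"
  shows "finite_dim TYPE('e \<Rightarrow>\<^sub>L real)"
proof -
  obtain B :: "'e set" and C :: "'e \<Rightarrow> 'e \<Rightarrow>\<^sub>L real"
    where BC: "finite B" "\<And>\<nu> :: 'e \<Rightarrow>\<^sub>L real. (\<Sum>b\<in>B. blinfun_apply \<nu> b *\<^sub>R C b) = \<nu>"
    using dual_basis_expansion[OF assms] by blast
  have "(\<Sum>b\<in>B. \<nu> b *\<^sub>R C b) \<in> span (C ` B)" for \<nu> :: "'e \<Rightarrow>\<^sub>L real"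
    by (intro span_sum span_scale span_base imageI)
  then have "span (C ` B) = UNIV" unfolding BC(2) by blast
  then show ?thesis using BC(1) unfolding finite_dim_def by blast
qed

lemma has_vector_derivative_dual:
  fixes F :: "real \<Rightarrow> 'e::real_normed_vector \<Rightarrow>\<^sub>L real" and F' :: "'e \<Rightarrow>\<^sub>L real"
  assumes "finite_dim TYPE('e)" "\<And>y. ((\<lambda>t. F t y) has_vector_derivative F' y) (at t within S)"
  shows "(F has_vector_derivative F') (at t within S)"
proof -
  obtain B :: "'e set" and C :: "'e \<Rightarrow> 'e \<Rightarrow>\<^sub>L real"
    where BC: "finite B" "\<And>\<nu> :: 'e \<Rightarrow>\<^sub>L real. (\<Sum>b\<in>B. blinfun_apply \<nu> b *\<^sub>R C b) = \<nu>"
    using dual_basis_expansion[OF assms(1)] by blast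
  have "((\<lambda>t. \<Sum>b\<in>B. F t b *\<^sub>R C b) has_vector_derivative (\<Sum>b\<in>B. F' b *\<^sub>R C b)) (at t within S)"
    by (intro has_vector_derivative_sum bounded_linear.has_vector_derivative[OF bounded_linear_scaleR_left] assms(2))
  then show ?thesis unfolding BC(2) .
qed

lemma continuous_map_dual:
  fixes F :: "'p \<Rightarrow> 'e::real_normed_vector \<Rightarrow>\<^sub>L real"
  assumes "finite_dim TYPE('e)" "\<And>y. continuous_map T euclidean (\<lambda>p. F p y)"
  shows "continuous_map T euclidean F"
proof -
  obtain B :: "'e set" and C :: "'e \<Rightarrow> 'e \<Rightarrow>\<^sub>L real"
    where BC: "finite B" "\<And>\<nu> :: 'e \<Rightarrow>\<^sub>L real. (\<Sum>b\<in>B. blinfun_apply \<nu> b *\<^sub>R C b) = \<nu>"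
    using dual_basis_expansion[OF assms(1)] by blast
  have "continuous_map T euclidean (\<lambda>p. F p b *\<^sub>R C b)" for b
    using continuous_map_compose[OF assms(2)[of b], of euclidean "\<lambda>r. r *\<^sub>R C b"]
    by (simp add: comp_def continuous_intros)
  then have "continuous_map T euclidean (\<lambda>p. \<Sum>b\<in>B. F p b *\<^sub>R C b)"
    by (intro continuous_map_sum BC(1))
  then show ?thesis unfolding BC(2) .
qed

lemma finite_dim_euclidean: "finite_dim TYPE('a::euclidean_space)"
  unfolding finite_dim_def using finite_Basis span_Basis by blast

section \<open>Calculus of smooth maps\<close>

lemma Ck_on_cong:
  assumes "open S" "\<And>x. x \<in> S \<Longrightarrow> f x = g x" "Ck_on k S f"
  shows "Ck_on k S g"
  using assms(2,3)
proof (induction k arbitrary: f g)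
  case 0
  then show ?case by (metis Ck_on.simps(1) continuous_on_cong)
next
  case (Suc k)
  have df: "f differentiable at x" if "x \<in> S" for x using Suc.prems that by simp
  have "g differentiable at x" if "x \<in> S" for x
    using df[OF that] Suc.prems(1) has_derivative_transform_within_open[OF _ assms(1) that]
    unfolding differentiable_def by blast
  moreover have "Ck_on k S (\<lambda>x. frechet_derivative g (at x) v)" for v
  proof (rule Suc.IH)
    show "Ck_on k S (\<lambda>x. frechet_derivative f (at x) v)" using Suc.prems by simp
    show "frechet_derivative f (at x) v = frechet_derivative g (at x) v" if "x \<in> S" for x
      using frechet_derivative_transform_within_open[OF df assms(1)] that Suc.prems(1) by metis
  qed
  ultimately show ?case by simp
qed

text \<open>The definition of \<^const>\<open>Ck_on\<close> speaks of \<^const>\<open>frechet_derivative\<close>, a chosen derivative. This rule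
and the next one trade it for any derivative known explicitly.\<close>

lemma Ck_on_SucI:
  assumes "open S" "\<And>x. x \<in> S \<Longrightarrow> (f has_derivative f' x) (at x)"
    "\<And>v. Ck_on k S (\<lambda>x. f' x v)"
  shows "Ck_on (Suc k) S f"
proof -
  have "Ck_on k S (\<lambda>x. frechet_derivative f (at x) v)" for v
    by (rule Ck_on_cong[OF assms(1) _ assms(3)])
      (rule fun_cong[OF frechet_derivative_at[OF assms(2)]])
  moreover have "f differentiable at x" if "x \<in> S" for x
    using assms(2)[OF that] unfolding differentiable_def by blast
  ultimately show ?thesis by simp
qed

lemma Ck_on_Suc_has_derivative:
  "Ck_on (Suc k) S f \<Longrightarrow> x \<in> S \<Longrightarrow> (f has_derivative frechet_derivative f (at x)) (at x)"
  unfolding Ck_on.simps(2) frechet_derivative_works by blast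

lemma Ck_on_Suc_imp_Ck_on: "Ck_on (Suc k) S f \<Longrightarrow> Ck_on k S f"
proof (induction k arbitrary: f)
  case 0
  then have "\<forall>x\<in>S. isCont f x" unfolding Ck_on.simps(2) by (metis differentiable_imp_continuous_within)
  then show ?case by (simp add: continuous_at_imp_continuous_on)
next
  case (Suc k)
  have "\<forall>x\<in>S. f differentiable at x" using Suc.prems by simp
  moreover have "Ck_on k S (\<lambda>x. frechet_derivative f (at x) v)" for v
  proof (rule Suc.IH)
    show "Ck_on (Suc k) S (\<lambda>x. frechet_derivative f (at x) v)"
      using Suc.prems by (simp only: Ck_on.simps(2)[of "Suc k"])
  qed
  ultimately show ?case by simp
qed

lemma Ck_on_subset: "Ck_on k S f \<Longrightarrow> T \<subseteq> S \<Longrightarrow> Ck_on k T f"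
proof (induction k arbitrary: f)
  case 0
  then show ?case using continuous_on_subset by auto
next
  case (Suc k)
  then show ?case by (simp add: subset_iff)
qed

lemma Ck_on_local:
  assumes "\<And>x. x \<in> S \<Longrightarrow> \<exists>U. open U \<and> x \<in> U \<and> Ck_on k U f"
  shows "Ck_on k S f"
  using assms
proof (induction k arbitrary: f)
  case 0
  have "isCont f x" if "x \<in> S" for x
    using 0[OF that] by (auto simp: continuous_on_eq_continuous_at)
  then show ?case by (simp add: continuous_at_imp_continuous_on)
next
  case (Suc k)
  have "f differentiable at x" if "x \<in> S" for x using Suc.prems[OF that] by auto
  moreover have "Ck_on k S (\<lambda>x. frechet_derivative f (at x) v)" for v
  proof (rule Suc.IH)
    fix x assume "x \<in> S"
    then obtain U where "open U" "x \<in> U" "Ck_on (Suc k) U f" using Suc.prems by blast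
    then show "\<exists>U. open U \<and> x \<in> U \<and> Ck_on k U (\<lambda>x. frechet_derivative f (at x) v)" by auto
  qed
  ultimately show ?case by simp
qed

lemma Ck_on_const: "open S \<Longrightarrow> Ck_on k S (\<lambda>x. c)"
proof (induction k arbitrary: c)
  case (Suc k)
  show ?case by (rule Ck_on_SucI[OF Suc.prems has_derivative_const Suc.IH[OF Suc.prems]])
qed (simp only: Ck_on.simps(1) continuous_on_const)

lemma Ck_on_bounded_linear:
  assumes "open S" "bounded_linear L" "Ck_on k S f"
  shows "Ck_on k S (\<lambda>x. L (f x))"
  using assms(3)
proof (induction k arbitrary: f)
  case 0
  then show ?case using bounded_linear.continuous_on[OF assms(2)] by simp
next
  case (Suc k)
  show ?case
  proof (rule Ck_on_SucI[OF assms(1)])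
    show "((\<lambda>x. L (f x)) has_derivative (\<lambda>v. L (frechet_derivative f (at x) v))) (at x)"
      if "x \<in> S" for x
      using bounded_linear.has_derivative[OF assms(2) Ck_on_Suc_has_derivative[OF Suc.prems that]] .
    show "Ck_on k S (\<lambda>x. L (frechet_derivative f (at x) v))" for v
      using Suc by simp
  qed
qed

lemma Ck_on_add:
  assumes "open S" "Ck_on k S f" "Ck_on k S g"
  shows "Ck_on k S (\<lambda>x. f x + g x)"
  using assms(2,3)
proof (induction k arbitrary: f g)
  case 0
  then show ?case by (auto intro: continuous_on_add)
next
  case (Suc k)
  show ?case
  proof (rule Ck_on_SucI[OF assms(1)])
    show "((\<lambda>x. f x + g x) has_derivative
        (\<lambda>v. frechet_derivative f (at x) v + frechet_derivative g (at x) v)) (at x)" if "x \<in> S" for x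
      by (rule has_derivative_add[OF Suc.prems[THEN Ck_on_Suc_has_derivative, OF that]])
    show "Ck_on k S (\<lambda>x. frechet_derivative f (at x) v + frechet_derivative g (at x) v)" for v
      using Suc.prems by (intro Suc.IH) auto
  qed
qed

lemma Ck_on_sum:
  assumes "open S" "\<And>i. i \<in> I \<Longrightarrow> Ck_on k S (f i)"
  shows "Ck_on k S (\<lambda>x. \<Sum>i\<in>I. f i x)"
  using assms(2)
proof (induction I rule: infinite_finite_induct)
  case (insert i I)
  then show ?case using Ck_on_add[OF assms(1), of k "f i" "\<lambda>x. \<Sum>i\<in>I. f i x"] by simp
qed (simp_all add: Ck_on_const[OF assms(1)])

lemma Ck_on_scaleR:
  assumes "open S" "Ck_on k S f" "Ck_on k S g"
  shows "Ck_on k S (\<lambda>x. f x *\<^sub>R g x)"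
  using assms(2,3)
proof (induction k arbitrary: f g)
  case 0
  then show ?case by (auto intro: continuous_on_scaleR)
next
  case (Suc k)
  show ?case
  proof (rule Ck_on_SucI[OF assms(1)])
    show "((\<lambda>x. f x *\<^sub>R g x) has_derivative
        (\<lambda>v. f x *\<^sub>R frechet_derivative g (at x) v + frechet_derivative f (at x) v *\<^sub>R g x)) (at x)"
      if "x \<in> S" for x
      by (rule has_derivative_scaleR[OF Suc.prems[THEN Ck_on_Suc_has_derivative, OF that]])
    show "Ck_on k S (\<lambda>x. f x *\<^sub>R frechet_derivative g (at x) v + frechet_derivative f (at x) v *\<^sub>R g x)" for v
      using Suc.prems by (intro Ck_on_add[OF assms(1)] Suc.IH) (auto intro: Ck_on_Suc_imp_Ck_on[of k] simp del: Ck_on.simps(2), simp_all)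
  qed
qed

lemma Ck_on_bounded_linear_apply:
  assumes "open S" "bounded_linear L"
  shows "Ck_on k S L"
proof (cases k)
  case 0
  then show ?thesis using assms(2) linear_continuous_on by auto
next
  case (Suc j)
  show ?thesis unfolding Suc
    by (rule Ck_on_SucI[OF assms(1) bounded_linear_imp_has_derivative[OF assms(2)]])
      (rule Ck_on_const[OF assms(1)])
qed

lemma Ck_on_Pair:
  assumes "open S" "Ck_on k S f" "Ck_on k S g"
  shows "Ck_on k S (\<lambda>x. (f x, g x))"
proof -
  have "bounded_linear (\<lambda>y. (y, 0))" "bounded_linear (\<lambda>y. (0, y))"
    by (intro bounded_linear_Pair bounded_linear_ident bounded_linear_zero)+
  then have "Ck_on k S (\<lambda>x. (f x, 0) + (0, g x))"
    using assms by (intro Ck_on_add) (auto dest: Ck_on_bounded_linear)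
  then show ?thesis by simp
qed

text \<open>In coordinates the left-hand side is a finite sum of products of \<open>C\<^sup>k\<close> functions. This is how
smoothness of all directional derivatives, with a fixed direction, yields smoothness with a variable
direction, as needed for the chain rule.\<close>

lemma Ck_on_apply_linear:
  fixes f' :: "'a::real_normed_vector \<Rightarrow> 'b::real_normed_vector \<Rightarrow> 'c::real_normed_vector"
  assumes "finite_dim TYPE('b)" "open S" "\<And>x. x \<in> S \<Longrightarrow> linear (f' x)"
    "\<And>b. Ck_on k S (\<lambda>x. f' x b)" "Ck_on k S Y"
  shows "Ck_on k S (\<lambda>x. f' x (Y x))"
proof -
  obtain B and c :: "'b \<Rightarrow> 'b \<Rightarrow> real" where Bc: "finite B" "\<And>b. bounded_linear (c b)"
    "\<And>y. (\<Sum>b\<in>B. c b y *\<^sub>R b) = y"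
    using finite_dim_coordinates[OF assms(1)] by blast
  have "(\<Sum>b\<in>B. c b (Y x) *\<^sub>R f' x b) = f' x (Y x)" if "x \<in> S" for x
    by (rule linear_coordinate_expansion[OF assms(3)[OF that] Bc(3)])
  moreover have "Ck_on k S (\<lambda>x. \<Sum>b\<in>B. c b (Y x) *\<^sub>R f' x b)"
    by (intro Ck_on_sum[OF assms(2)] Ck_on_scaleR[OF assms(2)] assms(4)
        Ck_on_bounded_linear[OF assms(2) Bc(2) assms(5)])
  ultimately show ?thesis by (rule Ck_on_cong[OF assms(2)])
qed

text \<open>The derivative of the composite is \<open>Dg (f x) (Df x v)\<close>: a linear map depending on \<open>x\<close>, to which
the induction hypothesis applies in every fixed direction, evaluated at a \<open>C\<^sup>k\<close> vector.\<close>

lemma Ck_on_compose: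
  fixes f :: "'a::real_normed_vector \<Rightarrow> 'b::real_normed_vector"
    and g :: "'b \<Rightarrow> 'c::real_normed_vector"
  assumes "finite_dim TYPE('b)" "open S" "open T" "f ` S \<subseteq> T" "Ck_on k S f" "Ck_on k T g"
  shows "Ck_on k S (\<lambda>x. g (f x))"
  using assms(5,6)
proof (induction k arbitrary: g)
  case 0
  then show ?case using assms(4) by (metis Ck_on.simps(1) continuous_on_compose2)
next
  case (Suc k)
  have fx: "f x \<in> T" if "x \<in> S" for x using assms(4) that by blast
  show ?case
  proof (rule Ck_on_SucI[OF assms(2)])
    show "((\<lambda>x. g (f x)) has_derivative
        (\<lambda>v. frechet_derivative g (at (f x)) (frechet_derivative f (at x) v))) (at x)"
      if "x \<in> S" for x
      by (rule has_derivative_compose[OF Ck_on_Suc_has_derivative[OF Suc.prems(1) that]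
            Ck_on_Suc_has_derivative[OF Suc.prems(2) fx[OF that]]])
    show "Ck_on k S (\<lambda>x. frechet_derivative g (at (f x)) (frechet_derivative f (at x) v))" for v
    proof (rule Ck_on_apply_linear[OF assms(1,2)])
      show "linear (frechet_derivative g (at (f x)))" if "x \<in> S" for x
        using Suc.prems fx[OF that] by (intro linear_frechet_derivative) simp
      show "Ck_on k S (\<lambda>x. frechet_derivative g (at (f x)) b)" for b
        by (rule Suc.IH[OF Ck_on_Suc_imp_Ck_on[OF Suc.prems(1)]]) (use Suc.prems(2) in simp)
      show "Ck_on k S (\<lambda>x. frechet_derivative f (at x) v)" using Suc.prems by simp
    qed
  qed
qed

lemma Cinf_on_has_derivative:
  "Cinf_on S f \<Longrightarrow> x \<in> S \<Longrightarrow> (f has_derivative frechet_derivative f (at x)) (at x)"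
  unfolding Cinf_on_def using Ck_on_Suc_has_derivative by blast

lemma Cinf_on_differentiable: "Cinf_on S f \<Longrightarrow> x \<in> S \<Longrightarrow> f differentiable at x"
  using Cinf_on_has_derivative differentiable_def by blast

lemma Cinf_on_continuous: "Cinf_on S f \<Longrightarrow> continuous_on S f"
  unfolding Cinf_on_def by (metis Ck_on.simps(1))

lemma Cinf_on_directional_derivative:
  "Cinf_on S f \<Longrightarrow> Cinf_on S (\<lambda>x. frechet_derivative f (at x) v)"
  unfolding Cinf_on_def by (metis Ck_on.simps(2))

lemma Cinf_on_subset: "Cinf_on S f \<Longrightarrow> T \<subseteq> S \<Longrightarrow> Cinf_on T f"
  unfolding Cinf_on_def using Ck_on_subset by blast

lemma Cinf_on_cong: "open S \<Longrightarrow> (\<And>x. x \<in> S \<Longrightarrow> f x = g x) \<Longrightarrow> Cinf_on S f \<Longrightarrow> Cinf_on S g"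
  unfolding Cinf_on_def using Ck_on_cong by blast

lemma Cinf_on_local:
  "(\<And>x. x \<in> S \<Longrightarrow> \<exists>U. open U \<and> x \<in> U \<and> Cinf_on U f) \<Longrightarrow> Cinf_on S f"
  unfolding Cinf_on_def by (meson Ck_on_local)

lemma Cinf_on_const: "open S \<Longrightarrow> Cinf_on S (\<lambda>x. c)"
  unfolding Cinf_on_def using Ck_on_const by blast

lemma Cinf_on_bounded_linear:
  "open S \<Longrightarrow> bounded_linear L \<Longrightarrow> Cinf_on S f \<Longrightarrow> Cinf_on S (\<lambda>x. L (f x))"
  unfolding Cinf_on_def using Ck_on_bounded_linear by blast

lemma Cinf_on_bounded_linear_apply: "open S \<Longrightarrow> bounded_linear L \<Longrightarrow> Cinf_on S L"
  unfolding Cinf_on_def using Ck_on_bounded_linear_apply by blast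

lemma Cinf_on_Pair:
  "open S \<Longrightarrow> Cinf_on S f \<Longrightarrow> Cinf_on S g \<Longrightarrow> Cinf_on S (\<lambda>x. (f x, g x))"
  unfolding Cinf_on_def using Ck_on_Pair by blast

lemma Cinf_on_apply_linear:
  fixes f' :: "'a::real_normed_vector \<Rightarrow> 'b::real_normed_vector \<Rightarrow> 'c::real_normed_vector"
  assumes "finite_dim TYPE('b)" "open S" "\<And>x. x \<in> S \<Longrightarrow> linear (f' x)"
    "\<And>b. Cinf_on S (\<lambda>x. f' x b)" "Cinf_on S Y"
  shows "Cinf_on S (\<lambda>x. f' x (Y x))"
  using assms unfolding Cinf_on_def by (metis Ck_on_apply_linear)

lemma Cinf_on_compose:
  fixes f :: "'a::real_normed_vector \<Rightarrow> 'b::real_normed_vector"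
    and g :: "'b \<Rightarrow> 'c::real_normed_vector"
  assumes "finite_dim TYPE('b)" "open S" "open T" "f ` S \<subseteq> T" "Cinf_on S f" "Cinf_on T g"
  shows "Cinf_on S (\<lambda>x. g (f x))"
  using assms unfolding Cinf_on_def by (metis Ck_on_compose)

lemma Cinf_on_derivative_along:
  assumes "finite_dim TYPE('a::real_normed_vector)" "open S"
    "Cinf_on S (f :: 'a::real_normed_vector \<Rightarrow> _)" "Cinf_on S Y"
  shows "Cinf_on S (\<lambda>x. frechet_derivative f (at x) (Y x))"
  by (rule Cinf_on_apply_linear[OF assms(1,2) linear_frechet_derivative[OF Cinf_on_differentiable[OF assms(3)]]
        Cinf_on_directional_derivative[OF assms(3)] assms(4)])

text \<open>The mean value theorem, applied once in the direction \<open>u\<close> and once in the direction \<open>v\<close>.\<close>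

lemma second_difference_mean_value:
  fixes f :: "'a::real_normed_vector \<Rightarrow> real"
  assumes "h > 0" "\<forall>s\<in>{0..h}. \<forall>t\<in>{0..h}. x + s *\<^sub>R u + t *\<^sub>R v \<in> S"
    and f: "Cinf_on S f"
  shows "\<exists>p q. 0 < p \<and> p < h \<and> 0 < q \<and> q < h \<and>
    f (x + h *\<^sub>R u + h *\<^sub>R v) - f (x + h *\<^sub>R u) - f (x + h *\<^sub>R v) + f x =
    h * h * frechet_derivative (\<lambda>y. frechet_derivative f (at y) u) (at (x + p *\<^sub>R u + q *\<^sub>R v)) v"
proof -
  let ?Du = "\<lambda>y. frechet_derivative f (at y) u"
  let ?DuDv = "\<lambda>y. frechet_derivative ?Du (at y) v"
  have along: "((\<lambda>s. g (y + s *\<^sub>R w)) has_real_derivative frechet_derivative g (at (y + s *\<^sub>R w)) w) (at s)"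
    if "Cinf_on S g" "y + s *\<^sub>R w \<in> S" for g :: "'a \<Rightarrow> real" and y w s
  proof -
    have "((\<lambda>s. y + s *\<^sub>R w) has_derivative (\<lambda>r. r *\<^sub>R w)) (at s)"
      by (auto intro!: derivative_eq_intros)
    then have "((\<lambda>s. g (y + s *\<^sub>R w)) has_derivative (\<lambda>r. frechet_derivative g (at (y + s *\<^sub>R w)) (r *\<^sub>R w))) (at s)"
      using has_derivative_compose Cinf_on_has_derivative[OF that] by blast
    moreover have "frechet_derivative g (at (y + s *\<^sub>R w)) (r *\<^sub>R w) = frechet_derivative g (at (y + s *\<^sub>R w)) w * r" for r
      using linear_frechet_derivative[OF Cinf_on_differentiable[OF that]] by (simp add: linear_scale)
    ultimately show ?thesis by (simp add: has_field_derivative_def)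
  qed
  have "\<exists>p. 0 < p \<and> p < h \<and> (f (x + h *\<^sub>R v + h *\<^sub>R u) - f (x + h *\<^sub>R u)) - (f (x + h *\<^sub>R v + 0 *\<^sub>R u) - f (x + 0 *\<^sub>R u))
    = (h - 0) * (?Du (x + h *\<^sub>R v + p *\<^sub>R u) - ?Du (x + p *\<^sub>R u))"
  proof (rule MVT2[OF assms(1)])
    fix s assume "0 \<le> s" "s \<le> h"
    then have "x + h *\<^sub>R v + s *\<^sub>R u \<in> S" "x + s *\<^sub>R u \<in> S"
      using assms(1) assms(2)[rule_format, of s h] assms(2)[rule_format, of s 0]
      by (simp_all add: ac_simps)
    then show "((\<lambda>s. f (x + h *\<^sub>R v + s *\<^sub>R u) - f (x + s *\<^sub>R u)) has_real_derivative
        ?Du (x + h *\<^sub>R v + s *\<^sub>R u) - ?Du (x + s *\<^sub>R u)) (at s)"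
      by (intro DERIV_diff along f)
  qed
  then obtain p where p: "0 < p" "p < h"
    "f (x + h *\<^sub>R u + h *\<^sub>R v) - f (x + h *\<^sub>R u) - f (x + h *\<^sub>R v) + f x
    = h * (?Du (x + p *\<^sub>R u + h *\<^sub>R v) - ?Du (x + p *\<^sub>R u))"
    by (auto simp: ac_simps)
  have "\<exists>q. 0 < q \<and> q < h \<and> ?Du (x + p *\<^sub>R u + h *\<^sub>R v) - ?Du (x + p *\<^sub>R u + 0 *\<^sub>R v)
    = (h - 0) * ?DuDv (x + p *\<^sub>R u + q *\<^sub>R v)"
  proof (rule MVT2[OF assms(1)])
    fix t assume "0 \<le> t" "t \<le> h"
    then show "((\<lambda>t. ?Du (x + p *\<^sub>R u + t *\<^sub>R v)) has_real_derivative
        ?DuDv (x + p *\<^sub>R u + t *\<^sub>R v)) (at t)"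
      using p assms(2)[rule_format, of p t] by (intro along Cinf_on_directional_derivative f) auto
  qed
  then show ?thesis using p by (auto simp: mult.assoc)
qed

text \<open>The second difference quotient is symmetric in \<open>u\<close> and \<open>v\<close>, and by the mean value form above it
converges to either mixed derivative as the step size shrinks.\<close>

lemma mixed_derivatives_commute_real:
  fixes f :: "'a::real_normed_vector \<Rightarrow> real"
  assumes "open S" "x \<in> S" and f: "Cinf_on S f"
  shows "frechet_derivative (\<lambda>y. frechet_derivative f (at y) u) (at x) v =
    frechet_derivative (\<lambda>y. frechet_derivative f (at y) v) (at x) u"
proof -
  obtain r where r: "r > 0" "ball x r \<subseteq> S" using assms open_contains_ball by blast
  \<comment> \<open>The segments spanned by steps of length \<open>h n\<close> along \<open>u\<close> and \<open>v\<close> stay in the ball of radius \<open>r\<close>.\<close>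
  define K where "K = norm u + norm v + 1"
  have K: "K > 0" by (simp add: K_def add_nonneg_pos)
  define h where "h n = r / K / (real n + 2)" for n
  have hpos: "h n > 0" for n using r(1) K by (simp add: h_def)
  have h0: "h \<longlonglongrightarrow> 0" unfolding h_def by real_asymp
  have inS: "x + s *\<^sub>R u + t *\<^sub>R v \<in> S" "x + s *\<^sub>R v + t *\<^sub>R u \<in> S"
    if "0 \<le> s" "s \<le> h n" "0 \<le> t" "t \<le> h n" for s t n
  proof -
    have "h n * K = r / (real n + 2)" using K by (simp add: h_def)
    also have "\<dots> < r" using r(1) by (simp add: divide_less_eq)
    finally have "h n * K < r" .
    moreover have "norm (s *\<^sub>R u + t *\<^sub>R v) \<le> h n * K" "norm (s *\<^sub>R v + t *\<^sub>R u) \<le> h n * K"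
    proof -
      have "s * norm w \<le> h n * norm w" "t * norm w \<le> h n * norm w" for w :: 'a
        using that by (simp_all add: mult_right_mono)
      from this[of u] this[of v]
      show "norm (s *\<^sub>R u + t *\<^sub>R v) \<le> h n * K" "norm (s *\<^sub>R v + t *\<^sub>R u) \<le> h n * K"
        using norm_triangle_ineq[of "s *\<^sub>R u" "t *\<^sub>R v"] norm_triangle_ineq[of "s *\<^sub>R v" "t *\<^sub>R u"]
          that hpos[of n] by (simp_all add: K_def algebra_simps)
    qed
    ultimately have "norm (s *\<^sub>R u + t *\<^sub>R v) < r" "norm (s *\<^sub>R v + t *\<^sub>R u) < r" by linarith+
    moreover have "dist x (x + a + b) = norm (a + b)" for a b :: 'a
      by (metis add.assoc add_diff_cancel_left' dist_commute dist_norm)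
    ultimately have "x + s *\<^sub>R u + t *\<^sub>R v \<in> ball x r" "x + s *\<^sub>R v + t *\<^sub>R u \<in> ball x r"
      by (simp_all only: mem_ball)
    then show "x + s *\<^sub>R u + t *\<^sub>R v \<in> S" "x + s *\<^sub>R v + t *\<^sub>R u \<in> S" using r by blast+
  qed
  define \<Delta> where "\<Delta> u v n = (f (x + h n *\<^sub>R u + h n *\<^sub>R v) - f (x + h n *\<^sub>R u)
      - f (x + h n *\<^sub>R v) + f x) / (h n * h n)" for u v n
  have lim: "\<Delta> u v \<longlonglongrightarrow> frechet_derivative (\<lambda>y. frechet_derivative f (at y) u) (at x) v"
    if box: "\<And>n. \<forall>s\<in>{0..h n}. \<forall>t\<in>{0..h n}. x + s *\<^sub>R u + t *\<^sub>R v \<in> S" for u v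
  proof -
    let ?D = "\<lambda>y. frechet_derivative (\<lambda>y. frechet_derivative f (at y) u) (at y) v"
    have "\<forall>n. \<exists>p q. 0 < p \<and> p < h n \<and> 0 < q \<and> q < h n \<and> \<Delta> u v n = ?D (x + p *\<^sub>R u + q *\<^sub>R v)"
    proof
      fix n
      obtain p q where "0 < p" "p < h n" "0 < q" "q < h n"
        "f (x + h n *\<^sub>R u + h n *\<^sub>R v) - f (x + h n *\<^sub>R u) - f (x + h n *\<^sub>R v) + f x =
          h n * h n * ?D (x + p *\<^sub>R u + q *\<^sub>R v)"
        using second_difference_mean_value[OF hpos box f] by blast
      moreover from this(5) have "\<Delta> u v n = ?D (x + p *\<^sub>R u + q *\<^sub>R v)"
        using hpos[of n] by (simp add: \<Delta>_def)
      ultimately show "\<exists>p q. 0 < p \<and> p < h n \<and> 0 < q \<and> q < h n \<and> \<Delta> u v n = ?D (x + p *\<^sub>R u + q *\<^sub>R v)"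
        by blast
    qed
    then obtain p q where pq: "\<And>n. 0 < p n \<and> p n < h n \<and> 0 < q n \<and> q n < h n \<and>
        \<Delta> u v n = ?D (x + p n *\<^sub>R u + q n *\<^sub>R v)" by metis
    have "p \<longlonglongrightarrow> 0" "q \<longlonglongrightarrow> 0"
      by (rule tendsto_sandwich[OF _ _ tendsto_const h0]; use pq in \<open>auto intro: always_eventually less_imp_le\<close>)+
    then have "(\<lambda>n. x + p n *\<^sub>R u + q n *\<^sub>R v) \<longlonglongrightarrow> x + 0 *\<^sub>R u + 0 *\<^sub>R v"
      by (intro tendsto_intros)
    then have "(\<lambda>n. x + p n *\<^sub>R u + q n *\<^sub>R v) \<longlonglongrightarrow> x" by simp
    moreover have "isCont ?D x"
      using Cinf_on_continuous[OF Cinf_on_directional_derivative[OF Cinf_on_directional_derivative[OF f]]]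
        assms(1,2) by (simp add: continuous_on_eq_continuous_at)
    ultimately have "(\<lambda>n. ?D (x + p n *\<^sub>R u + q n *\<^sub>R v)) \<longlonglongrightarrow> ?D x"
      by (rule isCont_tendsto_compose[rotated])
    moreover have "\<Delta> u v = (\<lambda>n. ?D (x + p n *\<^sub>R u + q n *\<^sub>R v))" using pq by blast
    ultimately show ?thesis by simp
  qed
  have "\<Delta> u v = \<Delta> v u" by (auto simp: \<Delta>_def ac_simps fun_eq_iff)
  then show ?thesis using lim[of u v] lim[of v u] inS by (metis LIMSEQ_unique atLeastAtMost_iff)
qed

text \<open>Reduces to the scalar case by applying each coordinate functional.\<close>

lemma mixed_derivatives_commute:
  fixes f :: "'a::real_normed_vector \<Rightarrow> 'b::real_normed_vector"
  assumes "finite_dim TYPE('b)" "open S" "x \<in> S" and f: "Cinf_on S f"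
  shows "frechet_derivative (\<lambda>y. frechet_derivative f (at y) u) (at x) v =
    frechet_derivative (\<lambda>y. frechet_derivative f (at y) v) (at x) u" (is "?L = ?R")
proof -
  obtain B and c :: "'b \<Rightarrow> 'b \<Rightarrow> real" where Bc: "finite B" "\<And>b. bounded_linear (c b)"
    "\<And>y. (\<Sum>b\<in>B. c b y *\<^sub>R b) = y"
    using finite_dim_coordinates[OF assms(1)] by blast
  have D1: "frechet_derivative (\<lambda>y. c b (g y)) (at y) w = c b (frechet_derivative g (at y) w)"
    if "Cinf_on S g" "y \<in> S" for b w y and g :: "'a \<Rightarrow> 'b"
    using frechet_derivative_at[OF bounded_linear.has_derivative[OF Bc(2) Cinf_on_has_derivative[OF that]]]
    by metis
  have D2: "frechet_derivative (\<lambda>y. frechet_derivative (\<lambda>z. c b (f z)) (at y) w) (at x) w'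
      = c b (frechet_derivative (\<lambda>y. frechet_derivative f (at y) w) (at x) w')" for b w w'
  proof -
    have "frechet_derivative (\<lambda>y. frechet_derivative (\<lambda>z. c b (f z)) (at y) w) (at x) w'
      = frechet_derivative (\<lambda>y. c b (frechet_derivative f (at y) w)) (at x) w'"
      using frechet_derivative_transform_within_open[of
          "\<lambda>y. frechet_derivative (\<lambda>z. c b (f z)) (at y) w" x S "\<lambda>y. c b (frechet_derivative f (at y) w)"]
        D1[OF f] assms(2,3)
        Cinf_on_differentiable[OF Cinf_on_directional_derivative[OF Cinf_on_bounded_linear[OF assms(2) Bc(2) f]]]
      by metis
    then show ?thesis using D1[OF Cinf_on_directional_derivative[OF f] assms(3)] by simp
  qed
  have "c b (frechet_derivative (\<lambda>y. frechet_derivative f (at y) u) (at x) v) =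
    c b (frechet_derivative (\<lambda>y. frechet_derivative f (at y) v) (at x) u)" for b
    using mixed_derivatives_commute_real[OF assms(2,3) Cinf_on_bounded_linear[OF assms(2) Bc(2) f]] D2
    by metis
  then have "(\<Sum>b\<in>B. c b ?L *\<^sub>R b) = (\<Sum>b\<in>B. c b ?R *\<^sub>R b)" by simp
  then show ?thesis by (simp only: Bc(3))
qed

lemma Cinf_on_slice_right:
  assumes "Cinf_on T f" "(p, q) \<in> T"
  shows "((\<lambda>y. f (p, y)) has_derivative (\<lambda>v. frechet_derivative f (at (p, q)) (0, v))) (at q)"
proof -
  have "((\<lambda>y. (p, y)) has_derivative (\<lambda>v. (0, v))) (at q)"
    by (auto intro!: derivative_eq_intros)
  then show ?thesis
    using has_derivative_compose[of "\<lambda>y. (p, y)" "\<lambda>v. (0, v)" q UNIV f] Cinf_on_has_derivative[OF assms] by simp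
qed

lemma Cinf_on_slice_left:
  assumes "Cinf_on T f" "(p, q) \<in> T"
  shows "((\<lambda>x. f (x, q)) has_derivative (\<lambda>v. frechet_derivative f (at (p, q)) (v, 0))) (at p)"
proof -
  have "((\<lambda>x. (x, q)) has_derivative (\<lambda>v. (v, 0))) (at p)"
    by (auto intro!: derivative_eq_intros)
  then show ?thesis
    using has_derivative_compose[of "\<lambda>x. (x, q)" "\<lambda>v. (v, 0)" p UNIV f] Cinf_on_has_derivative[OF assms] by simp
qed

text \<open>A product rule for the evaluation of a variable linear map at a variable vector. The derivative of the
linear map is only given direction by direction; its linearity in the direction follows.\<close>

lemma has_derivative_apply_linear:
  fixes f' :: "'a::real_normed_vector \<Rightarrow> 'b::real_normed_vector \<Rightarrow> 'c::real_normed_vector"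
  assumes "finite_dim TYPE('b)" "open S" "x \<in> S" "\<And>y. y \<in> S \<Longrightarrow> linear (f' y)"
    and E: "\<And>b. ((\<lambda>y. f' y b) has_derivative E b) (at x)" and Y: "(Y has_derivative Y') (at x)"
  shows "((\<lambda>y. f' y (Y y)) has_derivative (\<lambda>h. E (Y x) h + f' x (Y' h))) (at x)"
proof -
  obtain B and c :: "'b \<Rightarrow> 'b \<Rightarrow> real" where Bc: "finite B" "\<And>b. bounded_linear (c b)"
    "\<And>y. (\<Sum>b\<in>B. c b y *\<^sub>R b) = y"
    using finite_dim_coordinates[OF assms(1)] by blast
  have expand: "(\<Sum>b\<in>B. c b w *\<^sub>R f' y b) = f' y w" if "y \<in> S" for y w
    by (rule linear_coordinate_expansion[OF assms(4)[OF that] Bc(3)])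
  have "((\<lambda>y. \<Sum>b\<in>B. c b (Y x) *\<^sub>R f' y b) has_derivative (\<lambda>h. \<Sum>b\<in>B. c b (Y x) *\<^sub>R E b h)) (at x)"
    by (intro has_derivative_sum has_derivative_scaleR_right E)
  then have "((\<lambda>y. f' y (Y x)) has_derivative (\<lambda>h. \<Sum>b\<in>B. c b (Y x) *\<^sub>R E b h)) (at x)"
    by (rule has_derivative_transform_within_open[OF _ assms(2,3)]) (rule expand)
  then have EY: "E (Y x) = (\<lambda>h. \<Sum>b\<in>B. c b (Y x) *\<^sub>R E b h)"
    using has_derivative_unique[OF E] by blast
  have "((\<lambda>y. \<Sum>b\<in>B. c b (Y y) *\<^sub>R f' y b) has_derivative
      (\<lambda>h. \<Sum>b\<in>B. c b (Y x) *\<^sub>R E b h + c b (Y' h) *\<^sub>R f' x b)) (at x)"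
    by (intro has_derivative_sum has_derivative_scaleR E bounded_linear.has_derivative[OF Bc(2)] Y)
  then have "((\<lambda>y. f' y (Y y)) has_derivative
      (\<lambda>h. \<Sum>b\<in>B. c b (Y x) *\<^sub>R E b h + c b (Y' h) *\<^sub>R f' x b)) (at x)"
    by (rule has_derivative_transform_within_open[OF _ assms(2,3)]) (rule expand)
  then show ?thesis unfolding EY by (simp only: sum.distrib expand[OF assms(3)])
qed

lemma smooth_on_subset_Cinf_on:
  assumes "Cinf_on UNIV g" "\<And>x. x \<in> S \<Longrightarrow> g x = f x"
  shows "smooth_on S f"
  unfolding smooth_on_def using assms by (intro ballI exI[of _ UNIV] exI[of _ g]) auto

lemma smooth_onE:
  assumes "smooth_on S f" "x \<in> S"
  obtains U g where "open U" "x \<in> U" "Cinf_on U g" "\<And>y. y \<in> S \<Longrightarrow> y \<in> U \<Longrightarrow> g y = f y"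
proof -
  have "\<exists>U g. open U \<and> x \<in> U \<and> Cinf_on U g \<and> (\<forall>y\<in>S \<inter> U. g y = f y)"
    using assms unfolding smooth_on_def by (rule bspec)
  then obtain U g where "open U" "x \<in> U" "Cinf_on U g" "\<forall>y\<in>S \<inter> U. g y = f y"
    by (elim exE conjE)
  then show thesis using that[of U g] by simp
qed

lemma has_derivative_local_extension:
  assumes "open U" "x \<in> U" "x \<in> S" "(g has_derivative g') (at x)"
    and eq: "\<And>y. y \<in> S \<Longrightarrow> y \<in> U \<Longrightarrow> g y = f y"
  shows "(f has_derivative g') (at x within S)"
proof -
  obtain d where d: "d > 0" "ball x d \<subseteq> U" using assms(1,2) open_contains_ball by blast
  show ?thesis
  proof (rule has_derivative_transform_within[OF has_derivative_at_withinI[OF assms(4)] d(1) assms(3)])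
    fix y assume "y \<in> S" "dist y x < d"
    then show "g y = f y" using eq d(2) by (simp add: dist_commute subset_iff)
  qed
qed

lemma smooth_on_has_derivative:
  assumes "smooth_on S f" "x \<in> S"
  shows "(f has_derivative frechet_derivative f (at x within S)) (at x within S)"
proof -
  obtain U g where U: "open U" "x \<in> U" "Cinf_on U g" "\<And>y. y \<in> S \<Longrightarrow> y \<in> U \<Longrightarrow> g y = f y"
    using smooth_onE[OF assms] by blast
  have "(f has_derivative frechet_derivative g (at x)) (at x within S)"
    by (rule has_derivative_local_extension[OF U(1,2) assms(2) Cinf_on_has_derivative[OF U(3,2)] U(4)])
  then show ?thesis using differentiable_def frechet_derivative_works by blast
qed

lemma smooth_on_continuous_on:
  assumes "smooth_on S f"
  shows "continuous_on S f"
  unfolding continuous_on_eq_continuous_within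
  by (intro ballI has_derivative_continuous[OF smooth_on_has_derivative[OF assms]])

section \<open>Smooth manifolds in charts\<close>

lemma smooth_manifold_chart:
  assumes "smooth_manifold M" "(U, \<phi>) \<in> snd M"
  shows "openin (fst M) U" "open (\<phi> ` U)"
    "homeomorphic_map (subtopology (fst M) U) (top_of_set (\<phi> ` U)) \<phi>"
proof -
  have "\<forall>(U, \<phi>)\<in>snd M. openin (fst M) U \<and> open (\<phi> ` U) \<and>
      homeomorphic_map (subtopology (fst M) U) (top_of_set (\<phi> ` U)) \<phi>"
    using assms(1) by (cases M) (simp add: smooth_manifold_def)
  then show "openin (fst M) U" "open (\<phi> ` U)"
    "homeomorphic_map (subtopology (fst M) U) (top_of_set (\<phi> ` U)) \<phi>"
    using assms(2) by blast+
qed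

lemma smooth_manifold_finite_dim:
  fixes M :: "('g, 'e::real_normed_vector) manifold"
  shows "smooth_manifold M \<Longrightarrow> finite_dim TYPE('e)"
  by (cases M) (simp add: smooth_manifold_def)

lemma smooth_manifold_chart_at:
  assumes "smooth_manifold M" "x \<in> topspace (fst M)"
  obtains U \<phi> where "(U, \<phi>) \<in> snd M" "x \<in> U"
proof -
  have "x \<in> (\<Union>c\<in>snd M. fst c)"
    using assms by (cases M) (simp add: smooth_manifold_def)
  then obtain c where "c \<in> snd M" "x \<in> fst c" by blast
  then show thesis using that[of "fst c" "snd c"] by simp
qed

lemma chart_subset_topspace:
  "smooth_manifold M \<Longrightarrow> (U, \<phi>) \<in> snd M \<Longrightarrow> U \<subseteq> topspace (fst M)"
  using smooth_manifold_chart(1) openin_subset by metis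

lemma chart_inj_on:
  assumes "smooth_manifold M" "(U, \<phi>) \<in> snd M"
  shows "inj_on \<phi> U"
  using homeomorphic_imp_injective_map[OF smooth_manifold_chart(3)[OF assms]]
    chart_subset_topspace[OF assms] by (simp add: inf_absorb2)

lemma chart_inv_chart:
  assumes "smooth_manifold M" "(U, \<phi>) \<in> snd M" "x \<in> U"
  shows "chart_inv (U, \<phi>) (\<phi> x) = x"
  using chart_inj_on[OF assms(1,2)] assms(3) by (simp add: chart_inv_def)

lemma chart_inv_mem: "z \<in> \<phi> ` U \<Longrightarrow> chart_inv (U, \<phi>) z \<in> U"
  by (simp add: chart_inv_def inv_into_into)

lemma chart_chart_inv: "z \<in> \<phi> ` U \<Longrightarrow> \<phi> (chart_inv (U, \<phi>) z) = z"
  by (simp add: chart_inv_def f_inv_into_f)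

lemma continuous_map_chart:
  assumes "smooth_manifold M" "(U, \<phi>) \<in> snd M"
  shows "continuous_map (subtopology (fst M) U) euclidean \<phi>"
  using homeomorphic_imp_continuous_map[OF smooth_manifold_chart(3)[OF assms]]
  by (simp add: continuous_map_in_subtopology)

lemma continuous_map_chart_inv:
  assumes "smooth_manifold M" "(U, \<phi>) \<in> snd M"
  shows "continuous_map (top_of_set (\<phi> ` U)) (fst M) (chart_inv (U, \<phi>))"
proof -
  have U: "topspace (subtopology (fst M) U) = U"
    using chart_subset_topspace[OF assms] by auto
  obtain g where g: "homeomorphic_maps (subtopology (fst M) U) (top_of_set (\<phi> ` U)) \<phi> g"
    using smooth_manifold_chart(3)[OF assms] homeomorphic_map_maps by blast
  have "g z = chart_inv (U, \<phi>) z" if "z \<in> \<phi> ` U" for z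
    using g that U chart_inv_chart[OF assms] by (auto simp: homeomorphic_maps_def)
  moreover have "continuous_map (top_of_set (\<phi> ` U)) (fst M) g"
    using g by (auto simp: homeomorphic_maps_def continuous_map_in_subtopology)
  ultimately show ?thesis by (rule continuous_map_eq[rotated]) auto
qed

lemma openin_chart_preimage:
  assumes "smooth_manifold M" "(U, \<phi>) \<in> snd M" "open V"
  shows "openin (fst M) {x \<in> U. \<phi> x \<in> V}"
proof -
  have "openin (subtopology (fst M) U) {x \<in> topspace (subtopology (fst M) U). \<phi> x \<in> V}"
    using continuous_map_chart[OF assms(1,2)] assms(3) by (simp add: continuous_map_def)
  moreover have "topspace (subtopology (fst M) U) = U"
    using chart_subset_topspace[OF assms(1,2)] by auto
  ultimately show ?thesis
    using smooth_manifold_chart(1)[OF assms(1,2)] openin_trans_full by fastforce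
qed

lemma open_chart_domain:
  assumes "smooth_manifold M" "(U, \<phi>) \<in> snd M" "continuous_map (fst M) T f" "openin T W"
  shows "open {z \<in> \<phi> ` U. f (chart_inv (U, \<phi>) z) \<in> W}"
proof -
  have "continuous_map (top_of_set (\<phi> ` U)) T (f \<circ> chart_inv (U, \<phi>))"
    using continuous_map_compose continuous_map_chart_inv[OF assms(1,2)] assms(3) by blast
  then have "openin (top_of_set (\<phi> ` U)) {z \<in> \<phi> ` U. f (chart_inv (U, \<phi>) z) \<in> W}"
    using assms(4) by (simp add: continuous_map_def)
  then show ?thesis using smooth_manifold_chart(2)[OF assms(1,2)] openin_open_trans by blast
qed

lemma chart_image_eq:
  assumes "smooth_manifold M" "(U, \<phi>) \<in> snd M"
  shows "\<phi> ` {x \<in> U. P x} = {z \<in> \<phi> ` U. P (chart_inv (U, \<phi>) z)}"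
  using chart_inv_chart[OF assms] by force

text \<open>The sets on which the chart representations must be smooth, written as subsets of the chart image
instead of images of subsets of the manifold; in this form they are visibly open.\<close>

lemma smooth_map_iff:
  assumes "smooth_manifold M"
  shows "smooth_map M N f \<longleftrightarrow> continuous_map (fst M) (fst N) f \<and>
    (\<forall>U \<phi> V \<psi>. (U, \<phi>) \<in> snd M \<longrightarrow> (V, \<psi>) \<in> snd N \<longrightarrow>
      Cinf_on {z \<in> \<phi> ` U. f (chart_inv (U, \<phi>) z) \<in> V} (\<lambda>z. \<psi> (f (chart_inv (U, \<phi>) z))))"
  unfolding smooth_map_def using chart_image_eq[OF assms, of _ _ "\<lambda>x. f x \<in> _"]
  by (fastforce simp: comp_def)

lemma smooth_map_compose:
  fixes M :: "('g, 'e::real_normed_vector) manifold" and N :: "('h, 'f::real_normed_vector) manifold"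
    and P :: "('k, 'd::real_normed_vector) manifold"
  assumes M: "smooth_manifold M" and N: "smooth_manifold N" and P: "smooth_manifold P"
    and f: "smooth_map M N f" and g: "smooth_map N P g"
  shows "smooth_map M P (\<lambda>x. g (f x))"
  unfolding smooth_map_iff[OF M]
proof (intro conjI allI impI)
  have cf: "continuous_map (fst M) (fst N) f" and cg: "continuous_map (fst N) (fst P) g"
    using f g by (auto simp: smooth_map_def)
  show cgf: "continuous_map (fst M) (fst P) (\<lambda>x. g (f x))"
    using continuous_map_compose[OF cf cg] by (simp add: comp_def)
  fix U \<phi> W \<theta> assume U: "(U, \<phi>) \<in> snd M" and W: "(W, \<theta>) \<in> snd P"
  let ?i = "chart_inv (U, \<phi>)"
  show "Cinf_on {z \<in> \<phi> ` U. g (f (?i z)) \<in> W} (\<lambda>z. \<theta> (g (f (?i z))))"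
  proof (rule Cinf_on_local)
    fix z assume z: "z \<in> {z \<in> \<phi> ` U. g (f (?i z)) \<in> W}"
    then have "f (?i z) \<in> topspace (fst N)"
      using chart_inv_mem[of z \<phi> U] chart_subset_topspace[OF M U] cf
      by (auto simp: continuous_map_def)
    then obtain V \<psi> where V: "(V, \<psi>) \<in> snd N" "f (?i z) \<in> V"
      using smooth_manifold_chart_at[OF N] by blast
    let ?j = "chart_inv (V, \<psi>)"
    let ?A = "{z \<in> \<phi> ` U. f (?i z) \<in> V}" and ?B = "{z \<in> \<phi> ` U. g (f (?i z)) \<in> W}"
    let ?C = "{w \<in> \<psi> ` V. g (?j w) \<in> W}"
    have open_A: "open ?A" by (rule open_chart_domain[OF M U cf smooth_manifold_chart(1)[OF N V(1)]])
    have open_B: "open ?B" by (rule open_chart_domain[OF M U cgf smooth_manifold_chart(1)[OF P W]])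
    have open_C: "open ?C" by (rule open_chart_domain[OF N V(1) cg smooth_manifold_chart(1)[OF P W]])
    have open_AB: "open (?A \<inter> ?B)" using open_A open_B by blast
    have jf: "?j (\<psi> (f (?i y))) = f (?i y)" if "y \<in> ?A" for y
      using chart_inv_chart[OF N V(1)] that by blast
    have "Cinf_on (?A \<inter> ?B) (\<lambda>y. \<theta> (g (?j (\<psi> (f (?i y))))))"
    proof (rule Cinf_on_compose[OF smooth_manifold_finite_dim[OF N] open_AB open_C])
      show "(\<lambda>y. \<psi> (f (?i y))) ` (?A \<inter> ?B) \<subseteq> ?C" using jf by auto
      have "Cinf_on ?A (\<lambda>y. \<psi> (f (?i y)))" using f U V unfolding smooth_map_iff[OF M] by blast
      then show "Cinf_on (?A \<inter> ?B) (\<lambda>y. \<psi> (f (?i y)))" by (rule Cinf_on_subset) blast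
      show "Cinf_on ?C (\<lambda>w. \<theta> (g (?j w)))" using g V W unfolding smooth_map_iff[OF N] by blast
    qed
    then have "Cinf_on (?A \<inter> ?B) (\<lambda>y. \<theta> (g (f (?i y))))"
      by (rule Cinf_on_cong[OF open_AB, rotated]) (use jf in simp)
    then show "\<exists>O'. open O' \<and> z \<in> O' \<and> Cinf_on O' (\<lambda>z. \<theta> (g (f (?i z))))"
      using open_AB z V(2) by (intro exI[of _ "?A \<inter> ?B"]) simp
  qed
qed

text \<open>The chart representation of a map on a product, written as a function of two chart coordinates. It
hides how the product chart is inverted.\<close>

lemma smooth_map_prod_chart:
  assumes M: "smooth_manifold M" and N: "smooth_manifold N" and P: "smooth_manifold P"
    and f: "smooth_map (prod_manifold M N) P f"
    and U: "(U, \<phi>) \<in> snd M" and V: "(V, \<psi>) \<in> snd N" and W: "(W, \<theta>) \<in> snd P"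
  defines "T \<equiv> {(p, q). p \<in> \<phi> ` U \<and> q \<in> \<psi> ` V \<and> f (chart_inv (U, \<phi>) p, chart_inv (V, \<psi>) q) \<in> W}"
  shows "open T" "Cinf_on T (\<lambda>(p, q). \<theta> (f (chart_inv (U, \<phi>) p, chart_inv (V, \<psi>) q)))"
proof -
  let ?i = "chart_inv (U, \<phi>)" and ?j = "chart_inv (V, \<psi>)"
  have cf: "continuous_map (prod_topology (fst M) (fst N)) (fst P) f"
    using f by (simp add: smooth_map_def prod_manifold_def)
  have op: "open (\<phi> ` U \<times> \<psi> ` V)"
    by (intro open_Times smooth_manifold_chart(2)[OF M U] smooth_manifold_chart(2)[OF N V])
  have "continuous_map (top_of_set (\<phi> ` U \<times> \<psi> ` V)) (prod_topology (fst M) (fst N))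
      (\<lambda>x. (?i (fst x), ?j (snd x)))"
  proof (intro continuous_map_pairedI)
    have "continuous_map (top_of_set (\<phi> ` U \<times> \<psi> ` V)) (top_of_set (\<phi> ` U)) fst"
      "continuous_map (top_of_set (\<phi> ` U \<times> \<psi> ` V)) (top_of_set (\<psi> ` V)) snd"
      by (auto simp: continuous_map_in_subtopology intro: continuous_on_fst continuous_on_snd)
    from continuous_map_compose[OF this(1) continuous_map_chart_inv[OF M U]]
      continuous_map_compose[OF this(2) continuous_map_chart_inv[OF N V]]
    show "continuous_map (top_of_set (\<phi> ` U \<times> \<psi> ` V)) (fst M) (\<lambda>x. ?i (fst x))"
      "continuous_map (top_of_set (\<phi> ` U \<times> \<psi> ` V)) (fst N) (\<lambda>x. ?j (snd x))"
      by (simp_all add: comp_def)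
  qed
  from continuous_map_compose[OF this cf]
  have "openin (top_of_set (\<phi> ` U \<times> \<psi> ` V)) {x \<in> \<phi> ` U \<times> \<psi> ` V. f (?i (fst x), ?j (snd x)) \<in> W}"
    using smooth_manifold_chart(1)[OF P W] by (simp add: continuous_map_def comp_def)
  moreover have "{x \<in> \<phi> ` U \<times> \<psi> ` V. f (?i (fst x), ?j (snd x)) \<in> W} = T"
    by (auto simp: T_def)
  ultimately show "open T" using op openin_open_trans by metis
  have inj: "inj_on (map_prod \<phi> \<psi>) (U \<times> V)"
    by (intro map_prod_inj_on chart_inj_on[OF M U] chart_inj_on[OF N V])
  have inv: "chart_inv (U \<times> V, map_prod \<phi> \<psi>) (p, q) = (?i p, ?j q)"
    if "p \<in> \<phi> ` U" "q \<in> \<psi> ` V" for p q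
  proof -
    have "map_prod \<phi> \<psi> (?i p, ?j q) = (p, q)" "(?i p, ?j q) \<in> U \<times> V"
      using chart_chart_inv[OF that(1)] chart_chart_inv[OF that(2)] chart_inv_mem[OF that(1)] chart_inv_mem[OF that(2)]
      by simp_all
    then show ?thesis unfolding chart_inv_def using inv_into_f_eq[OF inj] by simp
  qed
  have chart: "(U \<times> V, map_prod \<phi> \<psi>) \<in> snd (prod_manifold M N)"
    using U V by (auto simp: prod_manifold_def)
  have T_eq: "map_prod \<phi> \<psi> ` {x \<in> U \<times> V. f x \<in> W} = T"
  proof (intro subset_antisym subsetI)
    fix x assume "x \<in> map_prod \<phi> \<psi> ` {x \<in> U \<times> V. f x \<in> W}"
    then show "x \<in> T"
      unfolding T_def using chart_inv_chart[OF M U] chart_inv_chart[OF N V] by auto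
  next
    fix x assume x: "x \<in> T"
    obtain p q where pq: "x = (p, q)" by fastforce
    then have pT: "p \<in> \<phi> ` U" "q \<in> \<psi> ` V" "f (?i p, ?j q) \<in> W" using x by (auto simp: T_def)
    then have "x = map_prod \<phi> \<psi> (?i p, ?j q)"
      using pq chart_chart_inv[OF pT(1)] chart_chart_inv[OF pT(2)] by simp
    moreover have "(?i p, ?j q) \<in> {x \<in> U \<times> V. f x \<in> W}"
      using pT(3) chart_inv_mem[OF pT(1)] chart_inv_mem[OF pT(2)] by simp
    ultimately show "x \<in> map_prod \<phi> \<psi> ` {x \<in> U \<times> V. f x \<in> W}" by (rule image_eqI)
  qed
  have "Cinf_on (map_prod \<phi> \<psi> ` {x \<in> U \<times> V. f x \<in> W}) (\<theta> \<circ> f \<circ> chart_inv (U \<times> V, map_prod \<phi> \<psi>))"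
    using f chart W unfolding smooth_map_def by blast
  then have "Cinf_on T (\<theta> \<circ> f \<circ> chart_inv (U \<times> V, map_prod \<phi> \<psi>))"
    unfolding T_eq .
  then show "Cinf_on T (\<lambda>(p, q). \<theta> (f (?i p, ?j q)))"
    by (rule Cinf_on_cong[OF \<open>open T\<close>, rotated]) (auto simp: T_def inv)
qed

lemma smooth_map_slice_right:
  fixes M :: "('g, 'e::real_normed_vector) manifold" and N :: "('h, 'f::real_normed_vector) manifold"
  assumes M: "smooth_manifold M" and N: "smooth_manifold N" and P: "smooth_manifold P"
    and f: "smooth_map (prod_manifold M N) P f" and a: "a \<in> topspace (fst M)"
  shows "smooth_map N P (\<lambda>y. f (a, y))"
  unfolding smooth_map_iff[OF N]
proof (intro conjI allI impI)
  have cf: "continuous_map (prod_topology (fst M) (fst N)) (fst P) f"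
    using f by (simp add: smooth_map_def prod_manifold_def)
  have "continuous_map (fst N) (prod_topology (fst M) (fst N)) (\<lambda>y. (a, y))"
    using a by (intro continuous_map_pairedI) auto
  from continuous_map_compose[OF this cf]
  show cfa: "continuous_map (fst N) (fst P) (\<lambda>y. f (a, y))" by (simp add: comp_def)
  fix V \<psi> W \<theta> assume V: "(V, \<psi>) \<in> snd N" and W: "(W, \<theta>) \<in> snd P"
  let ?S = "{z \<in> \<psi> ` V. f (a, chart_inv (V, \<psi>) z) \<in> W}"
  obtain U \<phi> where U: "(U, \<phi>) \<in> snd M" "a \<in> U" using smooth_manifold_chart_at[OF M a] by blast
  note T = smooth_map_prod_chart[OF M N P f U(1) V W]
  have open_S: "open ?S" by (rule open_chart_domain[OF N V cfa smooth_manifold_chart(1)[OF P W]])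
  have a_eq: "chart_inv (U, \<phi>) (\<phi> a) = a" by (rule chart_inv_chart[OF M U])
  have fin: "finite_dim TYPE('e \<times> 'f)"
    by (intro finite_dim_prod smooth_manifold_finite_dim[OF M] smooth_manifold_finite_dim[OF N])
  have "Cinf_on ?S (\<lambda>z. (\<phi> a, z))"
    by (intro Cinf_on_Pair Cinf_on_const Cinf_on_bounded_linear_apply open_S bounded_linear_ident)
  from Cinf_on_compose[OF fin open_S T(1) _ this T(2)]
  show "Cinf_on ?S (\<lambda>z. \<theta> (f (a, chart_inv (V, \<psi>) z)))"
    using U(2) by (simp add: a_eq image_subset_iff)
qed

lemma smooth_map_slice_left:
  fixes M :: "('g, 'e::real_normed_vector) manifold" and N :: "('h, 'f::real_normed_vector) manifold"
  assumes M: "smooth_manifold M" and N: "smooth_manifold N" and P: "smooth_manifold P"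
    and f: "smooth_map (prod_manifold M N) P f" and b: "b \<in> topspace (fst N)"
  shows "smooth_map M P (\<lambda>x. f (x, b))"
  unfolding smooth_map_iff[OF M]
proof (intro conjI allI impI)
  have cf: "continuous_map (prod_topology (fst M) (fst N)) (fst P) f"
    using f by (simp add: smooth_map_def prod_manifold_def)
  have "continuous_map (fst M) (prod_topology (fst M) (fst N)) (\<lambda>x. (x, b))"
    using b by (intro continuous_map_pairedI) auto
  from continuous_map_compose[OF this cf]
  show cfb: "continuous_map (fst M) (fst P) (\<lambda>x. f (x, b))" by (simp add: comp_def)
  fix U \<phi> W \<theta> assume U: "(U, \<phi>) \<in> snd M" and W: "(W, \<theta>) \<in> snd P"
  let ?S = "{z \<in> \<phi> ` U. f (chart_inv (U, \<phi>) z, b) \<in> W}"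
  obtain V \<psi> where V: "(V, \<psi>) \<in> snd N" "b \<in> V" using smooth_manifold_chart_at[OF N b] by blast
  note T = smooth_map_prod_chart[OF M N P f U V(1) W]
  have open_S: "open ?S" by (rule open_chart_domain[OF M U cfb smooth_manifold_chart(1)[OF P W]])
  have b_eq: "chart_inv (V, \<psi>) (\<psi> b) = b" by (rule chart_inv_chart[OF N V])
  have fin: "finite_dim TYPE('e \<times> 'f)"
    by (intro finite_dim_prod smooth_manifold_finite_dim[OF M] smooth_manifold_finite_dim[OF N])
  have "Cinf_on ?S (\<lambda>z. (z, \<psi> b))"
    by (intro Cinf_on_Pair Cinf_on_const Cinf_on_bounded_linear_apply open_S bounded_linear_ident)
  from Cinf_on_compose[OF fin open_S T(1) _ this T(2)]
  show "Cinf_on ?S (\<lambda>z. \<theta> (f (chart_inv (U, \<phi>) z, b)))"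
    using V(2) by (simp add: b_eq image_subset_iff)
qed

lemma smooth_manifold_real_line: "smooth_manifold real_line"
proof -
  have "Cinf_on (UNIV :: real set) (\<lambda>x. x)"
    by (intro Cinf_on_bounded_linear_apply bounded_linear_ident open_UNIV)
  moreover have "chart_inv (UNIV, id) = (\<lambda>x::real. x)"
    by (auto simp: chart_inv_def fun_eq_iff inv_into_f_eq)
  moreover have "second_countable euclideanreal"
  proof -
    obtain \<B> :: "real set set" where \<B>: "countable \<B>" "topological_basis \<B>"
      using ex_countable_basis by blast
    then show ?thesis
      unfolding second_countable_def
    proof (intro exI[of _ \<B>] conjI ballI allI impI)
      show "openin euclideanreal V" if "V \<in> \<B>" for V
        using topological_basis_open[OF \<B>(2) that] by simp
      show "\<exists>V\<in>\<B>. x \<in> V \<and> V \<subseteq> U" if "openin euclideanreal U \<and> x \<in> U" for U x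
        using topological_basisE[OF \<B>(2), of U x] that by (metis open_openin)
    qed (rule \<B>(1))
  qed
  ultimately show ?thesis
    using finite_dim_euclidean[where ?'a = real] homeomorphic_map_id[of "euclideanreal"]
    by (auto simp: smooth_manifold_def real_line_def comp_def id_def
        homeomorphic_map_maps homeomorphic_maps_id)
qed

lemma smooth_map_real_line_iff:
  "smooth_map real_line M \<gamma> \<longleftrightarrow> continuous_map euclideanreal (fst M) \<gamma> \<and>
    (\<forall>(U, \<phi>)\<in>snd M. Cinf_on {t. \<gamma> t \<in> U} (\<lambda>t. \<phi> (\<gamma> t)))"
proof -
  have "chart_inv (UNIV, id) = (\<lambda>x::real. x)"
    by (auto simp: chart_inv_def fun_eq_iff inv_into_f_eq)
  then show ?thesis unfolding smooth_map_def by (simp add: real_line_def comp_def)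
qed

text \<open>Charts carry small balls to path-connected neighbourhoods.\<close>

lemma smooth_manifold_locally_path_connected:
  assumes M: "smooth_manifold M"
  shows "locally_path_connected_space (fst M)"
  unfolding locally_path_connected_space
proof (intro allI impI, elim conjE)
  fix V x assume V: "openin (fst M) V" "x \<in> V"
  then obtain U \<phi> where U: "(U, \<phi>) \<in> snd M" "x \<in> U"
    using smooth_manifold_chart_at[OF M] openin_subset by blast
  have "open {z \<in> \<phi> ` U. chart_inv (U, \<phi>) z \<in> V}"
    using open_chart_domain[OF M U(1) continuous_map_id V(1)] by simp
  moreover have "\<phi> x \<in> {z \<in> \<phi> ` U. chart_inv (U, \<phi>) z \<in> V}"
    using U V chart_inv_chart[OF M U] by simp
  ultimately obtain r where r: "r > 0" "ball (\<phi> x) r \<subseteq> {z \<in> \<phi> ` U. chart_inv (U, \<phi>) z \<in> V}"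
    by (meson open_contains_ball)
  let ?B = "chart_inv (U, \<phi>) ` ball (\<phi> x) r"
  have B_eq: "?B = {y \<in> U. \<phi> y \<in> ball (\<phi> x) r}"
  proof safe
    fix z assume z: "z \<in> ball (\<phi> x) r"
    then have "z \<in> \<phi> ` U" using r by blast
    then show "chart_inv (U, \<phi>) z \<in> U" "\<phi> (chart_inv (U, \<phi>) z) \<in> ball (\<phi> x) r"
      using chart_inv_mem chart_chart_inv z by metis+
  next
    fix y assume "y \<in> U" "\<phi> y \<in> ball (\<phi> x) r"
    then show "y \<in> ?B" using chart_inv_chart[OF M U(1)] by (metis imageI)
  qed
  have "openin (fst M) ?B" unfolding B_eq by (rule openin_chart_preimage[OF M U(1) open_ball])
  moreover have "path_connectedin (fst M) ?B"
  proof (rule path_connectedin_continuous_map_image[OF continuous_map_chart_inv[OF M U(1)]])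
    have sub: "ball (\<phi> x) r \<subseteq> \<phi> ` U" using r by blast
    show "path_connectedin (top_of_set (\<phi> ` U)) (ball (\<phi> x) r)"
      unfolding path_connectedin
    proof (intro conjI ballI)
      show "ball (\<phi> x) r \<subseteq> topspace (top_of_set (\<phi> ` U))" using sub by simp
      fix p q assume "p \<in> ball (\<phi> x) r" "q \<in> ball (\<phi> x) r"
      then have seg: "linepath p q ` {0..1} \<subseteq> ball (\<phi> x) r"
        using closed_segment_subset[OF _ _ convex_ball] linepath_image_01 by metis
      have "pathin (top_of_set (\<phi> ` U)) (linepath p q)"
        unfolding pathin_def continuous_map_in_subtopology
        using seg sub continuous_on_linepath[of "{0..1}" p q] by auto
      moreover have "linepath p q 0 = p" "linepath p q 1 = q" by (simp_all add: linepath_def)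
      ultimately show "\<exists>g. pathin (top_of_set (\<phi> ` U)) g \<and> g \<in> {0..1} \<rightarrow> ball (\<phi> x) r \<and> g 0 = p \<and> g 1 = q"
        using seg by blast
    qed
  qed
  moreover have "x \<in> ?B" using U r B_eq by auto
  moreover have "?B \<subseteq> V" using r by blast
  ultimately show "\<exists>U. openin (fst M) U \<and> path_connectedin (fst M) U \<and> x \<in> U \<and> U \<subseteq> V" by blast
qed

lemma connected_manifold_path:
  assumes "smooth_manifold M" "connected_space (fst M)" "x \<in> topspace (fst M)" "y \<in> topspace (fst M)"
  obtains n where "continuous_map (top_of_set {0..1::real}) (fst M) n" "n 0 = x" "n 1 = y"
proof -
  have "path_connected_space (fst M)"
    using path_connected_eq_connected_space[OF smooth_manifold_locally_path_connected[OF assms(1)]] assms(2)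
    by blast
  then show thesis using assms(3,4) that unfolding path_connected_space_def pathin_def by metis
qed

section \<open>Lie groups and the adjoint representation\<close>

locale lie_group_structure =
  fixes G :: "('g, 'e::real_normed_vector, 'm) lie_data_scheme" (structure)
  assumes lie_group: "lie_group G"
begin

sublocale group G
  using lie_group by (simp add: lie_group_def)

abbreviation \<kappa> :: "'g \<Rightarrow> 'e" where "\<kappa> \<equiv> snd (id_chart G)"
abbreviation \<iota> :: "'e \<Rightarrow> 'g" where "\<iota> \<equiv> chart_inv (id_chart G)"
abbreviation U\<^sub>0 :: "'g set" where "U\<^sub>0 \<equiv> fst (id_chart G)"
abbreviation D\<^sub>0 :: "'e set" where "D\<^sub>0 \<equiv> \<kappa> ` U\<^sub>0"
abbreviation e\<^sub>0 :: 'e where "e\<^sub>0 \<equiv> id_coord G"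

lemma manifold: "smooth_manifold (lie_manifold G)"
  using lie_group by (simp add: lie_group_def)

lemma fst_lie_manifold [simp]: "fst (lie_manifold G) = gtop G"
  and snd_lie_manifold [simp]: "snd (lie_manifold G) = atlas G"
  by (simp_all add: lie_manifold_def)

lemma topspace_gtop [simp]: "topspace (gtop G) = carrier G"
  using lie_group by (simp add: lie_group_def)

lemma finite_dim: "finite_dim TYPE('e)"
  using smooth_manifold_finite_dim[OF manifold] .

lemma id_chart_mem: "(U\<^sub>0, \<kappa>) \<in> snd (lie_manifold G)"
  using lie_group by (simp add: lie_group_def)

lemma one_mem: "\<one> \<in> U\<^sub>0"
  using lie_group by (simp add: lie_group_def)

lemma U0_carrier: "x \<in> U\<^sub>0 \<Longrightarrow> x \<in> carrier G"
  using chart_subset_topspace[OF manifold id_chart_mem] by auto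

lemma open_U0: "openin (gtop G) U\<^sub>0" and open_D0: "open D\<^sub>0"
  using smooth_manifold_chart[OF manifold id_chart_mem] by simp_all

lemma iota_kappa [simp]: "x \<in> U\<^sub>0 \<Longrightarrow> \<iota> (\<kappa> x) = x"
  using chart_inv_chart[OF manifold id_chart_mem] by simp

lemma kappa_iota [simp]: "z \<in> D\<^sub>0 \<Longrightarrow> \<kappa> (\<iota> z) = z"
  using chart_chart_inv[of z \<kappa> U\<^sub>0] by simp

lemma iota_mem: "z \<in> D\<^sub>0 \<Longrightarrow> \<iota> z \<in> U\<^sub>0"
  using chart_inv_mem[of z \<kappa> U\<^sub>0] by simp

lemma iota_carrier: "z \<in> D\<^sub>0 \<Longrightarrow> \<iota> z \<in> carrier G"
  using iota_mem U0_carrier by blast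

lemma e0_mem: "e\<^sub>0 \<in> D\<^sub>0" and kappa_one: "\<kappa> \<one> = e\<^sub>0" and iota_e0 [simp]: "\<iota> e\<^sub>0 = \<one>"
  using one_mem by (auto simp: id_coord_def)

lemma left_mult_smooth:
  "g \<in> carrier G \<Longrightarrow> smooth_map (lie_manifold G) (lie_manifold G) (\<lambda>x. g \<otimes> x)"
  using smooth_map_slice_right[OF manifold manifold manifold, of "\<lambda>(g, h). g \<otimes> h" g] lie_group
  by (simp add: lie_group_def)

lemma right_mult_smooth:
  "g \<in> carrier G \<Longrightarrow> smooth_map (lie_manifold G) (lie_manifold G) (\<lambda>x. x \<otimes> g)"
  using smooth_map_slice_left[OF manifold manifold manifold, of "\<lambda>(g, h). g \<otimes> h" g] lie_group
  by (simp add: lie_group_def)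

text \<open>With \<open>h = inv g\<close> this is conjugation. General \<open>h\<close> is needed to transport statements at the identity
to other points of a one-parameter subgroup.\<close>

lemma two_sided_mult_smooth:
  assumes "g \<in> carrier G" "h \<in> carrier G"
  shows "smooth_map (lie_manifold G) (lie_manifold G) (\<lambda>x. g \<otimes> x \<otimes> h)"
  using smooth_map_compose[OF manifold manifold manifold left_mult_smooth[OF assms(1)] right_mult_smooth[OF assms(2)]] .

lemma continuous_map_mult:
  assumes "continuous_map T (gtop G) f" "continuous_map T (gtop G) g"
  shows "continuous_map T (gtop G) (\<lambda>x. f x \<otimes> g x)"
proof -
  have "continuous_map (prod_topology (gtop G) (gtop G)) (gtop G) (\<lambda>(g, h). g \<otimes> h)"
    using lie_group by (simp add: lie_group_def smooth_map_def prod_manifold_def)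
  from continuous_map_compose[OF continuous_map_pairedI[OF assms] this]
  show ?thesis by (simp add: comp_def)
qed

lemma continuous_map_inverse:
  assumes "continuous_map T (gtop G) f"
  shows "continuous_map T (gtop G) (\<lambda>x. inv (f x))"
proof -
  have "continuous_map (gtop G) (gtop G) (\<lambda>g. inv g)"
    using lie_group by (simp add: lie_group_def smooth_map_def)
  from continuous_map_compose[OF assms this] show ?thesis by (simp add: comp_def)
qed

lemma smooth_map_differentiable:
  assumes "smooth_map (lie_manifold G) (lie_manifold G) f" "f \<one> \<in> U" "(U, \<phi>) \<in> atlas G"
  shows "(\<lambda>z. \<phi> (f (\<iota> z))) differentiable (at e\<^sub>0)"
proof -
  have "Cinf_on {z \<in> D\<^sub>0. f (\<iota> z) \<in> U} (\<lambda>z. \<phi> (f (\<iota> z)))"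
  proof -
    have "Cinf_on {z \<in> D\<^sub>0. f (chart_inv (U\<^sub>0, \<kappa>) z) \<in> U} (\<lambda>z. \<phi> (f (chart_inv (U\<^sub>0, \<kappa>) z)))"
      using assms(1,3) id_chart_mem unfolding smooth_map_iff[OF manifold] snd_lie_manifold by blast
    then show ?thesis by simp
  qed
  then show ?thesis by (rule Cinf_on_differentiable) (use e0_mem assms(2) in simp)
qed

lemma Ad_has_derivative:
  assumes "g \<in> carrier G"
  shows "((\<lambda>z. \<kappa> (g \<otimes> \<iota> z \<otimes> inv g)) has_derivative Ad G g) (at e\<^sub>0)"
proof -
  have "(\<lambda>z. \<kappa> (g \<otimes> \<iota> z \<otimes> inv g)) differentiable (at e\<^sub>0)"
    using assms one_mem id_chart_mem
    by (intro smooth_map_differentiable[where U = "U\<^sub>0"] two_sided_mult_smooth) simp_all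
  then show ?thesis unfolding Ad_def frechet_derivative_works .
qed

lemma Ad_bounded_linear: "g \<in> carrier G \<Longrightarrow> bounded_linear (Ad G g)"
  using Ad_has_derivative has_derivative_bounded_linear by blast

lemma Ad_eqI:
  "g \<in> carrier G \<Longrightarrow> ((\<lambda>z. \<kappa> (g \<otimes> \<iota> z \<otimes> inv g)) has_derivative f') (at e\<^sub>0) \<Longrightarrow> Ad G g = f'"
  using Ad_has_derivative has_derivative_unique by blast

lemma Ad_one: "Ad G \<one> = id"
proof (rule Ad_eqI)
  have "((\<lambda>z. z) has_derivative id) (at e\<^sub>0)" unfolding id_def by (rule has_derivative_ident)
  then show "((\<lambda>z. \<kappa> (\<one> \<otimes> \<iota> z \<otimes> inv \<one>)) has_derivative id) (at e\<^sub>0)"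
    by (rule has_derivative_transform_within_open[OF _ open_D0 e0_mem]) (simp add: iota_carrier)
qed simp

lemma Ad_mult:
  assumes g: "g \<in> carrier G" and h: "h \<in> carrier G"
  shows "Ad G (g \<otimes> h) Y = Ad G g (Ad G h Y)"
proof -
  let ?S = "{z \<in> D\<^sub>0. h \<otimes> \<iota> z \<otimes> inv h \<in> U\<^sub>0}"
  have "continuous_map (gtop G) (gtop G) (\<lambda>x. h \<otimes> x \<otimes> inv h)"
    using two_sided_mult_smooth[OF h inv_closed[OF h]] by (simp add: smooth_map_def)
  then have op: "open ?S"
    using open_chart_domain[OF manifold id_chart_mem, of "gtop G"] open_U0 by simp
  have mem: "e\<^sub>0 \<in> ?S" using e0_mem one_mem h by simp
  have "\<kappa> (h \<otimes> \<iota> e\<^sub>0 \<otimes> inv h) = e\<^sub>0" using h by (simp add: kappa_one)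
  then have "((\<lambda>z. \<kappa> (g \<otimes> \<iota> (\<kappa> (h \<otimes> \<iota> z \<otimes> inv h)) \<otimes> inv g)) has_derivative (\<lambda>Y. Ad G g (Ad G h Y))) (at e\<^sub>0)"
    using has_derivative_compose[OF Ad_has_derivative[OF h], of "\<lambda>z. \<kappa> (g \<otimes> \<iota> z \<otimes> inv g)"]
      Ad_has_derivative[OF g] by simp
  then have "((\<lambda>z. \<kappa> (g \<otimes> h \<otimes> \<iota> z \<otimes> inv (g \<otimes> h))) has_derivative (\<lambda>Y. Ad G g (Ad G h Y))) (at e\<^sub>0)"
  proof (rule has_derivative_transform_within_open[OF _ op mem])
    fix z assume "z \<in> ?S"
    then have "\<iota> (\<kappa> (h \<otimes> \<iota> z \<otimes> inv h)) = h \<otimes> \<iota> z \<otimes> inv h" "\<iota> z \<in> carrier G"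
      using iota_carrier by simp_all
    then show "\<kappa> (g \<otimes> \<iota> (\<kappa> (h \<otimes> \<iota> z \<otimes> inv h)) \<otimes> inv g) = \<kappa> (g \<otimes> h \<otimes> \<iota> z \<otimes> inv (g \<otimes> h))"
      using g h by (simp add: m_assoc inv_mult_group)
  qed
  then show ?thesis using Ad_eqI[of "g \<otimes> h"] g h by (metis m_closed)
qed

definition chart_mult :: "'e \<times> 'e \<Rightarrow> 'e" where
  "chart_mult = (\<lambda>(p, q). \<kappa> (\<iota> p \<otimes> \<iota> q))"

definition chart_mult_dom :: "('e \<times> 'e) set" where
  "chart_mult_dom = {(p, q). p \<in> D\<^sub>0 \<and> q \<in> D\<^sub>0 \<and> \<iota> p \<otimes> \<iota> q \<in> U\<^sub>0}"

lemma chart_mult_smooth: "open chart_mult_dom" "Cinf_on chart_mult_dom chart_mult"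
proof -
  have "smooth_map (prod_manifold (lie_manifold G) (lie_manifold G)) (lie_manifold G) (\<lambda>(g, h). g \<otimes> h)"
    using lie_group by (simp add: lie_group_def)
  from smooth_map_prod_chart[OF manifold manifold manifold this id_chart_mem id_chart_mem id_chart_mem]
  show "open chart_mult_dom" "Cinf_on chart_mult_dom chart_mult"
    by (simp_all add: chart_mult_dom_def chart_mult_def)
qed

lemma chart_mult_dom_e0: "(e\<^sub>0, e\<^sub>0) \<in> chart_mult_dom"
  using e0_mem one_mem by (simp add: chart_mult_dom_def)

lemma chart_mult_e0:
  assumes "p \<in> D\<^sub>0"
  shows "(p, e\<^sub>0) \<in> chart_mult_dom" "(e\<^sub>0, p) \<in> chart_mult_dom"
    "chart_mult (p, e\<^sub>0) = p" "chart_mult (e\<^sub>0, p) = p"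
  using assms e0_mem iota_mem[OF assms] iota_carrier[OF assms]
  by (simp_all add: chart_mult_dom_def chart_mult_def)

lemma chart_mult_derivative_e0:
  "frechet_derivative chart_mult (at (e\<^sub>0, e\<^sub>0)) (v, w) = v + w"
proof -
  let ?D = "frechet_derivative chart_mult (at (e\<^sub>0, e\<^sub>0))"
  have "((\<lambda>x. chart_mult (x, e\<^sub>0)) has_derivative (\<lambda>v. v)) (at e\<^sub>0)"
    by (rule has_derivative_transform_within_open[OF has_derivative_ident open_D0 e0_mem]) (simp add: chart_mult_e0)
  then have 1: "(\<lambda>v. ?D (v, 0)) = (\<lambda>v. v)"
    using has_derivative_unique Cinf_on_slice_left[OF chart_mult_smooth(2) chart_mult_dom_e0] by blast
  have "((\<lambda>x. chart_mult (e\<^sub>0, x)) has_derivative (\<lambda>v. v)) (at e\<^sub>0)"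
    by (rule has_derivative_transform_within_open[OF has_derivative_ident open_D0 e0_mem]) (simp add: chart_mult_e0)
  then have 2: "(\<lambda>v. ?D (0, v)) = (\<lambda>v. v)"
    using has_derivative_unique Cinf_on_slice_right[OF chart_mult_smooth(2) chart_mult_dom_e0] by blast
  have "linear ?D"
    by (rule linear_frechet_derivative[OF Cinf_on_differentiable[OF chart_mult_smooth(2) chart_mult_dom_e0]])
  then have "?D (v, w) = ?D (v, 0) + ?D (0, w)"
    using linear_add[of ?D "(v, 0)" "(0, w)"] by simp
  then show ?thesis using 1 2 by (metis (no_types, lifting))
qed

text \<open>Conjugation \<open>p q p\<^sup>-\<^sup>1\<close> in the chart at the identity, jointly in both arguments and near the identity.
The domain is cut down so that all intermediate products stay in the chart.\<close>

lemma chart_conj_smooth: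
  obtains T where "open T" "(e\<^sub>0, e\<^sub>0) \<in> T" "Cinf_on T (\<lambda>(p, q). \<kappa> (\<iota> p \<otimes> \<iota> q \<otimes> inv (\<iota> p)))"
    "\<And>p q. (p, q) \<in> T \<Longrightarrow> p \<in> D\<^sub>0 \<and> q \<in> D\<^sub>0 \<and> \<iota> p \<otimes> \<iota> q \<in> U\<^sub>0 \<and> \<iota> p \<otimes> \<iota> q \<otimes> inv (\<iota> p) \<in> U\<^sub>0"
proof -
  have inv_smooth: "smooth_map (lie_manifold G) (lie_manifold G) (\<lambda>g. inv g)"
    using lie_group by (simp add: lie_group_def)
  let ?I = "{z \<in> D\<^sub>0. inv (\<iota> z) \<in> U\<^sub>0}"
  have "continuous_map (gtop G) (gtop G) (\<lambda>g. inv g)"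
    using inv_smooth by (simp add: smooth_map_def)
  then have open_I: "open ?I"
    using open_chart_domain[OF manifold id_chart_mem, of "gtop G"] open_U0 by simp
  have I: "Cinf_on ?I (\<lambda>z. \<kappa> (inv (\<iota> z)))"
  proof -
    have "Cinf_on {z \<in> D\<^sub>0. inv (chart_inv (U\<^sub>0, \<kappa>) z) \<in> U\<^sub>0} (\<lambda>z. \<kappa> (inv (chart_inv (U\<^sub>0, \<kappa>) z)))"
      using inv_smooth id_chart_mem unfolding smooth_map_iff[OF manifold] by blast
    then show ?thesis by simp
  qed
  define A where "A = chart_mult_dom \<inter> fst -` ?I"
  define h where "h x = (chart_mult x, \<kappa> (inv (\<iota> (fst x))))" for x
  define T where "T = A \<inter> h -` chart_mult_dom"
  have open_A: "open A"
    unfolding A_def by (intro open_Int chart_mult_smooth(1) open_vimage_fst open_I)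
  have "Cinf_on A (\<lambda>x. \<kappa> (inv (\<iota> (fst x))))"
    by (rule Cinf_on_compose[OF finite_dim open_A open_I _ Cinf_on_bounded_linear_apply[OF open_A bounded_linear_fst] I])
      (auto simp: A_def)
  moreover have "Cinf_on A chart_mult"
    by (rule Cinf_on_subset[OF chart_mult_smooth(2)]) (simp add: A_def)
  ultimately have h: "Cinf_on A h" unfolding h_def by (intro Cinf_on_Pair open_A)
  have open_T: "open T"
    unfolding T_def by (rule continuous_open_preimage[OF Cinf_on_continuous[OF h] open_A chart_mult_smooth(1)])
  have T: "p \<in> D\<^sub>0" "q \<in> D\<^sub>0" "\<iota> p \<otimes> \<iota> q \<in> U\<^sub>0" "inv (\<iota> p) \<in> U\<^sub>0" "\<iota> p \<otimes> \<iota> q \<otimes> inv (\<iota> p) \<in> U\<^sub>0"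
    if "(p, q) \<in> T" for p q
  proof -
    show pq: "p \<in> D\<^sub>0" "q \<in> D\<^sub>0" "\<iota> p \<otimes> \<iota> q \<in> U\<^sub>0" "inv (\<iota> p) \<in> U\<^sub>0"
      using that by (auto simp: T_def A_def chart_mult_dom_def)
    have "h (p, q) \<in> chart_mult_dom" using that by (simp add: T_def)
    then show "\<iota> p \<otimes> \<iota> q \<otimes> inv (\<iota> p) \<in> U\<^sub>0"
      using pq by (simp add: h_def chart_mult_def chart_mult_dom_def)
  qed
  have "Cinf_on T (\<lambda>x. chart_mult (h x))"
    by (rule Cinf_on_compose[OF finite_dim_prod[OF finite_dim finite_dim] open_T chart_mult_smooth(1) _
          Cinf_on_subset[OF h] chart_mult_smooth(2)]) (auto simp: T_def)
  then have smooth: "Cinf_on T (\<lambda>(p, q). \<kappa> (\<iota> p \<otimes> \<iota> q \<otimes> inv (\<iota> p)))"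
  proof (rule Cinf_on_cong[OF open_T, rotated])
    fix x assume "x \<in> T"
    moreover obtain p q where "x = (p, q)" by fastforce
    ultimately show "chart_mult (h x) = (case x of (p, q) \<Rightarrow> \<kappa> (\<iota> p \<otimes> \<iota> q \<otimes> inv (\<iota> p)))"
      using T[of p q] by (simp add: h_def chart_mult_def)
  qed
  have mem: "(e\<^sub>0, e\<^sub>0) \<in> T"
    using e0_mem one_mem chart_mult_dom_e0
    by (simp add: T_def A_def h_def chart_mult_def kappa_one)
  show thesis by (rule that[OF open_T mem smooth]) (use T in blast)
qed

text \<open>\<open>Ad p Y\<close> is the directional derivative along \<open>(0, Y)\<close> of the smooth map \<open>(p, q) \<mapsto> p q p\<^sup>-\<^sup>1\<close>, so
it depends differentiably on \<open>p\<close>.\<close>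

lemma bracket_has_derivative: "((\<lambda>z. Ad G (\<iota> z) Y) has_derivative (\<lambda>X. bracket G X Y)) (at e\<^sub>0)"
proof -
  obtain T where T: "open T" "(e\<^sub>0, e\<^sub>0) \<in> T" "Cinf_on T (\<lambda>(p, q). \<kappa> (\<iota> p \<otimes> \<iota> q \<otimes> inv (\<iota> p)))"
    "\<And>p q. (p, q) \<in> T \<Longrightarrow> p \<in> D\<^sub>0 \<and> q \<in> D\<^sub>0 \<and> \<iota> p \<otimes> \<iota> q \<in> U\<^sub>0 \<and> \<iota> p \<otimes> \<iota> q \<otimes> inv (\<iota> p) \<in> U\<^sub>0"
    using chart_conj_smooth by blast
  define C where "C = (\<lambda>(p, q). \<kappa> (\<iota> p \<otimes> \<iota> q \<otimes> inv (\<iota> p)))"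
  have C: "Cinf_on T C" using T(3) by (simp add: C_def)
  have Ad_C: "frechet_derivative C (at (p, e\<^sub>0)) (0, Y) = Ad G (\<iota> p) Y" if "(p, e\<^sub>0) \<in> T" for p
  proof -
    have "((\<lambda>y. C (p, y)) has_derivative (\<lambda>v. frechet_derivative C (at (p, e\<^sub>0)) (0, v))) (at e\<^sub>0)"
      by (rule Cinf_on_slice_right[OF C that])
    then have "Ad G (\<iota> p) = (\<lambda>v. frechet_derivative C (at (p, e\<^sub>0)) (0, v))"
      using T(4)[OF that] by (intro Ad_eqI) (simp_all add: C_def iota_carrier)
    then show ?thesis by simp
  qed
  let ?S = "(\<lambda>p. (p, e\<^sub>0)) -` T"
  have "open ?S" by (intro open_vimage T(1) continuous_intros)
  moreover have "e\<^sub>0 \<in> ?S" using T(2) by simp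
  ultimately have "((\<lambda>z. Ad G (\<iota> z) Y) has_derivative
      (\<lambda>v. frechet_derivative (\<lambda>x. frechet_derivative C (at x) (0, Y)) (at (e\<^sub>0, e\<^sub>0)) (v, 0))) (at e\<^sub>0)"
    using Ad_C
    by (intro has_derivative_transform_within_open[OF
          Cinf_on_slice_left[OF Cinf_on_directional_derivative[OF C, of "(0, Y)"] T(2)]]) auto
  then have "(\<lambda>z. Ad G (\<iota> z) Y) differentiable (at e\<^sub>0)" unfolding differentiable_def by blast
  then show ?thesis unfolding bracket_def frechet_derivative_works .
qed

lemma bracket_linear_left: "linear (\<lambda>X. bracket G X Y)"
  using has_derivative_linear[OF bracket_has_derivative] .

lemma bracket_linear_right: "linear (bracket G X)"
proof (rule linearI)
  have D: "((\<lambda>z. Ad G (\<iota> z) Y) has_derivative f') (at e\<^sub>0) \<Longrightarrow> bracket G X Y = f' X" for Y f'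
    using has_derivative_unique[OF bracket_has_derivative] by metis
  have lin: "linear (Ad G (\<iota> z))" if "z \<in> D\<^sub>0" for z
    using Ad_bounded_linear[OF iota_carrier[OF that]] by (rule bounded_linear.linear)
  show "bracket G X (Y + Z) = bracket G X Y + bracket G X Z" for Y Z
  proof (rule D)
    show "((\<lambda>z. Ad G (\<iota> z) (Y + Z)) has_derivative (\<lambda>X. bracket G X Y + bracket G X Z)) (at e\<^sub>0)"
      by (rule has_derivative_transform_within_open[OF
            has_derivative_add[OF bracket_has_derivative bracket_has_derivative] open_D0 e0_mem])
        (simp add: linear_add[OF lin])
  qed
  show "bracket G X (r *\<^sub>R Y) = r *\<^sub>R bracket G X Y" for r Y
  proof (rule D)
    show "((\<lambda>z. Ad G (\<iota> z) (r *\<^sub>R Y)) has_derivative (\<lambda>X. r *\<^sub>R bracket G X Y)) (at e\<^sub>0)"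
      by (rule has_derivative_transform_within_open[OF
            has_derivative_scaleR_right[OF bracket_has_derivative] open_D0 e0_mem])
        (simp add: linear_scale[OF lin])
  qed
qed

text \<open>Differentiate \<open>(p q p\<^sup>-\<^sup>1) p = p q\<close> in \<open>q\<close> along \<open>Y\<close> and then in \<open>p\<close> along \<open>X\<close>, both at the
identity. The right-hand side gives a mixed derivative of the multiplication. The left-hand side gives
the other mixed derivative, from the second factor \<open>p\<close>, plus \<open>[X, Y]\<close>, from the dependence
of \<open>Ad p Y\<close> on \<open>p\<close>.\<close>

lemma bracket_eq_mixed_derivatives:
  defines "B \<equiv> \<lambda>u v. frechet_derivative (\<lambda>x. frechet_derivative chart_mult (at x) u) (at (e\<^sub>0, e\<^sub>0)) v"
  shows "bracket G X Y = B (0, Y) (X, 0) - B (Y, 0) (0, X)"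
proof -
  obtain T where T: "open T" "(e\<^sub>0, e\<^sub>0) \<in> T" "Cinf_on T (\<lambda>(p, q). \<kappa> (\<iota> p \<otimes> \<iota> q \<otimes> inv (\<iota> p)))"
    "\<And>p q. (p, q) \<in> T \<Longrightarrow> p \<in> D\<^sub>0 \<and> q \<in> D\<^sub>0 \<and> \<iota> p \<otimes> \<iota> q \<in> U\<^sub>0 \<and> \<iota> p \<otimes> \<iota> q \<otimes> inv (\<iota> p) \<in> U\<^sub>0"
    using chart_conj_smooth by blast
  define C where "C = (\<lambda>(p, q). \<kappa> (\<iota> p \<otimes> \<iota> q \<otimes> inv (\<iota> p)))"
  have conj: "chart_mult (C (p, q), p) = chart_mult (p, q)" if "(p, q) \<in> T" for p q
    using T(4)[OF that] iota_carrier[of p] iota_carrier[of q]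
    by (simp add: chart_mult_def C_def m_assoc)
  let ?Dm = "frechet_derivative chart_mult"
  let ?S = "(\<lambda>p. (p, e\<^sub>0)) -` T"
  have open_S: "open ?S" by (intro open_vimage T(1) continuous_intros)
  have e0_S: "e\<^sub>0 \<in> ?S" using T(2) by simp
  \<comment> \<open>The identity differentiated in \<open>q\<close>, for fixed \<open>p\<close>.\<close>
  have first: "?Dm (at (e\<^sub>0, p)) (Ad G (\<iota> p) Y, 0) = ?Dm (at (p, e\<^sub>0)) (0, Y)" if p: "p \<in> ?S" for p
  proof -
    have pD: "p \<in> D\<^sub>0" using T(4) p by auto
    let ?R = "(\<lambda>q. (p, q)) -` T"
    have "open ?R" by (intro open_vimage T(1) continuous_intros)
    have Ce0: "C (p, e\<^sub>0) = e\<^sub>0" using iota_carrier[OF pD] by (simp add: C_def kappa_one)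
    have "((\<lambda>q. C (p, q)) has_derivative Ad G (\<iota> p)) (at e\<^sub>0)"
      using Ad_has_derivative[OF iota_carrier[OF pD]] by (simp add: C_def)
    moreover have "((\<lambda>x. chart_mult (x, p)) has_derivative (\<lambda>v. ?Dm (at (e\<^sub>0, p)) (v, 0))) (at (C (p, e\<^sub>0)))"
      unfolding Ce0 by (rule Cinf_on_slice_left[OF chart_mult_smooth(2) chart_mult_e0(2)[OF pD]])
    ultimately have "((\<lambda>q. chart_mult (C (p, q), p)) has_derivative (\<lambda>v. ?Dm (at (e\<^sub>0, p)) (Ad G (\<iota> p) v, 0))) (at e\<^sub>0)"
      by (rule has_derivative_compose)
    then have "((\<lambda>q. chart_mult (p, q)) has_derivative (\<lambda>v. ?Dm (at (e\<^sub>0, p)) (Ad G (\<iota> p) v, 0))) (at e\<^sub>0)"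
      by (rule has_derivative_transform_within_open[OF _ \<open>open ?R\<close>]) (use p conj in auto)
    from has_derivative_unique[OF this Cinf_on_slice_right[OF chart_mult_smooth(2) chart_mult_e0(1)[OF pD]]]
    show ?thesis by metis
  qed
  have "((\<lambda>p. ?Dm (at (e\<^sub>0, p)) (Ad G (\<iota> p) Y, 0)) has_derivative
      (\<lambda>h. B (Ad G (\<iota> e\<^sub>0) Y, 0) (0, h) + ?Dm (at (e\<^sub>0, e\<^sub>0)) (bracket G h Y, 0))) (at e\<^sub>0)"
  proof (rule has_derivative_apply_linear[where f' = "\<lambda>p v. ?Dm (at (e\<^sub>0, p)) (v, 0)", OF finite_dim open_D0 e0_mem])
    show "linear (\<lambda>v. ?Dm (at (e\<^sub>0, p)) (v, 0))" if "p \<in> D\<^sub>0" for p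
    proof -
      have "linear (?Dm (at (e\<^sub>0, p)))"
        by (rule linear_frechet_derivative[OF Cinf_on_differentiable[OF chart_mult_smooth(2) chart_mult_e0(2)[OF that]]])
      from linear_compose[OF _ this, of "\<lambda>v. (v, 0)"] show ?thesis
        by (simp add: comp_def linear_iff)
    qed
    show "((\<lambda>p. ?Dm (at (e\<^sub>0, p)) (b, 0)) has_derivative (\<lambda>h. B (b, 0) (0, h))) (at e\<^sub>0)" for b
      using Cinf_on_slice_right[OF Cinf_on_directional_derivative[OF chart_mult_smooth(2)] chart_mult_dom_e0, of "(b, 0)"]
      by (simp add: B_def)
  qed (rule bracket_has_derivative)
  then have "((\<lambda>p. ?Dm (at (p, e\<^sub>0)) (0, Y)) has_derivative
      (\<lambda>h. B (Ad G (\<iota> e\<^sub>0) Y, 0) (0, h) + ?Dm (at (e\<^sub>0, e\<^sub>0)) (bracket G h Y, 0))) (at e\<^sub>0)"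
    by (rule has_derivative_transform_within_open[OF _ open_S e0_S]) (rule first)
  moreover have "((\<lambda>p. ?Dm (at (p, e\<^sub>0)) (0, Y)) has_derivative (\<lambda>h. B (0, Y) (h, 0))) (at e\<^sub>0)"
    unfolding B_def
    by (rule Cinf_on_slice_left[OF Cinf_on_directional_derivative[OF chart_mult_smooth(2)] chart_mult_dom_e0])
  ultimately have "(\<lambda>h. B (Ad G (\<iota> e\<^sub>0) Y, 0) (0, h) + ?Dm (at (e\<^sub>0, e\<^sub>0)) (bracket G h Y, 0)) = (\<lambda>h. B (0, Y) (h, 0))"
    by (rule has_derivative_unique)
  from fun_cong[OF this, of X] show ?thesis
    by (simp add: chart_mult_derivative_e0 Ad_one eq_diff_eq add.commute)
qed

text \<open>Exchanging \<open>X\<close> and \<open>Y\<close> exchanges the two terms of the previous formula, up to the order of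
differentiation.\<close>

lemma bracket_antisym: "bracket G X Y = - bracket G Y X"
  unfolding bracket_eq_mixed_derivatives
  using mixed_derivatives_commute[OF finite_dim chart_mult_smooth(1) chart_mult_dom_e0 chart_mult_smooth(2)]
  by (metis minus_diff_eq)

section \<open>One-parameter subgroups\<close>

lemma one_param_subgroup_continuous:
  "one_param_subgroup G \<gamma> X \<Longrightarrow> continuous_map euclideanreal (gtop G) \<gamma>"
  by (simp add: one_param_subgroup_def smooth_map_def real_line_def)

lemma one_param_subgroup_carrier: "one_param_subgroup G \<gamma> X \<Longrightarrow> \<gamma> t \<in> carrier G"
  using one_param_subgroup_continuous by (fastforce simp: continuous_map_def)

lemma one_param_subgroup_add: "one_param_subgroup G \<gamma> X \<Longrightarrow> \<gamma> (s + t) = \<gamma> s \<otimes> \<gamma> t"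
  by (simp add: one_param_subgroup_def)

lemma one_param_subgroup_zero: "one_param_subgroup G \<gamma> X \<Longrightarrow> \<gamma> 0 = \<one>"
  using one_param_subgroup_add[of \<gamma> X 0 0] one_param_subgroup_carrier[of \<gamma> X 0]
  by (simp add: r_cancel_one')

lemma one_param_subgroup_minus: "one_param_subgroup G \<gamma> X \<Longrightarrow> \<gamma> (- t) = inv (\<gamma> t)"
  using one_param_subgroup_add[of \<gamma> X "- t" t] one_param_subgroup_carrier[of \<gamma> X]
    one_param_subgroup_zero[of \<gamma> X] by (intro inv_equality[symmetric]) simp_all

lemma one_param_subgroup_derivative:
  "one_param_subgroup G \<gamma> X \<Longrightarrow> ((\<lambda>t. \<kappa> (\<gamma> t)) has_vector_derivative X) (at 0)"
  by (simp add: one_param_subgroup_def comp_def)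

lemma open_curve_preimage:
  "continuous_map euclideanreal (gtop G) c \<Longrightarrow> openin (gtop G) U \<Longrightarrow> open {t. c t \<in> U}"
  by (simp add: continuous_map_def)

lemma one_param_subgroup_scale:
  assumes \<gamma>: "one_param_subgroup G \<gamma> X"
  shows "one_param_subgroup G (\<lambda>t. \<gamma> (r * t)) (r *\<^sub>R X)"
  unfolding one_param_subgroup_def
proof (intro conjI allI)
  have "Cinf_on UNIV (\<lambda>t::real. r * t)"
    by (intro Cinf_on_bounded_linear_apply open_UNIV bounded_linear_mult_right)
  then have "smooth_map real_line real_line (\<lambda>t. r * t)"
    unfolding smooth_map_real_line_iff by (auto simp: real_line_def continuous_intros)
  from smooth_map_compose[OF smooth_manifold_real_line smooth_manifold_real_line manifold this]
  show "smooth_map real_line (lie_manifold G) (\<lambda>t. \<gamma> (r * t))"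
    using \<gamma> by (simp add: one_param_subgroup_def)
  show "\<gamma> (r * (s + t)) = \<gamma> (r * s) \<otimes> \<gamma> (r * t)" for s t
    by (simp add: distrib_left one_param_subgroup_add[OF \<gamma>])
  have "((\<lambda>t. r * t) has_vector_derivative r) (at 0)"
    by (auto intro!: derivative_eq_intros simp: has_real_derivative_iff_has_vector_derivative[symmetric])
  from vector_diff_chain_at[OF this, of "\<lambda>t. \<kappa> (\<gamma> t)" X]
  show "(\<kappa> \<circ> (\<lambda>t. \<gamma> (r * t)) has_vector_derivative r *\<^sub>R X) (at 0)"
    using one_param_subgroup_derivative[OF \<gamma>] by (simp add: comp_def)
qed

lemma one_param_subgroup_conj:
  assumes \<gamma>: "one_param_subgroup G \<gamma> X" and g: "g \<in> carrier G"
  shows "one_param_subgroup G (\<lambda>t. g \<otimes> \<gamma> t \<otimes> inv g) (Ad G g X)"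
  unfolding one_param_subgroup_def
proof (intro conjI allI)
  note car = one_param_subgroup_carrier[OF \<gamma>]
  have "smooth_map real_line (lie_manifold G) \<gamma>" using \<gamma> by (simp add: one_param_subgroup_def)
  from smooth_map_compose[OF smooth_manifold_real_line manifold manifold this two_sided_mult_smooth[OF g inv_closed[OF g]]]
  show "smooth_map real_line (lie_manifold G) (\<lambda>t. g \<otimes> \<gamma> t \<otimes> inv g)" .
  show "g \<otimes> \<gamma> (s + t) \<otimes> inv g = (g \<otimes> \<gamma> s \<otimes> inv g) \<otimes> (g \<otimes> \<gamma> t \<otimes> inv g)" for s t
  proof -
    have "inv g \<otimes> (g \<otimes> (\<gamma> t \<otimes> inv g)) = \<gamma> t \<otimes> inv g"
      using g car by (simp add: m_assoc[symmetric])
    then show ?thesis using g car by (simp add: one_param_subgroup_add[OF \<gamma>] m_assoc)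
  qed
  have "((\<lambda>z. \<kappa> (g \<otimes> \<iota> z \<otimes> inv g)) has_derivative Ad G g) (at (\<kappa> (\<gamma> 0)))"
    using Ad_has_derivative[OF g] by (simp add: one_param_subgroup_zero[OF \<gamma>] kappa_one)
  from vector_derivative_diff_chain_within[OF one_param_subgroup_derivative[OF \<gamma>] has_derivative_at_withinI[OF this]]
  have "((\<lambda>t. \<kappa> (g \<otimes> \<iota> (\<kappa> (\<gamma> t)) \<otimes> inv g)) has_vector_derivative Ad G g X) (at 0)"
    by (simp add: comp_def)
  moreover have "open {t. \<gamma> t \<in> U\<^sub>0}"
    by (rule open_curve_preimage[OF one_param_subgroup_continuous[OF \<gamma>] open_U0])
  moreover have "0 \<in> {t. \<gamma> t \<in> U\<^sub>0}" by (simp add: one_param_subgroup_zero[OF \<gamma>] one_mem)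
  ultimately show "(\<kappa> \<circ> (\<lambda>t. g \<otimes> \<gamma> t \<otimes> inv g) has_vector_derivative Ad G g X) (at 0)"
    unfolding has_vector_derivative_def
    by (rule has_derivative_transform_within_open) simp
qed

text \<open>The curve \<open>\<delta> t = \<gamma> t (\<gamma>' t)\<^sup>-\<^sup>1\<close> has velocity \<open>X - X = 0\<close> at time 0. By the homomorphism
property \<open>\<delta> (t + h) = \<gamma> t (\<delta> h) (\<gamma>' t)\<^sup>-\<^sup>1\<close>, so translation on both sides carries this to every
other time. Hence \<open>\<delta>\<close> is locally constant, and therefore constant.\<close>

lemma one_param_subgroup_unique:
  assumes \<gamma>: "one_param_subgroup G \<gamma> X" and \<gamma>': "one_param_subgroup G \<gamma>' X"
  shows "\<gamma> = \<gamma>'"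
proof -
  note car = one_param_subgroup_carrier[OF \<gamma>] one_param_subgroup_carrier[OF \<gamma>']
  define \<delta> where "\<delta> t = \<gamma> t \<otimes> \<gamma>' (- t)" for t
  have cont: "continuous_map euclideanreal (gtop G) \<delta>"
  proof -
    have "continuous_map euclideanreal euclideanreal (\<lambda>t::real. - t)"
      by (simp add: continuous_intros)
    from continuous_map_compose[OF this one_param_subgroup_continuous[OF \<gamma>']]
    have "continuous_map euclideanreal (gtop G) (\<lambda>t. \<gamma>' (- t))" by (simp add: comp_def)
    then show ?thesis unfolding \<delta>_def
      by (rule continuous_map_mult[OF one_param_subgroup_continuous[OF \<gamma>]])
  qed
  have \<delta>0: "\<delta> 0 = \<one>"
    by (simp add: \<delta>_def one_param_subgroup_zero[OF \<gamma>] one_param_subgroup_zero[OF \<gamma>'])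
  have \<delta>_shift: "\<delta> (t + h) = \<gamma> t \<otimes> \<delta> h \<otimes> \<gamma>' (- t)" for t h
  proof -
    have "- (t + h) = - h + - t" by simp
    then show ?thesis
      unfolding \<delta>_def one_param_subgroup_add[OF \<gamma>, of t h]
      by (simp only: one_param_subgroup_add[OF \<gamma>', of "- h" "- t"]) (simp add: car m_assoc)
  qed
  have deriv0: "((\<lambda>h. \<kappa> (\<delta> h)) has_derivative (\<lambda>_. 0)) (at 0)"
  proof -
    have 1: "((\<lambda>t. \<kappa> (\<gamma> t)) has_derivative (\<lambda>h. h *\<^sub>R X)) (at 0)"
      using one_param_subgroup_derivative[OF \<gamma>] by (simp add: has_vector_derivative_def)
    have 2: "((\<lambda>t. \<kappa> (\<gamma>' (- t))) has_derivative (\<lambda>h. h *\<^sub>R (- X))) (at 0)"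
      using one_param_subgroup_derivative[OF one_param_subgroup_scale[OF \<gamma>', of "- 1"]]
      by (simp add: has_vector_derivative_def)
    have "(\<kappa> (\<gamma> 0), \<kappa> (\<gamma>' (- 0))) = (e\<^sub>0, e\<^sub>0)"
      by (simp add: one_param_subgroup_zero[OF \<gamma>] one_param_subgroup_zero[OF \<gamma>'] kappa_one)
    then have "(chart_mult has_derivative frechet_derivative chart_mult (at (e\<^sub>0, e\<^sub>0)))
        (at (\<kappa> (\<gamma> 0), \<kappa> (\<gamma>' (- 0))))"
      using Cinf_on_has_derivative[OF chart_mult_smooth(2) chart_mult_dom_e0] by simp
    from has_derivative_compose[OF has_derivative_Pair[OF 1 2] this]
    have "((\<lambda>t. chart_mult (\<kappa> (\<gamma> t), \<kappa> (\<gamma>' (- t)))) has_derivative (\<lambda>_. 0)) (at 0)"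
      by (simp add: chart_mult_derivative_e0)
    moreover have "open ({t. \<gamma> t \<in> U\<^sub>0} \<inter> uminus -` {t. \<gamma>' t \<in> U\<^sub>0})"
      by (intro open_Int open_vimage open_curve_preimage one_param_subgroup_continuous[OF \<gamma>]
          one_param_subgroup_continuous[OF \<gamma>'] open_U0 continuous_intros)
    moreover have "0 \<in> {t. \<gamma> t \<in> U\<^sub>0} \<inter> uminus -` {t. \<gamma>' t \<in> U\<^sub>0}"
      by (simp add: one_param_subgroup_zero[OF \<gamma>] one_param_subgroup_zero[OF \<gamma>'] one_mem)
    ultimately show ?thesis
      by (rule has_derivative_transform_within_open) (simp add: chart_mult_def \<delta>_def)
  qed
  have "\<delta> t = \<delta> 0" for t
  proof (rule connected_local_const[of UNIV t 0 \<delta>])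
    show "\<forall>a\<in>UNIV. eventually (\<lambda>b. \<delta> a = \<delta> b) (at a within UNIV)"
    proof
      fix a
      obtain V \<psi> where V: "(V, \<psi>) \<in> atlas G" "\<delta> a \<in> V"
        using smooth_manifold_chart_at[OF manifold, of "\<delta> a"] car by (auto simp: \<delta>_def)
      have V': "(V, \<psi>) \<in> snd (lie_manifold G)" using V(1) by simp
      have "open {t. \<delta> t \<in> V}"
        using open_curve_preimage[OF cont] smooth_manifold_chart(1)[OF manifold V'] by simp
      then obtain r where r: "r > 0" "ball a r \<subseteq> {t. \<delta> t \<in> V}"
        using V(2) open_contains_ball by blast
      have "((\<lambda>t. \<psi> (\<delta> t)) has_derivative (\<lambda>_. 0)) (at t)" if t: "t \<in> ball a r" for t
      proof -
        let ?f = "\<lambda>x. \<gamma> t \<otimes> x \<otimes> \<gamma>' (- t)"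
        have "?f \<one> = \<delta> t" using car by (simp add: \<delta>_def)
        then have "(\<lambda>z. \<psi> (?f (\<iota> z))) differentiable (at e\<^sub>0)"
          using r t V(1) car by (intro smooth_map_differentiable[where U = V] two_sided_mult_smooth) auto
        then obtain f' where f': "((\<lambda>z. \<psi> (?f (\<iota> z))) has_derivative f') (at (\<kappa> (\<delta> 0)))"
          by (auto simp: differentiable_def \<delta>0 kappa_one)
        have f'0: "f' 0 = 0" using has_derivative_linear[OF f'] by (rule linear_0)
        from has_derivative_compose[OF deriv0 f']
        have "((\<lambda>h. \<psi> (?f (\<iota> (\<kappa> (\<delta> h))))) has_derivative (\<lambda>_. 0)) (at 0)" by (simp add: f'0)
        moreover have "open {h. \<delta> h \<in> U\<^sub>0}" by (rule open_curve_preimage[OF cont open_U0])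
        moreover have "0 \<in> {h. \<delta> h \<in> U\<^sub>0}" by (simp add: \<delta>0 one_mem)
        ultimately have "((\<lambda>h. \<psi> (\<delta> (t + h))) has_derivative (\<lambda>_. 0)) (at 0)"
          by (rule has_derivative_transform_within_open) (simp add: \<delta>_shift)
        then have "((\<lambda>h. \<psi> (\<delta> (t + h))) has_derivative (\<lambda>_. 0)) (at (t - t))" by simp
        moreover have "((\<lambda>s. s - t) has_derivative (\<lambda>h. h)) (at t)"
          by (auto intro!: derivative_eq_intros)
        ultimately show ?thesis
          using has_derivative_compose[of "\<lambda>s. s - t" "\<lambda>h. h" t UNIV "\<lambda>h. \<psi> (\<delta> (t + h))" "\<lambda>_. 0"] by simp
      qed
      then have "((\<lambda>t. \<psi> (\<delta> t)) has_derivative (\<lambda>_. 0)) (at t within ball a r)" if "t \<in> ball a r" for t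
        using that by (blast intro: has_derivative_at_withinI)
      then have const: "\<psi> (\<delta> a) = \<psi> (\<delta> t)" if "t \<in> ball a r" for t
        using has_derivative_zero_unique[OF convex_ball, of a r "\<lambda>t. \<psi> (\<delta> t)" a t] that r(1) by simp
      have "\<delta> a = \<delta> t" if "t \<in> ball a r" for t
      proof -
        have "\<delta> a \<in> V" "\<delta> t \<in> V" using r that V(2) by auto
        then show ?thesis using const[OF that] chart_inj_on[OF manifold V'] by (auto dest: inj_onD)
      qed
      then show "eventually (\<lambda>b. \<delta> a = \<delta> b) (at a within UNIV)"
        unfolding eventually_at using r(1) by (auto simp: dist_commute intro!: exI[of _ r])
    qed
  qed auto
  then have "\<delta> t = \<one>" for t unfolding \<delta>0 .
  then have "\<gamma> t \<otimes> inv (\<gamma>' t) = \<one>" for t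
    by (simp add: \<delta>_def one_param_subgroup_minus[OF \<gamma>'])
  moreover have "\<gamma> t = \<gamma> t \<otimes> inv (\<gamma>' t) \<otimes> \<gamma>' t" for t using car by (simp add: m_assoc)
  ultimately have "\<gamma> t = \<gamma>' t" for t using car by simp
  then show ?thesis by blast
qed

lemma lie_exp_one_param_subgroup:
  assumes \<gamma>: "one_param_subgroup G \<gamma> X"
  shows "lie_exp G (t *\<^sub>R X) = \<gamma> t"
proof -
  note sc = one_param_subgroup_scale[OF \<gamma>, of t]
  have "(THE \<beta>. one_param_subgroup G \<beta> (t *\<^sub>R X)) = (\<lambda>s. \<gamma> (t * s))"
    using sc one_param_subgroup_unique[OF _ sc] by (rule the_equality)
  then show ?thesis by (simp add: lie_exp_def)
qed

section \<open>The coadjoint representation\<close>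

lemma coAd_apply: "g \<in> carrier G \<Longrightarrow> blinfun_apply (coAd G g \<nu>) Y = \<nu> (Ad G (inv g) Y)"
  unfolding coAd_def
  by (intro bounded_linear_Blinfun_apply[THEN fun_cong]
      bounded_linear_compose[OF blinfun.bounded_linear_right Ad_bounded_linear]) simp

lemma coad_apply: "blinfun_apply (coad G X \<nu>) Y = - \<nu> (bracket G X Y)"
  unfolding coad_def
  by (intro bounded_linear_Blinfun_apply[THEN fun_cong] bounded_linear_minus
      bounded_linear_compose[OF blinfun.bounded_linear_right]
      linear_imp_bounded_linear[OF finite_dim bracket_linear_right])

lemma coAd_one: "coAd G \<one> \<nu> = \<nu>"
  by (rule blinfun_eqI) (simp add: coAd_apply Ad_one)

lemma coAd_mult:
  assumes "g \<in> carrier G" "h \<in> carrier G"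
  shows "coAd G (g \<otimes> h) \<nu> = coAd G g (coAd G h \<nu>)"
  using assms by (intro blinfun_eqI) (simp add: coAd_apply inv_mult_group Ad_mult)

lemma coAd_bounded_linear:
  assumes "g \<in> carrier G"
  shows "bounded_linear (coAd G g)"
proof (rule linear_imp_bounded_linear[OF finite_dim_dual[OF finite_dim]])
  show "linear (coAd G g)"
    by (intro linearI blinfun_eqI) (simp_all add: coAd_apply[OF assms] blinfun.add_left blinfun.scaleR_left)
qed

lemma coad_minus: "coad G (- X) \<nu> = - coad G X \<nu>"
  by (rule blinfun_eqI) (simp add: coad_apply blinfun.minus_left linear_neg[OF bracket_linear_left] blinfun.minus_right)

text \<open>Stated for the curve of inverses because \<open>coAd (c\<^sup>-\<^sup>1) \<nu> = \<nu> \<circ> Ad c\<close>, whose derivative is the bracket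
by definition.\<close>

lemma coAd_inverse_curve_derivative:
  assumes c: "((\<lambda>t. \<kappa> (c t)) has_vector_derivative X) (at 0)" and c0: "c 0 = \<one>"
    and S: "open S" "0 \<in> S" "\<And>t. t \<in> S \<Longrightarrow> c t \<in> U\<^sub>0"
  shows "((\<lambda>t. coAd G (inv (c t)) \<nu>) has_vector_derivative - coad G X \<nu>) (at 0)"
proof (rule has_vector_derivative_dual[OF finite_dim])
  fix Y
  have "((\<lambda>z. Ad G (\<iota> z) Y) has_derivative (\<lambda>X. bracket G X Y)) (at (\<kappa> (c 0)))"
    using bracket_has_derivative by (simp add: c0 kappa_one)
  then have "((\<lambda>z. \<nu> (Ad G (\<iota> z) Y)) has_derivative (\<lambda>X. \<nu> (bracket G X Y))) (at (\<kappa> (c 0)))"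
    by (rule bounded_linear.has_derivative[OF blinfun.bounded_linear_right])
  from vector_derivative_diff_chain_within[OF c has_derivative_at_withinI[OF this]]
  have "((\<lambda>t. \<nu> (Ad G (\<iota> (\<kappa> (c t))) Y)) has_vector_derivative \<nu> (bracket G X Y)) (at 0)"
    by (simp add: comp_def)
  then show "((\<lambda>t. coAd G (inv (c t)) \<nu> Y) has_vector_derivative (- coad G X \<nu>) Y) (at 0)"
    unfolding has_vector_derivative_def
    by (rule has_derivative_transform_within_open[OF _ S(1,2), THEN has_derivative_eq_rhs])
      (use S(3) U0_carrier in \<open>simp_all add: coAd_apply blinfun.minus_left coad_apply\<close>)
qed

text \<open>The group law gives the velocity at time \<open>t\<close> from that at time 0 in two ways. The first form shows
that the flow satisfies its differential equation. The second expresses the velocity as the flow of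
another fixed vector, which allows induction on the order of differentiation.\<close>

lemma coAd_flow_derivative:
  assumes \<gamma>: "one_param_subgroup G \<gamma> X"
  shows "((\<lambda>s. coAd G (\<gamma> s) \<nu>) has_vector_derivative coad G X (coAd G (\<gamma> t) \<nu>)) (at t)"
    and "((\<lambda>s. coAd G (\<gamma> s) \<nu>) has_vector_derivative coAd G (\<gamma> t) (coad G X \<nu>)) (at t)"
proof -
  note car = one_param_subgroup_carrier[OF \<gamma>]
  have at0: "((\<lambda>s. coAd G (\<gamma> s) \<mu>) has_vector_derivative coad G X \<mu>) (at 0)" for \<mu>
  proof -
    note \<gamma>m = one_param_subgroup_scale[OF \<gamma>, of "- 1"]
    have "((\<lambda>s. coAd G (inv (\<gamma> (- s))) \<mu>) has_vector_derivative - coad G (- X) \<mu>) (at 0)"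
      using coAd_inverse_curve_derivative[of "\<lambda>t. \<gamma> (- 1 * t)" "- X" "{t. \<gamma> (- 1 * t) \<in> U\<^sub>0}" \<mu>]
        one_param_subgroup_derivative[OF \<gamma>m] one_param_subgroup_zero[OF \<gamma>] one_mem
        open_curve_preimage[OF one_param_subgroup_continuous[OF \<gamma>m] open_U0] by simp
    then show ?thesis using car by (simp add: one_param_subgroup_minus[OF \<gamma>] coad_minus)
  qed
  have shift: "((\<lambda>s. f (s - t)) has_vector_derivative f') (at t)"
    if "(f has_vector_derivative f') (at 0)" for f :: "real \<Rightarrow> 'e \<Rightarrow>\<^sub>L real" and f'
  proof -
    have "((\<lambda>s. s - t) has_vector_derivative 1) (at t)"
      by (auto intro!: derivative_eq_intros)
    from vector_diff_chain_at[OF this, of f f'] that show ?thesis by (simp add: comp_def)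
  qed
  have "((\<lambda>s. coAd G (\<gamma> (s - t)) (coAd G (\<gamma> t) \<nu>)) has_vector_derivative coad G X (coAd G (\<gamma> t) \<nu>)) (at t)"
    by (rule shift[OF at0])
  moreover have "coAd G (\<gamma> (s - t)) (coAd G (\<gamma> t) \<nu>) = coAd G (\<gamma> s) \<nu>" for s
    using one_param_subgroup_add[OF \<gamma>, of "s - t" t] car by (simp add: coAd_mult)
  ultimately show "((\<lambda>s. coAd G (\<gamma> s) \<nu>) has_vector_derivative coad G X (coAd G (\<gamma> t) \<nu>)) (at t)"
    by simp
  have "((\<lambda>s. coAd G (\<gamma> t) (coAd G (\<gamma> (s - t)) \<nu>)) has_vector_derivative coAd G (\<gamma> t) (coad G X \<nu>)) (at t)"
    by (rule bounded_linear.has_vector_derivative[OF coAd_bounded_linear[OF car] shift[OF at0]])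
  moreover have "coAd G (\<gamma> t) (coAd G (\<gamma> (s - t)) \<nu>) = coAd G (\<gamma> s) \<nu>" for s
    using one_param_subgroup_add[OF \<gamma>, of t "s - t"] car by (simp add: coAd_mult)
  ultimately show "((\<lambda>s. coAd G (\<gamma> s) \<nu>) has_vector_derivative coAd G (\<gamma> t) (coad G X \<nu>)) (at t)"
    by simp
qed

text \<open>By the second form of the derivative, derivatives of \<open>t \<mapsto> coAd (\<gamma> t) \<nu>\<close> are again of the
same kind, with \<open>coad X \<nu>\<close> in place of \<open>\<nu>\<close>.\<close>

lemma coAd_flow_smooth:
  assumes \<gamma>: "one_param_subgroup G \<gamma> X"
  shows "Cinf_on UNIV (\<lambda>(t, \<nu>). coAd G (\<gamma> t) \<nu>)"
proof -
  have "Ck_on k UNIV (\<lambda>t. coAd G (\<gamma> t) \<nu>)" for k \<nu>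
  proof (induction k arbitrary: \<nu>)
    case 0
    have "isCont (\<lambda>t. coAd G (\<gamma> t) \<nu>) t" for t
      by (rule has_vector_derivative_continuous[OF coAd_flow_derivative(1)[OF \<gamma>]])
    then show ?case by (simp add: continuous_at_imp_continuous_on)
  next
    case (Suc k)
    show ?case
      by (rule Ck_on_SucI[OF open_UNIV coAd_flow_derivative(2)[OF \<gamma>, unfolded has_vector_derivative_def]])
        (rule Ck_on_bounded_linear[OF open_UNIV bounded_linear_scaleR_right Suc.IH])
  qed
  then have "Cinf_on UNIV (\<lambda>t. coAd G (\<gamma> t) \<nu>)" for \<nu> by (simp add: Cinf_on_def)
  from Cinf_on_compose[OF finite_dim_euclidean open_UNIV open_UNIV _
      Cinf_on_bounded_linear_apply[OF open_UNIV bounded_linear_fst] this]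
  have 1: "Cinf_on UNIV (\<lambda>p. coAd G (\<gamma> (fst p)) \<nu>)" for \<nu> :: "'e \<Rightarrow>\<^sub>L real" by simp
  have "Cinf_on UNIV (\<lambda>p. coAd G (\<gamma> (fst p)) (snd p))"
    by (rule Cinf_on_apply_linear[OF finite_dim_dual[OF finite_dim] open_UNIV _ 1
          Cinf_on_bounded_linear_apply[OF open_UNIV bounded_linear_snd]])
      (rule bounded_linear.linear[OF coAd_bounded_linear[OF one_param_subgroup_carrier[OF \<gamma>]]])
  then show ?thesis by (simp add: case_prod_beta')
qed

text \<open>Near the identity this is differentiability in the chart. Elsewhere it follows
from \<open>Ad x = Ad g \<circ> Ad (g\<^sup>-\<^sup>1 x)\<close> for \<open>x\<close> near \<open>g\<close>.\<close>

lemma Ad_continuous: "continuous_map (gtop G) euclidean (\<lambda>g. Ad G g Y)"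
  unfolding continuous_map_eq_topcontinuous_at topcontinuous_at_def
proof (intro ballI conjI allI impI)
  fix g assume g: "g \<in> topspace (gtop G)"
  then have g': "g \<in> carrier G" by simp
  show "g \<in> topspace (gtop G)" by (rule g)
  show "(\<lambda>g. Ad G g Y) \<in> topspace (gtop G) \<rightarrow> topspace euclidean" by simp
  fix V :: "'e set" assume "openin euclidean V \<and> Ad G g Y \<in> V"
  then have V: "open V" "Ad G g Y \<in> V" by simp_all
  have "isCont (\<lambda>z. Ad G (\<iota> z) Y) e\<^sub>0"
    using bracket_has_derivative has_derivative_continuous by blast
  then have "isCont (\<lambda>z. Ad G g (Ad G (\<iota> z) Y)) e\<^sub>0"
    by (rule bounded_linear.isCont[OF Ad_bounded_linear[OF g']])
  moreover have "Ad G g (Ad G (\<iota> e\<^sub>0) Y) \<in> V" using V by (simp add: Ad_one)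
  ultimately obtain N where N: "open N" "e\<^sub>0 \<in> N" "\<And>z. z \<in> N \<Longrightarrow> Ad G g (Ad G (\<iota> z) Y) \<in> V"
    using V(1) unfolding continuous_at_open by meson
  let ?W = "{x \<in> U\<^sub>0. \<kappa> x \<in> N}"
  have "openin (gtop G) ?W"
    using openin_chart_preimage[OF manifold id_chart_mem N(1)] by simp
  moreover have "continuous_map (gtop G) (gtop G) (\<lambda>x. inv g \<otimes> x)"
    using left_mult_smooth[of "inv g"] g' by (simp add: smooth_map_def)
  ultimately have "openin (gtop G) {x \<in> topspace (gtop G). inv g \<otimes> x \<in> ?W}"
    by (rule openin_continuous_map_preimage[rotated])
  then have "openin (gtop G) {x \<in> carrier G. inv g \<otimes> x \<in> ?W}"
    by (simp only: topspace_gtop)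
  moreover have "g \<in> {x \<in> carrier G. inv g \<otimes> x \<in> ?W}"
    using g' one_mem N(2) by (simp add: kappa_one)
  moreover have "\<forall>x\<in>{x \<in> carrier G. inv g \<otimes> x \<in> ?W}. Ad G x Y \<in> V"
  proof
    fix x assume x: "x \<in> {x \<in> carrier G. inv g \<otimes> x \<in> ?W}"
    then have "Ad G g (Ad G (inv g \<otimes> x) Y) \<in> V" using N(3)[of "\<kappa> (inv g \<otimes> x)"] by simp
    moreover have "Ad G g (Ad G (inv g \<otimes> x) Y) = Ad G x Y"
      using x g' Ad_mult[of g "inv g \<otimes> x" Y] by (simp add: m_assoc[symmetric])
    ultimately show "Ad G x Y \<in> V" by simp
  qed
  ultimately show "\<exists>U. openin (gtop G) U \<and> g \<in> U \<and> (\<forall>y\<in>U. Ad G y Y \<in> V)" by blast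
qed

lemma coAd_continuous:
  assumes "continuous_map T (gtop G) f"
  shows "continuous_map T euclidean (\<lambda>p. coAd G (f p) \<nu>)"
proof (rule continuous_map_dual[OF finite_dim])
  fix Y
  have "continuous_map euclidean euclidean (blinfun_apply \<nu>)"
    by (simp add: linear_continuous_on blinfun.bounded_linear_right)
  from continuous_map_compose[OF continuous_map_compose[OF continuous_map_inverse[OF assms] Ad_continuous[of Y]] this]
  have "continuous_map T euclidean (\<lambda>p. \<nu> (Ad G (inv (f p)) Y))" by (simp add: comp_def)
  then show "continuous_map T euclidean (\<lambda>p. coAd G (f p) \<nu> Y)"
    by (rule continuous_map_eq) (use assms in \<open>auto simp: continuous_map_def coAd_apply Pi_iff\<close>)
qed

end

section \<open>Coadjoint orbits and their tangent vectors\<close>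

locale coadjoint_orbit_structure = lie_group_structure G
  for G :: "('g, 'e::real_normed_vector, 'm) lie_data_scheme" (structure) +
  fixes \<eta> :: "'e \<Rightarrow>\<^sub>L real"
  assumes compact_group: "compact_space (gtop G)"
begin

abbreviation M :: "('e \<Rightarrow>\<^sub>L real) set" where "M \<equiv> coadjoint_orbit G \<eta>"

lemma orbit_eq: "M = (\<lambda>g. coAd G g \<eta>) ` carrier G"
  by (auto simp: coadjoint_orbit_def orbit_def)

lemma orbit_nonempty: "M \<noteq> {}"
  unfolding orbit_eq using one_closed by blast

lemma orbit_closed: "g \<in> carrier G \<Longrightarrow> \<nu> \<in> M \<Longrightarrow> coAd G g \<nu> \<in> M"
  unfolding orbit_eq by (auto simp: coAd_mult[symmetric])

lemma orbit_compact: "compact M"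
proof -
  have "compactin euclidean ((\<lambda>g. coAd G g \<eta>) ` topspace (gtop G))"
    by (rule image_compactin[OF _ coAd_continuous[OF continuous_map_id[unfolded id_def]]])
      (use compact_group in \<open>simp add: compact_space_def\<close>)
  then show ?thesis by (simp add: orbit_eq)
qed

text \<open>The inverses of the points of a coordinate line through the identity, applied to \<open>\<nu>\<close>.\<close>

lemma tangent_curve:
  assumes \<nu>: "\<nu> \<in> M" and \<zeta>: "\<zeta> \<in> tangent G \<nu>"
  obtains c S where "open S" "0 \<in> S" "c ` S \<subseteq> M" "c 0 = \<nu>" "(c has_vector_derivative \<zeta>) (at (0::real))"
proof -
  obtain X where X: "\<zeta> = coad G X \<nu>" using \<zeta> by (auto simp: tangent_def)
  define p where "p t = e\<^sub>0 + t *\<^sub>R (- X)" for t :: real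
  define S where "S = p -` D\<^sub>0"
  have p0: "p 0 = e\<^sub>0" by (simp add: p_def)
  have open_S: "open S"
    unfolding S_def p_def by (intro open_vimage open_D0 continuous_intros)
  have S0: "0 \<in> S" using e0_mem by (simp add: S_def p0)
  have mem: "\<iota> (p t) \<in> U\<^sub>0" if "t \<in> S" for t using that iota_mem by (simp add: S_def)
  have "(p has_vector_derivative - X) (at 0)"
    unfolding p_def by (auto intro!: derivative_eq_intros)
  then have "((\<lambda>t. \<kappa> (\<iota> (p t))) has_vector_derivative - X) (at 0)"
    unfolding has_vector_derivative_def
    by (rule has_derivative_transform_within_open[OF _ open_S S0]) (simp add: S_def)
  from coAd_inverse_curve_derivative[OF this _ open_S S0 mem]
  have "((\<lambda>t. coAd G (inv (\<iota> (p t))) \<nu>) has_vector_derivative \<zeta>) (at 0)"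
    by (simp add: p0 coad_minus X)
  moreover have "(\<lambda>t. coAd G (inv (\<iota> (p t))) \<nu>) ` S \<subseteq> M"
    using orbit_closed[OF _ \<nu>] U0_carrier[OF mem] by blast
  ultimately show thesis
    using that[OF open_S S0, of "\<lambda>t. coAd G (inv (\<iota> (p t))) \<nu>"] by (simp add: p0 coAd_one)
qed

text \<open>A derivative within the orbit need not be unique as a linear map, but it is determined on velocities
of curves in the orbit.\<close>

lemma derivative_on_tangent_unique:
  assumes \<nu>: "\<nu> \<in> M" and \<zeta>: "\<zeta> \<in> tangent G \<nu>"
    and f1: "(f has_derivative f1) (at \<nu> within M)" and f2: "(f has_derivative f2) (at \<nu> within M)"
  shows "f1 \<zeta> = f2 \<zeta>"
proof -
  obtain c S where c: "open S" "0 \<in> S" "c ` S \<subseteq> M" "c 0 = \<nu>" "(c has_vector_derivative \<zeta>) (at (0::real))"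
    using tangent_curve[OF \<nu> \<zeta>] by blast
  have cS: "(c has_vector_derivative \<zeta>) (at 0 within S)"
    by (rule has_vector_derivative_at_within[OF c(5)])
  have D: "((\<lambda>t. f (c t)) has_vector_derivative f' \<zeta>) (at 0)"
    if "(f has_derivative f') (at \<nu> within M)" for f'
  proof -
    have "(f has_derivative f') (at (c 0) within c ` S)"
      unfolding c(4) by (rule has_derivative_subset[OF that c(3)])
    from vector_derivative_diff_chain_within[OF cS this] show ?thesis
      by (simp add: comp_def at_within_open[OF c(2,1)])
  qed
  show ?thesis using vector_derivative_unique_at[OF D[OF f1] D[OF f2]] .
qed

lemma frechet_derivative_on_tangent:
  assumes "\<nu> \<in> M" "\<zeta> \<in> tangent G \<nu>" "(f has_derivative f') (at \<nu> within M)"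
  shows "frechet_derivative f (at \<nu> within M) \<zeta> = f' \<zeta>"
proof -
  have "(f has_derivative frechet_derivative f (at \<nu> within M)) (at \<nu> within M)"
    using assms(3) differentiable_def frechet_derivative_works by blast
  then show ?thesis using derivative_on_tangent_unique assms by blast
qed

section \<open>Hamiltonian flows\<close>

text \<open>The value \<open>\<nu> [X, Y]\<close> depends on \<open>X\<close> only through \<open>coad X \<nu>\<close>, and by antisymmetry the same holds
for \<open>Y\<close>.\<close>

lemma kks_form_eq: "kks_form G \<nu> (coad G X \<nu>) (coad G Y \<nu>) = \<nu> (bracket G X Y)"
  unfolding kks_form_def
proof (rule the_equality)
  show "\<exists>X' Y'. coad G X \<nu> = coad G X' \<nu> \<and> coad G Y \<nu> = coad G Y' \<nu> \<and> \<nu> (bracket G X Y) = \<nu> (bracket G X' Y')"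
    by blast
  fix a assume "\<exists>X' Y'. coad G X \<nu> = coad G X' \<nu> \<and> coad G Y \<nu> = coad G Y' \<nu> \<and> a = \<nu> (bracket G X' Y')"
  then obtain X' Y' where eq: "coad G X \<nu> = coad G X' \<nu>" "coad G Y \<nu> = coad G Y' \<nu>"
    and a: "a = \<nu> (bracket G X' Y')" by blast
  have "\<nu> (bracket G X' Y') = \<nu> (bracket G X Y')"
    using arg_cong[OF eq(1), of "\<lambda>f. blinfun_apply f Y'"] by (simp add: coad_apply)
  also have "\<dots> = - \<nu> (bracket G Y' X)" by (subst bracket_antisym) (simp add: blinfun.minus_right)
  also have "\<dots> = - \<nu> (bracket G Y X)"
    using arg_cong[OF eq(2), of "\<lambda>f. blinfun_apply f X"] by (simp add: coad_apply)
  also have "\<dots> = \<nu> (bracket G X Y)" by (subst bracket_antisym) (simp add: blinfun.minus_right)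
  finally show "a = \<nu> (bracket G X Y)" using a by simp
qed

lemma hamiltonian_vector_coad:
  assumes \<nu>: "\<nu> \<in> M"
  shows "hamiltonian_vector G M (\<lambda>\<mu>. \<mu> X) \<nu> (coad G X \<nu>)"
  unfolding hamiltonian_vector_def
proof (intro conjI ballI)
  show "coad G X \<nu> \<in> tangent G \<nu>" by (simp add: tangent_def)
  fix \<zeta> assume \<zeta>: "\<zeta> \<in> tangent G \<nu>"
  then obtain Y where Y: "\<zeta> = coad G Y \<nu>" by (auto simp: tangent_def)
  have "((\<lambda>\<mu>::'e \<Rightarrow>\<^sub>L real. \<mu> X) has_derivative (\<lambda>\<mu>. \<mu> X)) (at \<nu> within M)"
    by (rule bounded_linear_imp_has_derivative[OF blinfun.bounded_linear_left])
  then have "frechet_derivative (\<lambda>\<mu>::'e \<Rightarrow>\<^sub>L real. \<mu> X) (at \<nu> within M) \<zeta> = \<zeta> X"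
    by (rule frechet_derivative_on_tangent[OF \<nu> \<zeta>])
  also have "\<dots> = - \<nu> (bracket G Y X)" by (simp add: Y coad_apply)
  also have "\<dots> = \<nu> (bracket G X Y)" by (subst bracket_antisym) (simp add: blinfun.minus_right)
  finally show "kks_form G \<nu> (coad G X \<nu>) \<zeta> = frechet_derivative (\<lambda>\<mu>::'e \<Rightarrow>\<^sub>L real. \<mu> X) (at \<nu> within M) \<zeta>"
    by (simp add: Y kks_form_eq)
qed

lemma hamiltonian_flow_coAd:
  assumes \<gamma>: "one_param_subgroup G \<gamma> X"
  shows "hamiltonian_flow G M (\<lambda>t \<nu>. \<nu> X) (\<lambda>t. coAd G (\<gamma> t))"
  unfolding hamiltonian_flow_def
proof (intro conjI ballI)
  have "bounded_linear (\<lambda>p :: real \<times> ('e \<Rightarrow>\<^sub>L real). blinfun_apply (snd p) X)"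
    by (rule bounded_linear_compose[OF blinfun.bounded_linear_left bounded_linear_snd])
  from Cinf_on_bounded_linear_apply[OF open_UNIV this]
  show "smooth_on ({0..1} \<times> M) (\<lambda>(t::real, \<nu>). blinfun_apply \<nu> X)"
    by (rule smooth_on_subset_Cinf_on) auto
  show "smooth_on ({0..1} \<times> M) (\<lambda>(t, \<nu>). coAd G (\<gamma> t) \<nu>)"
    by (rule smooth_on_subset_Cinf_on[OF coAd_flow_smooth[OF \<gamma>]]) simp
  show "coAd G (\<gamma> 0) \<nu> = \<nu>" for \<nu> by (simp add: one_param_subgroup_zero[OF \<gamma>] coAd_one)
  fix t :: real and \<nu> assume \<nu>: "\<nu> \<in> M"
  show mem: "coAd G (\<gamma> t) \<nu> \<in> M"
    by (rule orbit_closed[OF one_param_subgroup_carrier[OF \<gamma>] \<nu>])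
  show "\<exists>\<xi>. ((\<lambda>s. coAd G (\<gamma> s) \<nu>) has_vector_derivative \<xi>) (at t within {0..1}) \<and>
      hamiltonian_vector G M (\<lambda>\<nu>. \<nu> X) (coAd G (\<gamma> t) \<nu>) \<xi>"
    using has_vector_derivative_at_within[OF coAd_flow_derivative(1)[OF \<gamma>]] hamiltonian_vector_coad[OF mem]
    by blast
qed

text \<open>An element of \<^const>\<open>Ham\<close> is the time-one map of a flow, so the flow is run at \<open>t\<close> times its
speed.\<close>

lemma coAd_flow_Ham:
  assumes \<gamma>: "one_param_subgroup G \<gamma> X"
  shows "restrict (coAd G (\<gamma> t)) M \<in> Ham G M"
  unfolding Ham_def
  using hamiltonian_flow_coAd[OF one_param_subgroup_scale[OF \<gamma>, of t]] by fastforce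

lemma circle_action_eq:
  assumes \<gamma>: "one_param_subgroup G \<gamma> X"
  shows "circle_action G M X t = restrict (coAd G (\<gamma> t)) M"
  by (simp add: circle_action_def lie_exp_one_param_subgroup[OF \<gamma>])

lemma hamiltonian_circle_action_coAd:
  assumes \<gamma>: "one_param_subgroup G \<gamma> X" and closed: "\<gamma> 1 = \<one>"
  shows "hamiltonian_circle_action G M (circle_action G M X)"
  unfolding hamiltonian_circle_action_def circle_action_eq[OF \<gamma>]
proof (intro conjI allI)
  note car = one_param_subgroup_carrier[OF \<gamma>]
  show "restrict (coAd G (\<gamma> t)) M \<in> Ham G M" for t by (rule coAd_flow_Ham[OF \<gamma>])
  show "restrict (coAd G (\<gamma> (s + t))) M = compose M (restrict (coAd G (\<gamma> s)) M) (restrict (coAd G (\<gamma> t)) M)" for s t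
    using car orbit_closed
    by (auto simp: compose_def restrict_def one_param_subgroup_add[OF \<gamma>] coAd_mult)
  show "restrict (coAd G (\<gamma> 1)) M = restrict id M"
    by (auto simp: closed coAd_one restrict_def)
  show "smooth_on (UNIV \<times> M) (\<lambda>(t, \<nu>). restrict (coAd G (\<gamma> t)) M \<nu>)"
    by (rule smooth_on_subset_Cinf_on[OF coAd_flow_smooth[OF \<gamma>]]) auto
qed

end

section \<open>The smooth topology and linear maps\<close>

text \<open>If \<open>a\<close> is unbounded above then so is \<open>b\<close>, and all real sets without upper bound have the same
(default) supremum.\<close>

lemma abs_SUP_diff_le:
  fixes a b :: "'i \<Rightarrow> real"
  assumes "M \<noteq> {}" and close: "\<And>x. x \<in> M \<Longrightarrow> \<bar>a x - b x\<bar> \<le> r"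
  shows "\<bar>(SUP x\<in>M. a x) - (SUP x\<in>M. b x)\<bar> \<le> r"
proof (cases "bdd_above (a ` M)")
  case True
  then obtain K where K: "\<And>x. x \<in> M \<Longrightarrow> a x \<le> K" by (auto simp: bdd_above_def)
  have "b x \<le> K + r" if "x \<in> M" for x using K[OF that] close[OF that] by linarith
  then have b: "bdd_above (b ` M)" by (auto simp: bdd_above_def)
  have "(SUP x\<in>M. a x) \<le> (SUP x\<in>M. b x) + r"
  proof (rule cSUP_least[OF assms(1)])
    fix x assume x: "x \<in> M"
    show "a x \<le> (SUP x\<in>M. b x) + r" using cSUP_upper[OF x b] close[OF x] by linarith
  qed
  moreover have "(SUP x\<in>M. b x) \<le> (SUP x\<in>M. a x) + r"
  proof (rule cSUP_least[OF assms(1)])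
    fix x assume x: "x \<in> M"
    show "b x \<le> (SUP x\<in>M. a x) + r" using cSUP_upper[OF x True] close[OF x] by linarith
  qed
  ultimately show ?thesis by linarith
next
  case False
  have "\<not> bdd_above (b ` M)"
  proof
    assume "bdd_above (b ` M)"
    then obtain K where K: "\<And>x. x \<in> M \<Longrightarrow> b x \<le> K" by (auto simp: bdd_above_def)
    have "a x \<le> K + r" if "x \<in> M" for x using K[OF that] close[OF that] by linarith
    then show False using False by (auto simp: bdd_above_def)
  qed
  then have "(\<forall>y\<in>a ` M. y \<le> z) = (\<forall>y\<in>b ` M. y \<le> z)" for z
    using False unfolding bdd_above_def by blast
  then have "(SUP x\<in>M. a x) = (SUP x\<in>M. b x)" unfolding Sup_real_def by simp
  moreover obtain x where "x \<in> M" using assms(1) by blast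
  then have "0 \<le> r" using close[of x] by linarith
  ultimately show ?thesis by simp
qed

context coadjoint_orbit_structure
begin

text \<open>Local smooth extensions of \<open>h\<close> and \<open>Y\<close> to the ambient space give one of the derivative, because \<open>Y\<close>
is tangent to the orbit and derivatives are determined there.\<close>

lemma smooth_on_derivative_along:
  assumes h: "smooth_on M h" and Y: "Y \<in> vector_fields G M"
  shows "smooth_on M (\<lambda>\<nu>. frechet_derivative h (at \<nu> within M) (Y \<nu>))"
  unfolding smooth_on_def
proof
  fix \<nu> assume \<nu>: "\<nu> \<in> M"
  have Y': "smooth_on M Y" "\<And>\<mu>. \<mu> \<in> M \<Longrightarrow> Y \<mu> \<in> tangent G \<mu>"
    using Y by (auto simp: vector_fields_def)
  obtain U g where U: "open U" "\<nu> \<in> U" "Cinf_on U g" "\<And>y. y \<in> M \<Longrightarrow> y \<in> U \<Longrightarrow> g y = h y"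
    using smooth_onE[OF h \<nu>] by blast
  obtain V Z where V: "open V" "\<nu> \<in> V" "Cinf_on V Z" "\<And>y. y \<in> M \<Longrightarrow> y \<in> V \<Longrightarrow> Z y = Y y"
    using smooth_onE[OF Y'(1) \<nu>] by blast
  let ?W = "U \<inter> V"
  have W: "open ?W" using U(1) V(1) by blast
  have smooth: "Cinf_on ?W (\<lambda>\<mu>. frechet_derivative g (at \<mu>) (Z \<mu>))"
    by (rule Cinf_on_derivative_along[OF finite_dim_dual[OF finite_dim] W
          Cinf_on_subset[OF U(3) Int_lower1] Cinf_on_subset[OF V(3) Int_lower2]])
  have eq: "frechet_derivative g (at \<mu>) (Z \<mu>) = frechet_derivative h (at \<mu> within M) (Y \<mu>)"
    if \<mu>: "\<mu> \<in> M \<inter> ?W" for \<mu>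
  proof -
    have "(h has_derivative frechet_derivative g (at \<mu>)) (at \<mu> within M)"
      using \<mu> by (intro has_derivative_local_extension[OF U(1) _ _ Cinf_on_has_derivative[OF U(3)] U(4)]) simp_all
    from frechet_derivative_on_tangent[OF _ Y'(2) this] show ?thesis
      using \<mu> V(4) by simp
  qed
  show "\<exists>U g. open U \<and> \<nu> \<in> U \<and> Cinf_on U g \<and>
      (\<forall>y\<in>M \<inter> U. g y = frechet_derivative h (at y within M) (Y y))"
    using W U(2) V(2) smooth eq
    by (intro exI[of _ ?W] exI[of _ "\<lambda>\<mu>. frechet_derivative g (at \<mu>) (Z \<mu>)"]) simp
qed

lemma iter_deriv_Cons:
  "iter_deriv M (Y # Ys) h = (\<lambda>\<nu>. frechet_derivative (iter_deriv M Ys h) (at \<nu> within M) (Y \<nu>))"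
  by (simp add: iter_deriv_def)

lemma iter_deriv_smooth:
  "set Ys \<subseteq> vector_fields G M \<Longrightarrow> smooth_on M h \<Longrightarrow> smooth_on M (iter_deriv M Ys h)"
proof (induction Ys)
  case Nil
  then show ?case by (simp add: iter_deriv_def)
next
  case (Cons Y Ys)
  show ?case
    unfolding iter_deriv_Cons by (rule smooth_on_derivative_along) (use Cons in simp_all)
qed

lemma smooth_on_id: "smooth_on M id"
  by (rule smooth_on_subset_Cinf_on[OF Cinf_on_bounded_linear_apply[OF open_UNIV bounded_linear_ident]]) simp

text \<open>On the orbit \<open>\<phi>\<close> is \<open>L\<close> composed with the identity, and a bounded linear map commutes with
differentiation along tangent vectors.\<close>

lemma iter_deriv_linear:
  assumes L: "bounded_linear L" and \<phi>: "\<And>\<nu>. \<nu> \<in> M \<Longrightarrow> \<phi> \<nu> = L \<nu>"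
    and "set Ys \<subseteq> vector_fields G M" "\<nu> \<in> M"
  shows "iter_deriv M Ys \<phi> \<nu> = L (iter_deriv M Ys id \<nu>)"
  using assms(3,4)
proof (induction Ys arbitrary: \<nu>)
  case Nil
  then show ?case using \<phi> by (simp add: iter_deriv_def)
next
  case (Cons Y Ys)
  let ?u = "iter_deriv M Ys id"
  have Y: "Y \<nu> \<in> tangent G \<nu>" using Cons.prems by (auto simp: vector_fields_def)
  have "smooth_on M ?u" using Cons.prems by (intro iter_deriv_smooth smooth_on_id) simp
  then have "(?u has_derivative frechet_derivative ?u (at \<nu> within M)) (at \<nu> within M)"
    using Cons.prems(2) by (rule smooth_on_has_derivative)
  then have "((\<lambda>\<mu>. L (?u \<mu>)) has_derivative (\<lambda>v. L (frechet_derivative ?u (at \<nu> within M) v))) (at \<nu> within M)"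
    by (rule bounded_linear.has_derivative[OF L])
  then have "(iter_deriv M Ys \<phi> has_derivative (\<lambda>v. L (frechet_derivative ?u (at \<nu> within M) v))) (at \<nu> within M)"
  proof (rule has_derivative_transform[OF Cons.prems(2), rotated])
    show "iter_deriv M Ys \<phi> \<mu> = L (?u \<mu>)" if "\<mu> \<in> M" for \<mu>
      using Cons.prems(1) that by (intro Cons.IH) simp_all
  qed
  from frechet_derivative_on_tangent[OF Cons.prems(2) Y this]
  show ?case by (simp only: iter_deriv_Cons)
qed

text \<open>The distance between the iterated derivatives of \<open>L p\<close> and \<open>L q\<close> is at most a fixed linear
combination of the distances of their values on basis vectors, since the iterated derivatives of the identity are bounded on
the compact orbit. So the functions that define the subbasis of the topology are continuous in \<open>p\<close>.\<close>

lemma Ham_topology_continuous_linear: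
  fixes L :: "'p::topological_space \<Rightarrow> ('e \<Rightarrow>\<^sub>L real) \<Rightarrow> ('e \<Rightarrow>\<^sub>L real)"
  assumes Ham: "\<And>p. p \<in> S \<Longrightarrow> restrict (L p) M \<in> Ham G M"
    and lin: "\<And>p. p \<in> S \<Longrightarrow> bounded_linear (L p)"
    and cont: "\<And>\<nu>. continuous_on S (\<lambda>p. L p \<nu>)"
  shows "continuous_map (top_of_set S) (Ham_topology G M) (\<lambda>p. restrict (L p) M)"
  unfolding Ham_topology_def
proof (rule continuous_on_generated_topo)
  let ?dist = "\<lambda>Ys \<psi> \<phi>. SUP \<nu>\<in>M. norm (iter_deriv M Ys \<psi> \<nu> - iter_deriv M Ys \<phi> \<nu>)"
  let ?basis = "{{\<psi> \<in> Ham G M. ?dist Ys \<psi> \<phi> < \<epsilon>} |\<phi> Ys \<epsilon>.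
        \<phi> \<in> Ham G M \<and> set Ys \<subseteq> vector_fields G M \<and> \<epsilon> > 0}"
  show "(\<lambda>p. restrict (L p) M) ` topspace (top_of_set S) \<subseteq> \<Union> ?basis"
  proof clarify
    fix p assume "p \<in> topspace (top_of_set S)"
    then have \<phi>: "restrict (L p) M \<in> Ham G M" using Ham by simp
    have "?dist [] (restrict (L p) M) (restrict (L p) M) < 1" using orbit_nonempty by simp
    then have "restrict (L p) M \<in> {\<psi> \<in> Ham G M. ?dist [] \<psi> (restrict (L p) M) < 1}" using \<phi> by simp
    moreover have "{\<psi> \<in> Ham G M. ?dist [] \<psi> (restrict (L p) M) < 1} \<in> ?basis"
      using \<phi> by (intro CollectI exI[of _ "restrict (L p) M"] exI[of _ "[]"] exI[of _ 1]) simp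
    ultimately show "restrict (L p) M \<in> \<Union> ?basis" by blast
  qed
  fix U assume "U \<in> ?basis"
  then obtain \<phi> Ys \<epsilon> where U: "U = {\<psi> \<in> Ham G M. ?dist Ys \<psi> \<phi> < \<epsilon>}"
    and Ys: "set Ys \<subseteq> vector_fields G M" by blast
  let ?u = "iter_deriv M Ys id" and ?w = "iter_deriv M Ys \<phi>"
  define g where "g p = (SUP \<nu>\<in>M. norm (L p (?u \<nu>) - ?w \<nu>))" for p
  have g: "?dist Ys (restrict (L p) M) \<phi> = g p" if "p \<in> S" for p
    unfolding g_def using iter_deriv_linear[OF lin[OF that] _ Ys, of "restrict (L p) M"]
    by (intro SUP_cong) simp_all
  obtain B and c :: "('e \<Rightarrow>\<^sub>L real) \<Rightarrow> ('e \<Rightarrow>\<^sub>L real) \<Rightarrow> real"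
    where Bc: "finite B" "\<And>b. bounded_linear (c b)" "\<And>x. (\<Sum>b\<in>B. c b x *\<^sub>R b) = x"
    using finite_dim_coordinates[OF finite_dim_dual[OF finite_dim]] by blast
  have "\<exists>K. \<forall>\<nu>\<in>M. \<bar>c b (?u \<nu>)\<bar> \<le> K" for b
  proof -
    have "continuous_on M (\<lambda>\<nu>. c b (?u \<nu>))"
      by (intro bounded_linear.continuous_on[OF Bc(2)] smooth_on_continuous_on iter_deriv_smooth Ys smooth_on_id)
    from compact_imp_bounded[OF compact_continuous_image[OF this orbit_compact]]
    show ?thesis by (auto simp: bounded_iff)
  qed
  then obtain K where K: "\<And>b \<nu>. \<nu> \<in> M \<Longrightarrow> \<bar>c b (?u \<nu>)\<bar> \<le> K b" by metis
  define \<rho> where "\<rho> p q = (\<Sum>b\<in>B. K b * norm (L p b - L q b))" for p q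
  have diff: "\<bar>g p - g q\<bar> \<le> \<rho> p q" if pq: "p \<in> S" "q \<in> S" for p q
    unfolding g_def
  proof (rule abs_SUP_diff_le[OF orbit_nonempty])
    fix \<nu> assume \<nu>: "\<nu> \<in> M"
    have expand: "L r x = (\<Sum>b\<in>B. c b x *\<^sub>R L r b)" if "r \<in> S" for r x
      by (rule linear_coordinate_expansion[OF bounded_linear.linear[OF lin[OF that]] Bc(3), symmetric])
    have "\<bar>norm (L p (?u \<nu>) - ?w \<nu>) - norm (L q (?u \<nu>) - ?w \<nu>)\<bar> \<le> norm (L p (?u \<nu>) - L q (?u \<nu>))"
      using norm_triangle_ineq3[of "L p (?u \<nu>) - ?w \<nu>" "L q (?u \<nu>) - ?w \<nu>"] by simp
    also have "L p (?u \<nu>) - L q (?u \<nu>) = (\<Sum>b\<in>B. c b (?u \<nu>) *\<^sub>R (L p b - L q b))"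
      unfolding expand[OF pq(1), of "?u \<nu>"] expand[OF pq(2), of "?u \<nu>"]
      by (simp add: sum_subtractf scaleR_diff_right)
    also have "norm \<dots> \<le> (\<Sum>b\<in>B. \<bar>c b (?u \<nu>)\<bar> * norm (L p b - L q b))"
      by (rule order_trans[OF norm_sum]) simp
    also have "\<dots> \<le> \<rho> p q"
      unfolding \<rho>_def by (intro sum_mono mult_right_mono K[OF \<nu>] norm_ge_zero)
    finally show "\<bar>norm (L p (?u \<nu>) - ?w \<nu>) - norm (L q (?u \<nu>) - ?w \<nu>)\<bar> \<le> \<rho> p q" .
  qed
  have "continuous_on S g"
    unfolding continuous_on_def
  proof
    fix q assume q: "q \<in> S"
    have "continuous_on S (\<lambda>p. \<rho> p q)" unfolding \<rho>_def by (intro continuous_intros cont)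
    then have "((\<lambda>p. \<rho> p q) \<longlongrightarrow> \<rho> q q) (at q within S)" using q by (simp add: continuous_on_def)
    then have "((\<lambda>p. \<rho> p q) \<longlongrightarrow> 0) (at q within S)" by (simp add: \<rho>_def)
    then have "((\<lambda>p. g p - g q) \<longlongrightarrow> 0) (at q within S)"
      by (rule Lim_null_comparison[rotated]) (use diff q in \<open>simp add: eventually_at_topological, blast\<close>)
    then show "(g \<longlongrightarrow> g q) (at q within S)" by (simp add: LIM_zero_iff)
  qed
  then have "openin (top_of_set S) (S \<inter> g -` {..<\<epsilon>})"
    by (intro continuous_openin_preimage_gen open_lessThan)
  moreover have "(\<lambda>p. restrict (L p) M) -` U \<inter> topspace (top_of_set S) = S \<inter> g -` {..<\<epsilon>}"
    using g Ham by (auto simp: U)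
  ultimately show "openin (top_of_set S) ((\<lambda>p. restrict (L p) M) -` U \<inter> topspace (top_of_set S))" by simp
qed

section \<open>Conjugate circle actions\<close>

lemma circle_actions_conj_equivalent:
  assumes conn: "connected_space (gtop G)" and \<gamma>: "one_param_subgroup G \<gamma> X" and closed: "\<gamma> 1 = \<one>"
    and g: "g \<in> carrier G"
  shows "circle_equivalent G M (circle_action G M X) (circle_action G M (Ad G g X))"
proof -
  obtain n where n: "continuous_map (top_of_set {0..1::real}) (gtop G) n" "n 0 = \<one>" "n 1 = g"
    using connected_manifold_path[OF manifold, of \<one> g] conn g by auto
  have n_car: "n s \<in> carrier G" if "s \<in> {0..1}" for s
    using n(1) that by (auto simp: continuous_map_def Pi_iff)
  have conj: "one_param_subgroup G (\<lambda>t. n s \<otimes> \<gamma> t \<otimes> inv (n s)) (Ad G (n s) X)" if "s \<in> {0..1}" for s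
    by (rule one_param_subgroup_conj[OF \<gamma> n_car[OF that]])
  let ?\<Psi> = "\<lambda>s. circle_action G M (Ad G (n s) X)"
  let ?L = "\<lambda>(s, t). coAd G (n s \<otimes> \<gamma> t \<otimes> inv (n s))"
  have "hamiltonian_circle_action G M (?\<Psi> s)" if "s \<in> {0..1}" for s
    by (rule hamiltonian_circle_action_coAd[OF conj[OF that]]) (simp add: closed n_car[OF that])
  moreover have "continuous_map (top_of_set ({0..1} \<times> UNIV)) (Ham_topology G M) (\<lambda>(s, t). ?\<Psi> s t)"
  proof (rule continuous_map_eq)
    show "continuous_map (top_of_set ({0..1} \<times> UNIV)) (Ham_topology G M) (\<lambda>p. restrict (?L p) M)"
    proof (rule Ham_topology_continuous_linear)
      fix p :: "real \<times> real" assume p: "p \<in> {0..1} \<times> UNIV"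
      then show "restrict (?L p) M \<in> Ham G M"
        using coAd_flow_Ham[OF conj] by auto
      show "bounded_linear (?L p)"
        using coAd_bounded_linear one_param_subgroup_carrier[OF conj] p by auto
    next
      fix \<nu>
      let ?T = "top_of_set ({0..1::real} \<times> (UNIV :: real set))"
      have "continuous_map ?T (top_of_set {0..1}) fst" "continuous_map ?T euclideanreal snd"
        by (auto simp: continuous_map_in_subtopology intro: continuous_on_fst continuous_on_snd)
      from continuous_map_compose[OF this(1) n(1)]
        continuous_map_compose[OF this(2) one_param_subgroup_continuous[OF \<gamma>]]
      have "continuous_map ?T (gtop G) (\<lambda>p. n (fst p))" "continuous_map ?T (gtop G) (\<lambda>p. \<gamma> (snd p))"
        by (simp_all add: comp_def)
      then have "continuous_map ?T (gtop G) (\<lambda>p. n (fst p) \<otimes> \<gamma> (snd p) \<otimes> inv (n (fst p)))"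
        by (intro continuous_map_mult continuous_map_inverse)
      from coAd_continuous[OF this, of \<nu>]
      show "continuous_on ({0..1} \<times> UNIV) (\<lambda>p. ?L p \<nu>)"
        by (simp add: case_prod_beta')
    qed
    fix p :: "real \<times> real" assume "p \<in> topspace (top_of_set ({0..1} \<times> UNIV))"
    then show "restrict (?L p) M = (case p of (s, t) \<Rightarrow> ?\<Psi> s t)"
      using circle_action_eq[OF conj] by auto
  qed
  moreover have "?\<Psi> 0 = circle_action G M X" "?\<Psi> 1 = circle_action G M (Ad G g X)"
    by (simp_all add: n(2,3) Ad_one)
  ultimately show ?thesis unfolding circle_equivalent_def by (intro exI[of _ ?\<Psi>]) blast
qed

end

theorem theorem9:
  fixes G :: "('g, 'e::real_normed_vector, 'm) lie_data_scheme"
    and \<eta> :: "'e \<Rightarrow>\<^sub>L real" and H :: "'g set" and X X' :: 'e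
  assumes "lie_group G" "compact_space (gtop G)" "connected_space (gtop G)"
    and "maximal_torus G H" "H \<subseteq> stabilizer G (coAd G) \<eta>"
    and "X \<in> integer_lattice G H" "X' \<in> integer_lattice G H"
    and "\<exists>w\<in>carrier (weyl_group G H). weyl_act G w X = X'"
  shows "circle_equivalent G (coadjoint_orbit G \<eta>)
    (circle_action G (coadjoint_orbit G \<eta>) X) (circle_action G (coadjoint_orbit G \<eta>) X')"
proof -
  interpret coadjoint_orbit_structure G \<eta>
    using assms(1,2) by unfold_locales
  obtain \<gamma> where \<gamma>: "one_param_subgroup G \<gamma> X" and "lie_exp G X = \<one>\<^bsub>G\<^esub>"
    using assms(6) by (auto simp: integer_lattice_def lie_subalgebra_of_def)
  then have closed: "\<gamma> 1 = \<one>\<^bsub>G\<^esub>"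
    using lie_exp_one_param_subgroup[OF \<gamma>, of 1] by simp
  obtain w where w: "w \<in> carrier (weyl_group G H)" "weyl_act G w X = X'" using assms(8) by blast
  have H: "subgroup H G" using assms(4) by (simp add: maximal_torus_def torus_def)
  have "normalizer G H \<subseteq> carrier G" by (auto simp: normalizer_def stabilizer_def)
  moreover obtain n where n: "n \<in> normalizer G H" "w = H #>\<^bsub>G\<^esub> n"
    using w(1) by (auto simp: weyl_group_def FactGroup_def RCOSETS_def r_coset_def)
  ultimately have "n \<in> w" "w \<subseteq> carrier G"
    using H rcos_self[of n H] r_coset_subset_G[OF subgroup.subset[OF H]] by auto
  then have "(SOME g. g \<in> w) \<in> carrier G" by (metis someI_ex subsetD)
  from circle_actions_conj_equivalent[OF assms(3) \<gamma> closed this]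
  show ?thesis using w(2) by (simp add: weyl_act_def)
qed

end
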